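(* Let $k$ be a positive integer and $c>0$. The map $\Psi_c:D\to D$ has a unique fixed point.
   Context: The first order language of rooted trees has a constant symbol $R$ (the root), equality, and the parent relation $\pi[v]=w$ ("$w$ is the parent of $v$"); sentences are finite, with Boolean connectives and quantification over vertices, and the quantifier depth of a sentence is the depth of nesting of its quantifiers. Fix a positive integer $k$. For rooted trees (finite or infinite), $T\equiv_k T'$ means that $T,T'$ have the same truth value for all first order sentences of quantifier depth at most $k$ (equivalently, Duplicator wins the $k$-move Ehrenfeucht game on $T,T'$). The set $\Sigma=\Sigma_k$ of equivalence classes is finite; write $\Sigma=\{1,\ldots,m\}$. $EV[T]\in\Sigma$ denotes the class of $T$. $D=\{(x_1,\ldots,x_m)\in\mathbb{R}^m:\sum_j x_j=1,\ x_j\ge 0\}$ is the set of probability distributions on $\Sigma$. Let $C=\{0,1,\ldots,k-1,\omega\}$, where a count of $\omega$ means "at least $k$" and a count $n\ne\omega$ means exactly $n$. $T(v)$ denotes the rooted tree consisting of $v$ and all its descendants, with root $v$. A rootchild is a child of the root. The recursion function $\Gamma:C^m\to\Sigma$ is given by: $\Gamma(n_1,\ldots,n_m)$ is the class $EV[T]$ of any rooted tree $T$ which for each $j$ has $n_j$ rootchildren $v$ with $EV[T(v)]=j$ (this class depends only on $(n_1,\ldots,n_m)$). $\Psi_c:D\to D$ is defined as follows: give a root a Poisson($c$) number of children, assign each child independently a label in $\Sigma$ with distribution $\vec{x}$, and let $n_j\in C$ be the number of children with label $j$ (with $\omega$ recorded when there are at least $k$); $\Psi_c(\vec{x})$ is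 the distribution of $\Gamma(n_1,\ldots,n_m)$. Equivalently, the $j$-th coordinate of $\Psi_c(\vec{x})$ is $\sum_{\vec{a}\in C^m:\Gamma(\vec{a})=j}\prod_{i=1}^m p_i(a_i)$, where $p_i(u)=e^{-cx_i}(cx_i)^u/u!$ for $u\in\{0,\ldots,k-1\}$ and $p_i(\omega)=1-\sum_{u=0}^{k-1}p_i(u)$. *)

theory Defs
  imports "HOL-Probability.Probability" "HOL-Combinatorics.Multiset_Permutations"
begin

record 'v rtree =
  verts :: "'v set"
  root :: 'v
  parent :: "('v \<times> 'v) set"

text \<open>A pair \<open>(v, w)\<close> in \<open>parent T\<close> means that \<open>w\<close> is the parent of \<open>v\<close>.
  Vertices come from a fixed type \<open>'v\<close>, so that the equivalence classes below are sets. If \<open>'v\<close>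
  is infinite, every tree (even one too large to embed in \<open>'v\<close>) is elementarily equivalent to one
  over \<open>'v\<close>, by Loewenheim-Skolem: an elementary substructure of a tree is again a tree.\<close>

definition rooted_tree :: "'v rtree \<Rightarrow> bool" where
  "rooted_tree T \<longleftrightarrow>
     root T \<in> verts T \<and>
     parent T \<subseteq> verts T \<times> verts T \<and>
     (\<forall>w. (root T, w) \<notin> parent T) \<and>
     (\<forall>v\<in>verts T - {root T}. \<exists>!w. (v, w) \<in> parent T) \<and>
     (\<forall>v\<in>verts T. (v, root T) \<in> (parent T)\<^sup>*)"

definition subtree :: "'v rtree \<Rightarrow> 'v \<Rightarrow> 'v rtree" where
  "subtree T v =
     (let V = {u \<in> verts T. (u, v) \<in> (parent T)\<^sup>*}
      in \<lparr>verts = V, root = v, parent = parent T \<inter> (V \<times> V)\<rparr>)"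

definition rootchildren :: "'v rtree \<Rightarrow> 'v set" where
  "rootchildren T = {v \<in> verts T. (v, root T) \<in> parent T}"

datatype trm = Root | Var nat

text \<open>\<open>Par s t\<close> is the atomic formula \<open>\<pi>[s] = t\<close>. The remaining connectives and the
  universal quantifier are definable without increasing the quantifier depth.\<close>

datatype fm =
    Eq trm trm
  | Par trm trm
  | Neg fm
  | Conj fm fm
  | Ex nat fm

primrec qdepth :: "fm \<Rightarrow> nat" where
  "qdepth (Eq s t) = 0"
| "qdepth (Par s t) = 0"
| "qdepth (Neg \<phi>) = qdepth \<phi>"
| "qdepth (Conj \<phi> \<psi>) = max (qdepth \<phi>) (qdepth \<psi>)"
| "qdepth (Ex x \<phi>) = Suc (qdepth \<phi>)"

primrec fv_trm :: "trm \<Rightarrow> nat set" where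
  "fv_trm Root = {}"
| "fv_trm (Var x) = {x}"

primrec fv :: "fm \<Rightarrow> nat set" where
  "fv (Eq s t) = fv_trm s \<union> fv_trm t"
| "fv (Par s t) = fv_trm s \<union> fv_trm t"
| "fv (Neg \<phi>) = fv \<phi>"
| "fv (Conj \<phi> \<psi>) = fv \<phi> \<union> fv \<psi>"
| "fv (Ex x \<phi>) = fv \<phi> - {x}"

definition sentence :: "fm \<Rightarrow> bool" where
  "sentence \<phi> \<longleftrightarrow> fv \<phi> = {}"

primrec val :: "'v rtree \<Rightarrow> (nat \<Rightarrow> 'v) \<Rightarrow> trm \<Rightarrow> 'v" where
  "val T e Root = root T"
| "val T e (Var x) = e x"

primrec sat :: "'v rtree \<Rightarrow> (nat \<Rightarrow> 'v) \<Rightarrow> fm \<Rightarrow> bool" where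
  "sat T e (Eq s t) \<longleftrightarrow> val T e s = val T e t"
| "sat T e (Par s t) \<longleftrightarrow> (val T e s, val T e t) \<in> parent T"
| "sat T e (Neg \<phi>) \<longleftrightarrow> \<not> sat T e \<phi>"
| "sat T e (Conj \<phi> \<psi>) \<longleftrightarrow> sat T e \<phi> \<and> sat T e \<psi>"
| "sat T e (Ex x \<phi>) \<longleftrightarrow> (\<exists>v\<in>verts T. sat T (e(x := v)) \<phi>)"

text \<open>The assignment is irrelevant for sentences, so any fixed one will do.\<close>

definition models :: "'v rtree \<Rightarrow> fm \<Rightarrow> bool" where
  "models T \<phi> \<longleftrightarrow> sat T (\<lambda>_. root T) \<phi>"

definition equiv_k :: "nat \<Rightarrow> ('v rtree \<times> 'v rtree) set" where
  "equiv_k k = {(T, T'). rooted_tree T \<and> rooted_tree T' \<and>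
     (\<forall>\<phi>. sentence \<phi> \<and> qdepth \<phi> \<le> k \<longrightarrow> (models T \<phi> \<longleftrightarrow> models T' \<phi>))}"

definition EV :: "nat \<Rightarrow> 'v rtree \<Rightarrow> 'v rtree set" where
  "EV k T = equiv_k k `` {T}"

text \<open>\<open>classes k\<close> is \<open>\<Sigma>\<close>; instead of numbering the classes \<open>1, \<dots>, m\<close>, vectors are indexed
  by the classes themselves, as functions that are \<open>extensional\<close> on \<open>classes k\<close>.\<close>

definition classes :: "nat \<Rightarrow> 'v rtree set set" where
  "classes k = {T. rooted_tree T} // equiv_k k"

definition dists :: "nat \<Rightarrow> ('v rtree set \<Rightarrow> real) set" where
  "dists k = {x \<in> classes k \<rightarrow>\<^sub>E {0..}. (\<Sum>j\<in>classes k. x j) = 1}"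

datatype cnt = Exactly nat | Omega

definition counts :: "nat \<Rightarrow> cnt set" where
  "counts k = insert Omega (Exactly ` {..<k})"

definition num :: "nat \<Rightarrow> 'b set \<Rightarrow> cnt" where
  "num k A = (if finite A \<and> card A < k then Exactly (card A) else Omega)"

definition child_counts :: "nat \<Rightarrow> 'v rtree \<Rightarrow> 'v rtree set \<Rightarrow> cnt" where
  "child_counts k T = (\<lambda>j\<in>classes k. num k {v \<in> rootchildren T. EV k (subtree T v) = j})"

definition recGamma :: "nat \<Rightarrow> ('v rtree set \<Rightarrow> cnt) \<Rightarrow> 'v rtree set" where
  "recGamma k n = (THE j. \<exists>T. rooted_tree T \<and> child_counts k T = n \<and> EV k T = j)"

text \<open>\<open>cnt_prob k r a\<close> is the probability that a Poisson variable of mean \<open>r\<close> has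
  truncated value \<open>a\<close>. For \<open>r = 0\<close> this is the point mass at \<open>0\<close>, since \<open>0 ^ 0 = 1\<close>.\<close>

primrec cnt_prob :: "nat \<Rightarrow> real \<Rightarrow> cnt \<Rightarrow> real" where
  "cnt_prob k r (Exactly u) = exp (- r) * r ^ u / fact u"
| "cnt_prob k r Omega = 1 - (\<Sum>u<k. exp (- r) * r ^ u / fact u)"

definition Psi :: "nat \<Rightarrow> real \<Rightarrow> ('v rtree set \<Rightarrow> real) \<Rightarrow> ('v rtree set \<Rightarrow> real)" where
  "Psi k c x = (\<lambda>j\<in>classes k.
     \<Sum>a | a \<in> (classes k \<rightarrow>\<^sub>E counts k) \<and> recGamma k a = j.
       \<Prod>i\<in>classes k. cnt_prob k (c * x i) (a i))"

text \<open>On distributions, \<open>Psi k c x\<close> is the law of \<open>recGamma\<close> applied to the truncated label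
  counts of a Poisson number of children with independent labels of law \<open>x\<close>.\<close>

lemma pmf_replicate_pmf:
  "pmf (replicate_pmf n X) xs = (if length xs = n then prod_list (map (pmf X) xs) else 0)"
proof (induction n arbitrary: xs)
  case 0
  show ?case by (auto simp: indicator_def)
next
  case (Suc n)
  have eq: "replicate_pmf (Suc n) X = map_pmf (\<lambda>(x, xs). x # xs) (pair_pmf X (replicate_pmf n X))"
    by (simp add: pair_pmf_def map_pmf_def bind_assoc_pmf bind_return_pmf)
  show ?case
  proof (cases xs)
    case Nil
    then show ?thesis unfolding eq
      by (auto simp: pmf_eq_0_set_pmf)
  next
    case (Cons y ys)
    have "inj (\<lambda>(x :: 'a, xs). x # xs)" by (auto simp: inj_def)
    from pmf_map_inj'[OF this, of "pair_pmf X (replicate_pmf n X)" "(y, ys)"]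
    show ?thesis unfolding eq Cons by (simp add: pmf_pair Suc.IH)
  qed
qed

lemma poisson_labels_counts:
  fixes X :: "'b pmf"
  assumes c: "0 < c" and S: "finite S" "set_pmf X \<subseteq> S"
  shows "map_pmf count_list (bind_pmf (poisson_pmf c) (\<lambda>n. replicate_pmf n X)) =
    Pi_pmf S 0 (\<lambda>i. if pmf X i = 0 then return_pmf 0 else poisson_pmf (c * pmf X i))"
    (is "map_pmf _ ?L = Pi_pmf S 0 ?q")
proof (rule pmf_eqI)
  fix f :: "'b \<Rightarrow> nat"
  have q: "pmf (?q i) u = exp (- (c * pmf X i)) * (c * pmf X i) ^ u / fact u" for i u
  proof (cases "pmf X i = 0")
    case True
    then show ?thesis by (cases u) auto
  next
    case False
    then have "0 < c * pmf X i" using c by (simp add: pmf_positive_iff less_le)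
    then show ?thesis using False by simp
  qed
  have L: "pmf ?L xs = c ^ length xs / fact (length xs) * exp (- c) * prod_list (map (pmf X) xs)"
    for xs
  proof -
    have "pmf ?L xs = (\<integral>n. pmf (replicate_pmf n X) xs \<partial>poisson_pmf c)"
      by (simp add: pmf_bind)
    also have "\<dots> = (\<Sum>n\<in>{length xs}. pmf (replicate_pmf n X) xs * pmf (poisson_pmf c) n)"
      by (rule integral_measure_pmf_real) (auto simp: pmf_replicate_pmf split: if_splits)
    also have "\<dots> = c ^ length xs / fact (length xs) * exp (- c) * prod_list (map (pmf X) xs)"
      using c by (simp add: pmf_replicate_pmf)
    finally show ?thesis .
  qed
  have m: "pmf (map_pmf count_list ?L) f = measure_pmf.prob ?L (count_list -` {f})"
    by (simp add: pmf_map)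
  show "pmf (map_pmf count_list ?L) f = pmf (Pi_pmf S 0 ?q) f"
  proof (cases "\<forall>i. i \<notin> S \<longrightarrow> f i = 0")
    case False
    then obtain i where i: "i \<notin> S" "f i \<noteq> 0" by blast
    have "set_pmf ?L \<inter> count_list -` {f} = {}"
    proof -
      have "count_list xs i = 0" if "xs \<in> set_pmf ?L" for xs
        using that i S by (auto simp: set_replicate_pmf count_list_0_iff)
      then show ?thesis using i by fastforce
    qed
    then have "measure_pmf.prob ?L (count_list -` {f}) = 0"
      by (simp add: measure_pmf_zero_iff)
    then show ?thesis using pmf_Pi_outside[OF S(1), of f 0 ?q] False by (simp add: m)
  next
    case True
    define M where "M = Abs_multiset f"
    have "finite {i. 0 < f i}"
      by (rule finite_subset[OF _ S(1)]) (use True in auto)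
    then have cM: "count M = f" by (simp add: M_def Abs_multiset_inverse)
    have MS: "set_mset M \<subseteq> S" using True cM by (metis count_eq_zero_iff subsetI)
    have pre: "count_list -` {f} = permutations_of_multiset M"
    proof -
      have "count_list xs = f \<longleftrightarrow> mset xs = M" for xs
      proof -
        have "count_list xs = count (mset xs)" by (auto simp: count_mset)
        then show ?thesis using cM by (metis count_inject)
      qed
      then show ?thesis by (auto simp: permutations_of_multiset_def)
    qed
    have pl: "prod_list (map (pmf X) xs) = (\<Prod>i\<in>S. pmf X i ^ f i)" if "mset xs = M" for xs
    proof -
      have "prod_list (map (pmf X) xs) = prod_mset (image_mset (pmf X) M)"
        using that by (metis mset_map prod_mset_prod_list)
      also have "\<dots> = (\<Prod>i\<in>set_mset M. pmf X i ^ f i)"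
        by (simp add: image_prod_mset_multiplicity cM)
      also have "\<dots> = (\<Prod>i\<in>S. pmf X i ^ f i)"
        using MS cM S by (intro prod.mono_neutral_left) (auto simp: not_in_iff)
      finally show ?thesis .
    qed
    have size: "size M = (\<Sum>i\<in>S. f i)"
      unfolding size_multiset_overloaded_eq cM
      using MS cM S by (intro sum.mono_neutral_left) (auto simp: not_in_iff)
    have pfact: "(\<Prod>i\<in>set_mset M. fact (f i)) = (\<Prod>i\<in>S. fact (f i) :: nat)"
      using MS cM S by (intro prod.mono_neutral_left) (auto simp: not_in_iff)
    have card: "real (card (permutations_of_multiset M)) * (\<Prod>i\<in>S. fact (f i)) = fact (size M)"
    proof -
      have "card (permutations_of_multiset M) * (\<Prod>i\<in>S. fact (f i)) = fact (size M)"
        using card_permutations_of_multiset_aux[of M] by (simp add: cM pfact)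
      then have "real (card (permutations_of_multiset M) * (\<Prod>i\<in>S. fact (f i))) = real (fact (size M))"
        by simp
      then show ?thesis by (simp add: of_nat_prod)
    qed
    have sum1: "(\<Sum>i\<in>S. pmf X i) = 1"
      using S by (rule sum_pmf_eq_1)
    have "pmf (map_pmf count_list ?L) f = (\<Sum>xs\<in>permutations_of_multiset M. pmf ?L xs)"
      unfolding m pre by (rule measure_measure_pmf_finite) simp
    also have "\<dots> = (\<Sum>xs\<in>permutations_of_multiset M.
        c ^ size M / fact (size M) * exp (- c) * (\<Prod>i\<in>S. pmf X i ^ f i))"
      unfolding L by (intro sum.cong refl)
        (auto simp: permutations_of_multiset_def pl simp flip: size_mset)
    also have "\<dots> = real (card (permutations_of_multiset M)) / fact (size M) *
        (c ^ size M * exp (- c) * (\<Prod>i\<in>S. pmf X i ^ f i))"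
      by simp
    also have "real (card (permutations_of_multiset M)) / fact (size M) =
        1 / (\<Prod>i\<in>S. fact (f i))"
      using card by (simp add: field_simps S)
    also have "c ^ size M = (\<Prod>i\<in>S. c ^ f i)"
      by (simp add: size power_sum)
    also have "exp (- c) = (\<Prod>i\<in>S. exp (- (c * pmf X i)))"
      using sum1 S by (simp flip: exp_sum add: sum_negf sum_distrib_left[symmetric])
    also have "1 / (\<Prod>i\<in>S. fact (f i)) * ((\<Prod>i\<in>S. c ^ f i) *
        (\<Prod>i\<in>S. exp (- (c * pmf X i))) * (\<Prod>i\<in>S. pmf X i ^ f i)) = (\<Prod>i\<in>S. pmf (?q i) (f i))"
      unfolding q by (simp add: prod_dividef prod.distrib power_mult_distrib)
    also have "\<dots> = pmf (Pi_pmf S 0 ?q) f"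
      using S True by (simp add: pmf_Pi)
    finally show ?thesis .
  qed
qed

lemma Psi_eq_pmf:
  fixes x :: "'v rtree set \<Rightarrow> real"
  assumes c: "0 < c" and x: "x \<in> dists k"
    and X: "\<And>i. i \<in> classes k \<Longrightarrow> pmf X i = x i" and j: "j \<in> classes k"
  shows "Psi k c x j = pmf (do {
      n \<leftarrow> poisson_pmf c;
      xs \<leftarrow> replicate_pmf n X;
      return_pmf (recGamma k (\<lambda>i\<in>classes k. num k {l. l < length xs \<and> xs ! l = i}))
    }) j"
proof -
  let ?S = "classes k :: 'v rtree set set"
  have s1: "(\<Sum>i\<in>?S. x i) = 1" using x by (simp add: dists_def)
  then have fin: "finite ?S" by (metis sum.infinite zero_neq_one)
  have sub: "set_pmf X \<subseteq> ?S"
  proof -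
    have "measure_pmf.prob X ?S = 1"
      using s1 fin X by (simp add: measure_measure_pmf_finite)
    then show ?thesis by (simp add: measure_pmf.prob_eq_1 AE_measure_pmf_iff subset_iff)
  qed
  define q where "q i = (if pmf X i = 0 then return_pmf 0 else poisson_pmf (c * pmf X i))" for i
  define tr where "tr u = (if u < k then Exactly u else Omega)" for u
  let ?L = "bind_pmf (poisson_pmf c) (\<lambda>n. replicate_pmf n X)"
  let ?h = "\<lambda>f. \<lambda>i\<in>?S. tr (f i)"
  have qp: "pmf (q i) u = exp (- (c * pmf X i)) * (c * pmf X i) ^ u / fact u" for i u
  proof (cases "pmf X i = 0")
    case True
    then show ?thesis by (cases u) (auto simp: q_def)
  next
    case False
    then have "0 < c * pmf X i" using c by (simp add: pmf_positive_iff less_le)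
    then show ?thesis using False by (simp add: q_def)
  qed
  have num: "num k {l. l < length xs \<and> xs ! l = i} = tr (count_list xs i)"
    for xs :: "'v rtree set list" and i
  proof -
    have "card {l. l < length xs \<and> xs ! l = i} = count_list xs i"
      by (simp add: count_list_eq_length_filter length_filter_conv_card eq_commute)
    then show ?thesis by (simp add: num_def tr_def)
  qed
  have trp: "pmf (map_pmf tr (q i)) a = cnt_prob k (c * pmf X i) a" if "a \<in> counts k" for i a
  proof (cases a)
    case (Exactly u)
    then have "tr -` {a} = {u}" using that by (auto simp: tr_def counts_def split: if_splits)
    then show ?thesis using Exactly by (simp add: pmf_map measure_pmf_single qp)
  next
    case Omega
    then have "tr -` {a} = UNIV - {..<k}" by (auto simp: tr_def split: if_splits)
    moreover have "measure_pmf.prob (q i) (UNIV - {..<k}) = 1 - measure_pmf.prob (q i) {..<k}"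
      using measure_pmf.prob_compl[of "{..<k}" "q i"] by simp
    ultimately show ?thesis using Omega
      by (simp add: pmf_map measure_measure_pmf_finite qp)
  qed
  have law: "map_pmf (\<lambda>xs. \<lambda>i\<in>?S. num k {l. l < length xs \<and> xs ! l = i}) ?L
      = Pi_pmf ?S undefined (\<lambda>i. map_pmf tr (q i))" (is "?N = ?P")
  proof -
    have "?N = map_pmf ?h (map_pmf count_list ?L)"
      by (simp add: num pmf.map_comp o_def)
    also have "\<dots> = map_pmf ?h (Pi_pmf ?S 0 q)"
      using poisson_labels_counts[OF c fin sub] by (simp add: q_def[abs_def])
    also have "\<dots> = map_pmf (\<lambda>g i. if i \<in> ?S then g i else undefined)
        (map_pmf (\<lambda>f. tr \<circ> f) (Pi_pmf ?S 0 q))"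
      by (simp add: pmf.map_comp o_def restrict_def)
    also have "\<dots> = map_pmf (\<lambda>g i. if i \<in> ?S then g i else undefined)
        (Pi_pmf ?S (tr 0) (\<lambda>i. map_pmf tr (q i)))"
      using fin by (simp add: Pi_pmf_map)
    also have "\<dots> = ?P"
      by (rule Pi_pmf_default_swap[OF fin])
    finally show ?thesis .
  qed
  have trc: "tr u \<in> counts k" for u by (auto simp: tr_def counts_def)
  have finC: "finite (?S \<rightarrow>\<^sub>E counts k)"
    using fin by (intro finite_PiE) (auto simp: counts_def)
  have supp: "set_pmf ?P \<subseteq> (?S \<rightarrow>\<^sub>E counts k)"
  proof -
    have "set_pmf ?P = set_pmf ?N" by (simp only: law)
    also have "\<dots> \<subseteq> (?S \<rightarrow>\<^sub>E counts k)" by (auto simp: num trc)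
    finally show ?thesis .
  qed
  have "pmf (map_pmf (recGamma k) ?P) j = measure_pmf.prob ?P (recGamma k -` {j})"
    by (simp add: pmf_map)
  also have "\<dots> = measure_pmf.prob ?P {a \<in> ?S \<rightarrow>\<^sub>E counts k. recGamma k a = j}"
    using supp by (intro measure_pmf.finite_measure_eq_AE) (auto simp: AE_measure_pmf_iff)
  also have "\<dots> = (\<Sum>a | a \<in> (?S \<rightarrow>\<^sub>E counts k) \<and> recGamma k a = j. pmf ?P a)"
    using finC by (intro measure_measure_pmf_finite) simp
  also have "\<dots> = Psi k c x j"
  proof -
    have "pmf ?P a = (\<Prod>i\<in>?S. cnt_prob k (c * x i) (a i))" if "a \<in> ?S \<rightarrow>\<^sub>E counts k" for a
    proof -
      have "pmf ?P a = (\<Prod>i\<in>?S. pmf (map_pmf tr (q i)) (a i))"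
        using that fin by (subst pmf_Pi') (auto simp: PiE_def extensional_def)
      also have "\<dots> = (\<Prod>i\<in>?S. cnt_prob k (c * x i) (a i))"
        using that by (intro prod.cong refl, subst trp) (auto simp: X)
      finally show ?thesis .
    qed
    then show ?thesis using j by (simp add: Psi_def)
  qed
  finally show ?thesis
    unfolding law[symmetric]
    by (simp add: map_pmf_def bind_assoc_pmf bind_return_pmf)
qed

end

theory Submission
  imports Defs
begin

text \<open>A depth-\<open>k\<close> sentence is decided by the neighbourhood of the root, once the tree contains a
  suitable finite tree \<open>U\<close> as a full subtree \<open>T(v)\<close>: by the usual locality strategy for the
  Ehrenfeucht game, a vertex far from all pebbles can be answered inside \<open>U\<close>, provided that \<open>U\<close>
  has enough disjoint copies of every tree of bounded depth, up to equivalence.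

  Grow the Poisson tree for \<open>s\<close> generations and hang representatives of random classes
  below the last one. The class of the root then has law \<open>Psi ^^ s\<close> applied to the law of
  the classes at the bottom, and it does not depend on these classes unless the tree survives for
  \<open>s\<close> generations without containing \<open>U\<close>. With \<open>g s\<close> and \<open>e s\<close> the probabilities that \<open>U\<close> does
  not occur, and that moreover the tree is extinct, both sequences satisfy
  \<open>x (s + 1) = exp (c * (x s - 1)) - \<delta>\<close> for large \<open>s\<close>, where \<open>\<delta> > 0\<close> is the probability of \<open>U\<close>; so
  \<open>g s - e s\<close> tends to \<open>0\<close> geometrically, by convexity. Hence the iterates of \<open>Psi\<close> merge
  uniformly on the distributions, which gives existence and uniqueness of the fixed point.\<close>

section \<open>Back-and-forth systems\<close>

text \<open>For \<open>c > 1\<close> the tree survives with positive probability, and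
  \<open>Psi k c\<close> is not an evident contraction of the distributions. So two labelings of one
  random tree are compared instead of two distributions: all of the logic is condensed into the
  question whether the class of the root is already forced, and only two numbers per generation have
  to be followed. An extinct tree without \<open>U\<close> is beyond the locality argument but has
  no labels that could matter; hence the second sequence \<open>e s\<close>.

  \<open>U\<close> has to be finite in order to have positive probability, although trees of bounded
  depth may branch infinitely. Since classes of rank \<open>K\<close> see the number of children of
  each class only up to \<open>K\<close>, every tree of bounded depth has a finite equivalent, and
  there are finitely many classes to represent. The rank \<open>K\<close> exceeds \<open>k\<close>,
  because it costs rounds to copy the ball around a pebble and to certify that answers stay inside
  it.

  The root counts as a pebble from the start. Hence a vertex far from all pebbles is deep in the
  tree, and the ball around it lies in a full subtree, as the copies in \<open>U\<close> do.\<close>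

definition partial_iso :: "('a \<times> 'a) set \<Rightarrow> ('b \<times> 'b) set \<Rightarrow> ('a \<times> 'b) set \<Rightarrow> bool" where
  "partial_iso E E' P \<longleftrightarrow> (\<forall>(a, b)\<in>P. \<forall>(a', b')\<in>P.
     (a = a' \<longleftrightarrow> b = b') \<and> ((a, a') \<in> E \<longleftrightarrow> (b, b') \<in> E'))"

lemma partial_isoD:
  assumes "partial_iso E E' P" "(a, b) \<in> P" "(a', b') \<in> P"
  shows "a = a' \<longleftrightarrow> b = b'" "(a, a') \<in> E \<longleftrightarrow> (b, b') \<in> E'"
  using bspec[OF bspec[OF assms(1)[unfolded partial_iso_def] assms(2), simplified] assms(3)] by simp_all

text \<open>The move sets \<open>V\<close> and \<open>V'\<close> are kept apart from the relations,
  so that a game can be confined to a subtree or to a ball while \<open>P\<close> and the relations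
  remain those of the whole trees.\<close>

primrec back_forth ::
    "('a \<times> 'a) set \<Rightarrow> ('b \<times> 'b) set \<Rightarrow> nat \<Rightarrow> 'a set \<Rightarrow> 'b set \<Rightarrow> ('a \<times> 'b) set \<Rightarrow> bool" where
  "back_forth E E' 0 V V' P \<longleftrightarrow> partial_iso E E' P"
| "back_forth E E' (Suc n) V V' P \<longleftrightarrow>
     (\<forall>a\<in>V. \<exists>b\<in>V'. back_forth E E' n V V' (insert (a, b) P)) \<and>
     (\<forall>b\<in>V'. \<exists>a\<in>V. back_forth E E' n V V' (insert (a, b) P))"

lemma back_forth_mono:
  "back_forth E E' n V V' Q \<Longrightarrow> P \<subseteq> Q \<Longrightarrow> back_forth E E' n V V' P"
proof (induction n arbitrary: P Q)
  case 0
  then show ?case by (fastforce simp: partial_iso_def)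
next
  case (Suc n)
  have "back_forth E E' n V V' (insert (a, b) P)"
    if "back_forth E E' n V V' (insert (a, b) Q)" for a b
    by (rule Suc.IH[OF that]) (use Suc.prems in auto)
  then show ?case using Suc.prems(1) unfolding back_forth.simps by meson
qed

lemma back_forth_converse:
  "back_forth E E' n V V' P \<Longrightarrow> back_forth E' E n V' V (P\<inverse>)"
proof (induction n arbitrary: P)
  case 0
  then show ?case by (auto simp: partial_iso_def)
next
  case (Suc n)
  have "back_forth E' E n V' V (insert (b, a) (P\<inverse>))"
    if "back_forth E E' n V V' (insert (a, b) P)" for a b
  proof -
    have "(insert (a, b) P)\<inverse> = insert (b, a) (P\<inverse>)" by auto
    then show ?thesis using Suc.IH[OF that] by simp
  qed
  then show ?case using Suc.prems unfolding back_forth.simps by meson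
qed

text \<open>A spare round is wasted on any element of \<open>V\<close>. If both move sets are empty,
  a game with at least one round is won whatever \<open>P\<close> is; this is why nonemptiness
  recurs below.\<close>

lemma back_forth_le:
  assumes "back_forth E E' n V V' P" "m \<le> n" "V \<noteq> {}"
  shows "back_forth E E' m V V' P"
  using assms(2,1)
proof (induction n rule: dec_induct)
  case (step n)
  from assms(3) obtain a where "a \<in> V" by blast
  with step.prems obtain b where "back_forth E E' n V V' (insert (a, b) P)" by auto
  then show ?case by (intro step.IH back_forth_mono[of _ _ _ _ _ _ P]) auto
qed

lemma back_forth_partial_iso:
  "back_forth E E' n V V' P \<Longrightarrow> V \<noteq> {} \<Longrightarrow> partial_iso E E' P"
  using back_forth_le[of E E' n V V' P 0] by simp

lemma back_forth_iso:
  assumes f: "bij_betw f V V'"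
    and E: "\<And>x y. x \<in> V \<Longrightarrow> y \<in> V \<Longrightarrow> (x, y) \<in> E \<longleftrightarrow> (f x, f y) \<in> E'"
    and P: "P \<subseteq> (\<lambda>x. (x, f x)) ` V"
  shows "back_forth E E' n V V' P"
  using P
proof (induction n arbitrary: P)
  case 0
  have inj: "inj_on f V" using f by (simp add: bij_betw_def)
  have "(a = a' \<longleftrightarrow> b = b') \<and> ((a, a') \<in> E \<longleftrightarrow> (b, b') \<in> E')"
    if "(a, b) \<in> P" "(a', b') \<in> P" for a b a' b'
  proof -
    have "a \<in> V" "b = f a" "a' \<in> V" "b' = f a'" using that 0 by auto
    then show ?thesis using E inj_on_eq_iff[OF inj] by simp
  qed
  then show ?case unfolding back_forth.simps partial_iso_def by (intro ballI) (simp add: split_beta)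
next
  case (Suc n)
  have "\<exists>b\<in>V'. back_forth E E' n V V' (insert (a, b) P)" if "a \<in> V" for a
    using that Suc.prems f by (intro bexI[of _ "f a"] Suc.IH) (auto simp: bij_betw_def)
  moreover have "\<exists>a\<in>V. back_forth E E' n V V' (insert (a, b) P)" if b: "b \<in> V'" for b
  proof -
    obtain a where "a \<in> V" "b = f a" using b f by (auto simp: bij_betw_def)
    then show ?thesis using Suc.prems by (intro bexI[of _ a] Suc.IH) auto
  qed
  ultimately show ?case by simp
qed

lemma back_forth_edges_cong:
  assumes "\<And>x y. x \<in> V \<Longrightarrow> y \<in> V \<Longrightarrow> (x, y) \<in> E \<longleftrightarrow> (x, y) \<in> F"
    and "\<And>x y. x \<in> V' \<Longrightarrow> y \<in> V' \<Longrightarrow> (x, y) \<in> E' \<longleftrightarrow> (x, y) \<in> F'"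
    and "P \<subseteq> V \<times> V'"
  shows "back_forth E E' n V V' P \<longleftrightarrow> back_forth F F' n V V' P"
  using assms(3)
proof (induction n arbitrary: P)
  case 0
  have "((a, a') \<in> E \<longleftrightarrow> (a, a') \<in> F) \<and> ((b, b') \<in> E' \<longleftrightarrow> (b, b') \<in> F')"
    if "(a, b) \<in> P" "(a', b') \<in> P" for a b a' b'
    using that 0 by (intro conjI assms(1,2)) auto
  then show ?case
    unfolding back_forth.simps partial_iso_def by (intro ball_cong refl) auto
next
  case (Suc n)
  have "back_forth E E' n V V' (insert (a, b) P) \<longleftrightarrow> back_forth F F' n V V' (insert (a, b) P)"
    if "a \<in> V" "b \<in> V'" for a b
    using that Suc.prems by (intro Suc.IH) auto
  then show ?case by (simp cong: ball_cong bex_cong)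
qed

section \<open>Satisfaction of formulas and the Ehrenfeucht game\<close>

lemma back_forth_sat:
  assumes "back_forth (parent T) (parent T') n (verts T) (verts T') P"
    and "qdepth \<phi> \<le> n" and "verts T \<noteq> {}"
    and "\<And>x. x \<in> fv \<phi> \<Longrightarrow> (e x, e' x) \<in> P" and "(root T, root T') \<in> P"
  shows "sat T e \<phi> \<longleftrightarrow> sat T' e' \<phi>"
  using assms(1,2,4,5)
proof (induction \<phi> arbitrary: n P e e')
  case (Eq s t)
  have "partial_iso (parent T) (parent T') P"
    using Eq.prems(1) assms(3) by (rule back_forth_partial_iso)
  moreover have "(val T e s, val T' e' s) \<in> P" "(val T e t, val T' e' t) \<in> P"
    using Eq.prems by (cases s; cases t; simp)+
  ultimately show ?case unfolding partial_iso_def sat.simps by fast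
next
  case (Par s t)
  have "partial_iso (parent T) (parent T') P"
    using Par.prems(1) assms(3) by (rule back_forth_partial_iso)
  moreover have "(val T e s, val T' e' s) \<in> P" "(val T e t, val T' e' t) \<in> P"
    using Par.prems by (cases s; cases t; simp)+
  ultimately show ?case unfolding partial_iso_def sat.simps by fast
next
  case (Neg \<phi>)
  from Neg.IH[OF Neg.prems(1)] Neg.prems(2-4) show ?case by simp
next
  case (Conj \<phi> \<psi>)
  have "sat T e \<phi> \<longleftrightarrow> sat T' e' \<phi>"
    by (rule Conj.IH(1)[OF Conj.prems(1)]) (use Conj.prems(2-4) in auto)
  moreover have "sat T e \<psi> \<longleftrightarrow> sat T' e' \<psi>"
    by (rule Conj.IH(2)[OF Conj.prems(1)]) (use Conj.prems(2-4) in auto)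
  ultimately show ?case by simp
next
  case (Ex x \<phi>)
  obtain m where n: "n = Suc m" and m: "qdepth \<phi> \<le> m" using Ex.prems(2) by (cases n) auto
  have IH: "sat T (e(x := a)) \<phi> \<longleftrightarrow> sat T' (e'(x := b)) \<phi>"
    if "back_forth (parent T) (parent T') m (verts T) (verts T') (insert (a, b) P)" for a b
    using that m by (rule Ex.IH) (use Ex.prems(3,4) in auto)
  show ?case using Ex.prems(1) IH unfolding n back_forth.simps sat.simps by meson
qed

text \<open>The formula describing a complete type over \<open>F\<close>; the induction below puts
  an existential quantifier in front of it.\<close>

lemma exists_Conj_literals:
  assumes "finite F" "\<And>\<phi>. \<phi> \<in> F \<Longrightarrow> qdepth \<phi> \<le> n \<and> fv \<phi> \<subseteq> A"
  shows "\<exists>\<theta>. qdepth \<theta> \<le> n \<and> fv \<theta> \<subseteq> A \<and>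
    (\<forall>T :: 'v rtree. \<forall>e. sat T e \<theta> \<longleftrightarrow> (\<forall>\<phi>\<in>F. sat T e \<phi> \<longleftrightarrow> \<phi> \<in> X))"
  using assms
proof (induction F)
  case empty
  show ?case by (intro exI[of _ "Eq Root Root"]) simp
next
  case (insert \<phi> F)
  then obtain \<theta> where \<theta>: "qdepth \<theta> \<le> n" "fv \<theta> \<subseteq> A"
    "\<forall>T :: 'v rtree. \<forall>e. sat T e \<theta> \<longleftrightarrow> (\<forall>\<phi>\<in>F. sat T e \<phi> \<longleftrightarrow> \<phi> \<in> X)"
    by auto
  then show ?case
    using insert.prems
    by (intro exI[of _ "Conj (if \<phi> \<in> X then \<phi> else Neg \<phi>) \<theta>"]) auto
qed

text \<open>The formulas of \<open>F\<close> play the role of Hintikka formulas with free variables below \<open>p\<close>.\<close>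

lemma exists_finite_types:
  "\<exists>F. finite F \<and> (\<forall>\<phi>\<in>F. qdepth \<phi> \<le> n \<and> fv \<phi> \<subseteq> {..<p}) \<and>
     (\<forall>(T :: 'v rtree) (T' :: 'v rtree) e e'. (\<forall>\<phi>\<in>F. sat T e \<phi> \<longleftrightarrow> sat T' e' \<phi>) \<longrightarrow>
        back_forth (parent T) (parent T') n (verts T) (verts T')
          (insert (root T, root T') ((\<lambda>i. (e i, e' i)) ` {..<p})))"
proof (induction n arbitrary: p)
  case 0
  let ?ts = "insert Root (Var ` {..<p})"
  let ?F = "(\<lambda>(s, t). Eq s t) ` (?ts \<times> ?ts) \<union> (\<lambda>(s, t). Par s t) ` (?ts \<times> ?ts)"
  have iso: "partial_iso (parent T) (parent T') (insert (root T, root T') ((\<lambda>i. (e i, e' i)) ` {..<p}))"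
    if "\<forall>\<phi>\<in>?F. sat T e \<phi> \<longleftrightarrow> sat T' e' \<phi>" for T T' :: "'v rtree" and e e'
  proof -
    have P: "insert (root T, root T') ((\<lambda>i. (e i, e' i)) ` {..<p}) = (\<lambda>t. (val T e t, val T' e' t)) ` ?ts"
      by (auto simp: image_iff)
    have "sat T e (Eq s t) \<longleftrightarrow> sat T' e' (Eq s t)" "sat T e (Par s t) \<longleftrightarrow> sat T' e' (Par s t)"
      if "s \<in> ?ts" "t \<in> ?ts" for s t
      using \<open>\<forall>\<phi>\<in>?F. _\<close> that by blast+
    then have "(val T e s = val T e t \<longleftrightarrow> val T' e' s = val T' e' t) \<and>
        ((val T e s, val T e t) \<in> parent T \<longleftrightarrow> (val T' e' s, val T' e' t) \<in> parent T')"
      if "s \<in> ?ts" "t \<in> ?ts" for s t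
      using that by (simp only: sat.simps)
    then show ?thesis
      unfolding partial_iso_def P by (intro ballI) (elim imageE, simp only: prod.case, intro ballI, elim imageE,
          simp only: prod.case)
  qed
  have fin: "finite ?F" by (intro finite_UnI finite_imageI finite_SigmaI) simp_all
  have qd: "\<forall>\<phi>\<in>?F. qdepth \<phi> \<le> 0 \<and> fv \<phi> \<subseteq> {..<p}"
  proof -
    have "fv_trm t \<subseteq> {..<p}" if "t \<in> ?ts" for t using that by auto
    then show ?thesis by (intro ballI) (elim UnE imageE SigmaE, simp_all only: prod.case fv.simps
      qdepth.simps order.refl Un_least simp_thms)
  qed
  show ?case
    unfolding back_forth.simps
    by (intro exI[of _ ?F] conjI allI impI) (fact fin, fact qd, erule iso)
next
  case (Suc n)
  from Suc.IH[of "Suc p"] obtain F where finF: "finite F"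
    and qF: "\<forall>\<phi>\<in>F. qdepth \<phi> \<le> n \<and> fv \<phi> \<subseteq> {..<Suc p}"
    and bfF: "\<forall>(T :: 'v rtree) (T' :: 'v rtree) e e'. (\<forall>\<phi>\<in>F. sat T e \<phi> \<longleftrightarrow> sat T' e' \<phi>) \<longrightarrow>
        back_forth (parent T) (parent T') n (verts T) (verts T')
          (insert (root T, root T') ((\<lambda>i. (e i, e' i)) ` {..<Suc p}))"
    by (elim exE conjE)
  have "\<forall>X. \<exists>\<theta>. qdepth \<theta> \<le> n \<and> fv \<theta> \<subseteq> {..<Suc p} \<and>
    (\<forall>T :: 'v rtree. \<forall>e. sat T e \<theta> \<longleftrightarrow> (\<forall>\<phi>\<in>F. sat T e \<phi> \<longleftrightarrow> \<phi> \<in> X))"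
    by (intro allI exists_Conj_literals[OF finF]) (use qF in simp)
  from choice[OF this] obtain \<theta> where "\<forall>X. qdepth (\<theta> X) \<le> n \<and> fv (\<theta> X) \<subseteq> {..<Suc p} \<and>
    (\<forall>T :: 'v rtree. \<forall>e. sat T e (\<theta> X) \<longleftrightarrow> (\<forall>\<phi>\<in>F. sat T e \<phi> \<longleftrightarrow> \<phi> \<in> X))"
    by (rule exE)
  then have \<theta>: "qdepth (\<theta> X) \<le> n" "fv (\<theta> X) \<subseteq> {..<Suc p}"
    "sat T e (\<theta> X) \<longleftrightarrow> (\<forall>\<phi>\<in>F. sat T e \<phi> \<longleftrightarrow> \<phi> \<in> X)" for X and T :: "'v rtree" and e
    by simp_all
  \<comment> \<open>One formula for each type over \<open>F\<close> that a further vertex could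
    have. The new vertex takes the variable \<open>p\<close>, which is still available because the
    parameters occupy \<open>{..<p}\<close>.\<close>
  let ?F = "(\<lambda>X. Ex p (\<theta> X)) ` Pow F"
  have bf: "back_forth (parent T) (parent T') (Suc n) (verts T) (verts T')
          (insert (root T, root T') ((\<lambda>i. (e i, e' i)) ` {..<p}))" (is "back_forth _ _ _ _ _ ?P")
    if *: "\<forall>\<phi>\<in>?F. sat T e \<phi> \<longleftrightarrow> sat T' e' \<phi>" for T T' :: "'v rtree" and e e'
  proof -
    have ext: "back_forth (parent T) (parent T') n (verts T) (verts T') (insert (a, b) ?P)"
      if "\<forall>\<phi>\<in>F. sat T (e(p := a)) \<phi> \<longleftrightarrow> sat T' (e'(p := b)) \<phi>" for a b
    proof -
      have "insert (root T, root T') ((\<lambda>i. ((e(p := a)) i, (e'(p := b)) i)) ` {..<Suc p})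
        = insert (a, b) ?P"
        by (auto simp: lessThan_Suc image_iff)
      then show ?thesis using bfF[rule_format, OF that[rule_format]] by simp
    qed
    have 1: "\<exists>b\<in>verts T'. \<forall>\<phi>\<in>F. sat T (e(p := a)) \<phi> \<longleftrightarrow> sat T' (e'(p := b)) \<phi>"
      if "a \<in> verts T" for a
    proof -
      define X where "X = {\<phi> \<in> F. sat T (e(p := a)) \<phi>}"
      have "sat T e (Ex p (\<theta> X))" using that by (auto simp: \<theta>(3) X_def)
      then have "sat T' e' (Ex p (\<theta> X))" using * by (auto simp: X_def)
      then show ?thesis by (auto simp: \<theta>(3) X_def)
    qed
    have 2: "\<exists>a\<in>verts T. \<forall>\<phi>\<in>F. sat T (e(p := a)) \<phi> \<longleftrightarrow> sat T' (e'(p := b)) \<phi>"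
      if "b \<in> verts T'" for b
    proof -
      define X where "X = {\<phi> \<in> F. sat T' (e'(p := b)) \<phi>}"
      have "sat T' e' (Ex p (\<theta> X))" using that by (auto simp: \<theta>(3) X_def)
      then have "sat T e (Ex p (\<theta> X))" using * by (auto simp: X_def)
      then show ?thesis by (auto simp: \<theta>(3) X_def)
    qed
    show ?thesis using 1 2 ext unfolding back_forth.simps by meson
  qed
  have fin: "finite ?F" using finF by simp
  have qd: "\<forall>\<phi>\<in>?F. qdepth \<phi> \<le> Suc n \<and> fv \<phi> \<subseteq> {..<p}"
    using \<theta>(1,2) by (auto simp: lessThan_Suc)
  show ?case by (intro exI[of _ ?F] conjI allI impI) (fact fin, fact qd, erule bf)
qed

lemma exists_finite_sentences:
  "\<exists>F. finite F \<and> (\<forall>\<phi>\<in>F. sentence \<phi> \<and> qdepth \<phi> \<le> k) \<and>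
     (\<forall>(T :: 'v rtree) (T' :: 'v rtree). (\<forall>\<phi>\<in>F. models T \<phi> \<longleftrightarrow> models T' \<phi>) \<longrightarrow>
        back_forth (parent T) (parent T') k (verts T) (verts T') {(root T, root T')})"
proof -
  obtain F where F: "finite F" "\<forall>\<phi>\<in>F. qdepth \<phi> \<le> k \<and> fv \<phi> \<subseteq> {..<0}"
    "\<forall>(T :: 'v rtree) (T' :: 'v rtree) e e'. (\<forall>\<phi>\<in>F. sat T e \<phi> \<longleftrightarrow> sat T' e' \<phi>) \<longrightarrow>
        back_forth (parent T) (parent T') k (verts T) (verts T')
          (insert (root T, root T') ((\<lambda>i. (e i, e' i)) ` {..<0}))"
    using exists_finite_types[of k 0, where 'v = 'v] by (elim exE conjE)
  have "\<forall>\<phi>\<in>F. sentence \<phi> \<and> qdepth \<phi> \<le> k" using F(2) by (simp add: sentence_def)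
  moreover have "back_forth (parent T) (parent T') k (verts T) (verts T') {(root T, root T')}"
    if "\<forall>\<phi>\<in>F. models T \<phi> \<longleftrightarrow> models T' \<phi>" for T T' :: "'v rtree"
    using F(3)[rule_format, of T "\<lambda>_. root T" T' "\<lambda>_. root T'"] that by (simp add: models_def)
  ultimately show ?thesis using F(1) by (intro exI[of _ F]) simp
qed

section \<open>Equivalence classes of trees\<close>

lemma root_in_verts: "rooted_tree T \<Longrightarrow> root T \<in> verts T"
  by (simp add: rooted_tree_def)

text \<open>Ehrenfeucht's theorem. The pair of roots, pebbled in advance, stands for the constant
  symbol.\<close>

lemma equiv_k_iff_back_forth:
  fixes T T' :: "'v rtree"
  assumes "rooted_tree T" "rooted_tree T'"
  shows "(T, T') \<in> equiv_k k \<longleftrightarrow>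
    back_forth (parent T) (parent T') k (verts T) (verts T') {(root T, root T')}"
proof
  assume "(T, T') \<in> equiv_k k"
  then show "back_forth (parent T) (parent T') k (verts T) (verts T') {(root T, root T')}"
    using exists_finite_sentences[where 'v = 'v, of k]
    by (elim exE conjE) (simp add: equiv_k_def)
next
  assume bf: "back_forth (parent T) (parent T') k (verts T) (verts T') {(root T, root T')}"
  have "models T \<phi> \<longleftrightarrow> models T' \<phi>" if "sentence \<phi>" "qdepth \<phi> \<le> k" for \<phi>
    unfolding models_def
    by (rule back_forth_sat[OF bf]) (use that root_in_verts[OF assms(1)] in \<open>auto simp: sentence_def\<close>)
  then show "(T, T') \<in> equiv_k k" using assms by (simp add: equiv_k_def)
qed

lemma equiv_equiv_k: "equiv {T. rooted_tree T} (equiv_k k)"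
  by (auto simp: equiv_def refl_on_def sym_def trans_def equiv_k_def)

lemma EV_eq_iff: "rooted_tree T \<Longrightarrow> EV k T = EV k T' \<longleftrightarrow> (T, T') \<in> equiv_k k"
  using equiv_equiv_k[of k] unfolding EV_def
  by (smt (verit) Image_singleton_iff case_prodD equiv_class_eq_iff equiv_k_def mem_Collect_eq)

lemma EV_in_classes: "rooted_tree T \<Longrightarrow> EV k T \<in> classes k"
  by (simp add: EV_def classes_def quotientI)

lemma classesE:
  assumes "j \<in> classes k"
  obtains T where "rooted_tree T" "j = EV k T"
  using assms by (auto simp: EV_def classes_def quotient_def)

text \<open>A class is determined by the subset of a finite set of sentences that its representative
  satisfies.\<close>

lemma finite_classes: "finite (classes k :: 'v rtree set set)"
proof -
  obtain F where F: "finite F" "\<forall>\<phi>\<in>F. sentence \<phi> \<and> qdepth \<phi> \<le> k"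
     "\<forall>(T :: 'v rtree) (T' :: 'v rtree). (\<forall>\<phi>\<in>F. models T \<phi> \<longleftrightarrow> models T' \<phi>) \<longrightarrow>
        back_forth (parent T) (parent T') k (verts T) (verts T') {(root T, root T')}"
    using exists_finite_sentences[where 'v = 'v, of k] by (elim exE conjE)
  define h where "h j = {\<phi> \<in> F. models (SOME T. rooted_tree T \<and> j = EV k T) \<phi>}" for j :: "'v rtree set"
  have "inj_on h (classes k)"
  proof (rule inj_onI)
    fix i j :: "'v rtree set" assume ij: "i \<in> classes k" "j \<in> classes k" "h i = h j"
    define S where "S j = (SOME T. rooted_tree T \<and> j = EV k T)" for j :: "'v rtree set"
    have S: "rooted_tree (S j)" "EV k (S j) = j" if "j \<in> classes k" for j
    proof -
      have "\<exists>T. rooted_tree T \<and> j = EV k T" using classesE[OF that] by metis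
      from someI_ex[OF this] show "rooted_tree (S j)" "EV k (S j) = j" by (simp_all add: S_def)
    qed
    have "\<forall>\<phi>\<in>F. models (S i) \<phi> \<longleftrightarrow> models (S j) \<phi>"
    proof
      fix \<phi> assume "\<phi> \<in> F"
      then have "models (S i) \<phi> \<longleftrightarrow> \<phi> \<in> h i" "models (S j) \<phi> \<longleftrightarrow> \<phi> \<in> h j"
        by (simp_all add: h_def S_def)
      then show "models (S i) \<phi> \<longleftrightarrow> models (S j) \<phi>" using ij(3) by simp
    qed
    then have "(S i, S j) \<in> equiv_k k"
      using S(1)[OF ij(1)] S(1)[OF ij(2)] by (simp add: equiv_k_iff_back_forth F(3))
    then have "EV k (S i) = EV k (S j)" using S(1)[OF ij(1)] by (simp add: EV_eq_iff)
    then show "i = j" using S(2)[OF ij(1)] S(2)[OF ij(2)] by simp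
  qed
  moreover have "h ` classes k \<subseteq> Pow F" unfolding h_def by (intro image_subsetI PowI Collect_restrict)
  ultimately show ?thesis using inj_on_finite[of h "classes k" "Pow F"] F(1) by simp
qed

section \<open>Descendants and depth\<close>

abbreviation descendants :: "'v rtree \<Rightarrow> 'v \<Rightarrow> 'v set" where
  "descendants T v \<equiv> verts (subtree T v)"

lemma verts_subtree: "descendants T v = {u \<in> verts T. (u, v) \<in> (parent T)\<^sup>*}"
  and root_subtree [simp]: "root (subtree T v) = v"
  and parent_subtree: "parent (subtree T v) = parent T \<inter> (descendants T v \<times> descendants T v)"
  by (simp_all add: subtree_def Let_def)

lemma parent_subset: "rooted_tree T \<Longrightarrow> parent T \<subseteq> verts T \<times> verts T"
  by (simp add: rooted_tree_def)

lemma parent_in_verts: "rooted_tree T \<Longrightarrow> (u, v) \<in> parent T \<Longrightarrow> u \<in> verts T \<and> v \<in> verts T"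
  using parent_subset by fastforce

lemma root_no_parent: "rooted_tree T \<Longrightarrow> (root T, w) \<notin> parent T"
  by (simp add: rooted_tree_def)

lemma ex1_parent: "rooted_tree T \<Longrightarrow> v \<in> verts T \<Longrightarrow> v \<noteq> root T \<Longrightarrow> \<exists>!w. (v, w) \<in> parent T"
  by (simp add: rooted_tree_def)

lemma parent_rtrancl_in_verts:
  "(u, v) \<in> (parent T)\<^sup>* \<Longrightarrow> rooted_tree T \<Longrightarrow> u \<in> verts T \<Longrightarrow> v \<in> verts T"
  by (induction rule: rtrancl_induct) (auto dest: parent_in_verts)

lemma parent_unique: "rooted_tree T \<Longrightarrow> (u, v) \<in> parent T \<Longrightarrow> (u, w) \<in> parent T \<Longrightarrow> v = w"
  by (metis ex1_parent parent_in_verts root_no_parent)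

lemma single_valued_parent: "rooted_tree T \<Longrightarrow> single_valued (parent T)"
  by (meson parent_unique single_valuedI)

lemma rtrancl_root: "rooted_tree T \<Longrightarrow> v \<in> verts T \<Longrightarrow> (v, root T) \<in> (parent T)\<^sup>*"
  by (simp add: rooted_tree_def)

lemma relpow_root_unique:
  assumes "rooted_tree T"
  shows "(v, root T) \<in> parent T ^^ m \<Longrightarrow> (v, root T) \<in> parent T ^^ n \<Longrightarrow> m = n"
proof (induction m arbitrary: n v)
  case 0
  show ?case
  proof (cases n)
    case (Suc n')
    with 0 root_no_parent[OF assms] show ?thesis by (metis relpow_0_E relpow_Suc_D2)
  qed simp
next
  case (Suc m)
  from Suc.prems(1) obtain w where w: "(v, w) \<in> parent T" "(w, root T) \<in> parent T ^^ m"
    by (blast dest: relpow_Suc_D2)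
  with root_no_parent[OF assms] have "v \<noteq> root T" by auto
  with Suc.prems(2) obtain n' where n: "n = Suc n'" by (cases n) auto
  with Suc.prems(2) obtain w' where w': "(v, w') \<in> parent T" "(w', root T) \<in> parent T ^^ n'"
    by (blast dest: relpow_Suc_D2)
  have "w' = w" using parent_unique[OF assms w'(1) w(1)] .
  then show ?case using Suc.IH[OF w(2)] w'(2) n by simp
qed

definition depth :: "'v rtree \<Rightarrow> 'v \<Rightarrow> nat" where
  "depth T v = (THE n. (v, root T) \<in> parent T ^^ n)"

lemma depth_eq:
  assumes "rooted_tree T" "(v, root T) \<in> parent T ^^ n"
  shows "depth T v = n"
  unfolding depth_def using assms relpow_root_unique[OF assms(1)] by (intro the_equality) auto

lemma relpow_depth:
  assumes "rooted_tree T" "v \<in> verts T"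
  shows "(v, root T) \<in> parent T ^^ depth T v"
  using rtrancl_root[OF assms] depth_eq[OF assms(1)] rtrancl_imp_relpow by metis

lemma depth_root: "rooted_tree T \<Longrightarrow> depth T (root T) = 0"
  by (rule depth_eq) auto

lemma depth_parent: "rooted_tree T \<Longrightarrow> (u, v) \<in> parent T \<Longrightarrow> depth T u = Suc (depth T v)"
  by (intro depth_eq relpow_Suc_I2) (auto dest: parent_in_verts intro: relpow_depth)

lemma depth_relpow: "rooted_tree T \<Longrightarrow> (u, v) \<in> parent T ^^ n \<Longrightarrow> depth T u = depth T v + n"
proof (induction n arbitrary: u)
  case (Suc n)
  then obtain w where "(u, w) \<in> parent T" "(w, v) \<in> parent T ^^ n" by (meson relpow_Suc_D2)
  with Suc show ?case by (simp add: depth_parent)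
qed simp

lemma depth_rtrancl: "rooted_tree T \<Longrightarrow> (u, v) \<in> (parent T)\<^sup>* \<Longrightarrow> depth T v \<le> depth T u"
  by (auto simp: rtrancl_power depth_relpow)

lemma rootchild_iff: "rooted_tree T \<Longrightarrow> v \<in> rootchildren T \<longleftrightarrow> (v, root T) \<in> parent T"
  by (auto simp: rootchildren_def dest: parent_in_verts)

lemma rooted_subtree:
  assumes T: "rooted_tree T" and v: "v \<in> verts T"
  shows "rooted_tree (subtree T v)"
proof -
  let ?D = "descendants T v" and ?E = "parent (subtree T v)"
  have up: "w \<in> ?D" if "u \<in> ?D" "u \<noteq> v" "(u, w) \<in> parent T" for u w
  proof -
    from that(1,2) obtain w' where w': "(u, w') \<in> parent T" "(w', v) \<in> (parent T)\<^sup>*"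
      by (auto simp: verts_subtree elim: converse_rtranclE)
    then have "w' = w" using parent_unique[OF T w'(1) that(3)] by simp
    then show ?thesis using w' parent_in_verts[OF T that(3)] by (simp add: verts_subtree)
  qed
  have "(u, v) \<in> ?E\<^sup>*" if "(u, v) \<in> (parent T)\<^sup>*" "u \<in> verts T" for u
    using that
  proof (induction rule: converse_rtrancl_induct)
    case (step u w)
    have w: "w \<in> verts T" using parent_in_verts[OF T step.hyps(1)] by simp
    have "(u, w) \<in> ?E" using step.hyps step.prems w by (auto simp: parent_subtree verts_subtree)
    then show ?case using step.IH[OF w] by (rule converse_rtrancl_into_rtrancl)
  qed simp
  moreover have "(v, w) \<notin> ?E" for w
  proof
    assume "(v, w) \<in> ?E"
    then have "(v, w) \<in> parent T" "(w, v) \<in> (parent T)\<^sup>*" by (auto simp: parent_subtree verts_subtree)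
    then show False using depth_parent[OF T] depth_rtrancl[OF T] by (metis Suc_n_not_le_n)
  qed
  moreover have "\<exists>!w. (u, w) \<in> ?E" if u: "u \<in> ?D - {v}" for u
  proof -
    have "u \<in> verts T" using u by (simp add: verts_subtree)
    moreover have "u \<noteq> root T"
    proof
      assume "u = root T"
      moreover have "(u, v) \<in> (parent T)\<^sup>*" using u by (simp add: verts_subtree)
      ultimately show False using u root_no_parent[OF T] by (auto elim: converse_rtranclE)
    qed
    ultimately obtain w where "(u, w) \<in> parent T" using ex1_parent[OF T] by meson
    then have "(u, w) \<in> ?E" using up[of u w] u by (auto simp: parent_subtree)
    then show ?thesis using parent_unique[OF T] by (auto simp: parent_subtree)
  qed
  moreover have "v \<in> ?D" using v by (simp add: verts_subtree)
  moreover have "?E \<subseteq> ?D \<times> ?D" by (simp add: parent_subtree)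
  ultimately show ?thesis
    unfolding rooted_tree_def root_subtree by (simp add: verts_subtree)
qed

lemma subtree_root: "rooted_tree T \<Longrightarrow> subtree T (root T) = T"
proof (rule rtree.equality)
  assume T: "rooted_tree T"
  show "verts (subtree T (root T)) = verts T" using rtrancl_root[OF T] by (auto simp: verts_subtree)
  then show "parent (subtree T (root T)) = parent T" using parent_subset[OF T] by (auto simp: parent_subtree)
qed simp_all

text \<open>The ancestors of \<open>u\<close> form a chain because parents are unique, and two
  members of a chain at the same depth coincide.\<close>

lemma descendants_comparable:
  assumes "rooted_tree T" "u \<in> descendants T v" "u \<in> descendants T w" "depth T v = depth T w"
  shows "v = w"
proof -
  have uv: "(u, v) \<in> (parent T)\<^sup>*" "(u, w) \<in> (parent T)\<^sup>*" using assms by (auto simp: verts_subtree)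
  have *: "a = b" if "(a, b) \<in> (parent T)\<^sup>*" "depth T a = depth T b" for a b
    using that depth_relpow[OF assms(1)] by (auto simp: rtrancl_power)
  show ?thesis
    using single_valued_confluent[OF single_valued_parent[OF assms(1)] uv] *[of v w] *[of w v] assms(4)
    by auto
qed

lemma depth_rootchild: "rooted_tree T \<Longrightarrow> v \<in> rootchildren T \<Longrightarrow> depth T v = 1"
  by (simp add: rootchild_iff depth_parent depth_root)

lemma rootchildren_disjoint:
  assumes "rooted_tree T" "v \<in> rootchildren T" "w \<in> rootchildren T"
    "u \<in> descendants T v" "u \<in> descendants T w"
  shows "v = w"
  using assms by (auto intro: descendants_comparable simp: depth_rootchild)

lemma rootchild_in_verts: "v \<in> rootchildren T \<Longrightarrow> v \<in> verts T"
  by (simp add: rootchildren_def)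

lemma root_notin_rootchild_descendants:
  assumes "rooted_tree T" "v \<in> rootchildren T"
  shows "root T \<notin> descendants T v"
  using depth_rtrancl[OF assms(1), of "root T" v] depth_rootchild[OF assms] depth_root[OF assms(1)]
  by (auto simp: verts_subtree)

lemma in_verts_cases:
  assumes "rooted_tree T" "u \<in> verts T"
  obtains "u = root T" | v where "v \<in> rootchildren T" "u \<in> descendants T v"
proof (cases "u = root T")
  case False
  then obtain v where "(u, v) \<in> (parent T)\<^sup>*" "(v, root T) \<in> parent T"
    using rtrancl_root[OF assms] by (metis rtranclE)
  then show ?thesis using that(2)[of v] assms by (auto simp: verts_subtree rootchild_iff)
qed (rule that)

lemma parent_descendants:
  assumes "rooted_tree T" "(u, w) \<in> parent T" "u \<in> descendants T v" "u \<noteq> v"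
  shows "w \<in> descendants T v"
proof -
  from assms(3,4) obtain w' where w': "(u, w') \<in> parent T" "(w', v) \<in> (parent T)\<^sup>*"
    by (auto simp: verts_subtree elim: converse_rtranclE)
  then have "w' = w" using parent_unique[OF assms(1) w'(1) assms(2)] by simp
  then show ?thesis using w' parent_in_verts[OF assms(1,2)] by (simp add: verts_subtree)
qed

lemma child_descendants:
  assumes "rooted_tree T" "(u, w) \<in> parent T" "w \<in> descendants T v"
  shows "u \<in> descendants T v"
  using assms parent_in_verts[OF assms(1,2)] by (auto simp: verts_subtree)

section \<open>The root class is determined by the child counts\<close>

lemma verts_nonempty: "rooted_tree T \<Longrightarrow> verts T \<noteq> {}"
  using root_in_verts by blast

lemma self_descendant: "v \<in> verts T \<Longrightarrow> v \<in> descendants T v"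
  by (simp add: verts_subtree)

text \<open>Only edges between vertices of the move sets matter. Keeping the relations of the whole
  trees allows strategies for several subtrees to be combined into one.\<close>

lemma equiv_k_subtree_iff_back_forth:
  assumes "rooted_tree T" "rooted_tree T'" "v \<in> verts T" "v' \<in> verts T'"
  shows "(subtree T v, subtree T' v') \<in> equiv_k k \<longleftrightarrow>
    back_forth (parent T) (parent T') k (descendants T v) (descendants T' v') {(v, v')}"
proof -
  have "back_forth (parent (subtree T v)) (parent (subtree T' v')) k
      (descendants T v) (descendants T' v') {(v, v')} \<longleftrightarrow>
    back_forth (parent T) (parent T') k (descendants T v) (descendants T' v') {(v, v')}"
    using assms by (intro back_forth_edges_cong) (auto simp: parent_subtree self_descendant)
  then show ?thesis
    using equiv_k_iff_back_forth[OF rooted_subtree[OF assms(1,3)] rooted_subtree[OF assms(2,4)]]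
    by simp
qed

text \<open>Truncation does no harm while fewer than \<open>k\<close> pairs are in use: were
  \<open>A'\<close> exhausted by \<open>m\<close>, its count would be below \<open>k\<close> and
  hence exact, so \<open>A\<close> would be no larger than \<open>m\<close>, against the proper
  inclusion.\<close>

lemma num_eq_imp_unmatched:
  assumes "num k A = num k A'" "finite m" "card m < k" "inj_on fst m" "fst ` m \<subset> A"
  shows "\<exists>v'\<in>A'. v' \<notin> snd ` m"
proof (rule ccontr)
  assume "\<not> ?thesis"
  then have sub: "A' \<subseteq> snd ` m" by blast
  then have fin: "finite A'" using assms(2) by (meson finite_imageI finite_subset)
  have le: "card A' \<le> card m"
    using card_mono[OF finite_imageI[OF assms(2)] sub] card_image_le[OF assms(2), of snd] by simp
  then have "num k A' = Exactly (card A')" using fin assms(3) by (simp add: num_def)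
  then have A: "finite A" "card A = card A'" using assms(1) by (auto simp: num_def split: if_splits)
  have "card m < card A" using psubset_card_mono[OF A(1) assms(5)] card_image[OF assms(4)] by simp
  then show False using A le by simp
qed

text \<open>\<open>m\<close> pairs the children of the roots below which pebbles have been placed; below a pair of
  \<open>m\<close> Duplicator follows a winning strategy for the two subtrees.\<close>

definition matched ::
    "nat \<Rightarrow> 'v rtree \<Rightarrow> 'v rtree \<Rightarrow> nat \<Rightarrow> ('v \<times> 'v) set \<Rightarrow> ('v \<times> 'v) set \<Rightarrow> bool" where
  "matched k T T' n m P \<longleftrightarrow>
     finite m \<and> card m + n \<le> k \<and> inj_on fst m \<and> inj_on snd m \<and>
     P \<subseteq> insert (root T, root T') (\<Union>(v, v')\<in>m. descendants T v \<times> descendants T' v') \<and>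
     (\<forall>(v, v')\<in>m. v \<in> rootchildren T \<and> v' \<in> rootchildren T' \<and>
        EV k (subtree T v) = EV k (subtree T' v') \<and>
        back_forth (parent T) (parent T') n (descendants T v) (descendants T' v')
          (insert (v, v') (P \<inter> descendants T v \<times> descendants T' v')))"

lemma matched_subset: "matched k T T' n m P \<Longrightarrow>
    P \<subseteq> insert (root T, root T') (\<Union>(v, v')\<in>m. descendants T v \<times> descendants T' v')"
  by (simp add: matched_def)

lemma matched_pair:
  assumes "matched k T T' n m P" "(v, v') \<in> m"
  shows "v \<in> rootchildren T" "v' \<in> rootchildren T'" "EV k (subtree T v) = EV k (subtree T' v')"
    "back_forth (parent T) (parent T') n (descendants T v) (descendants T' v')
      (insert (v, v') (P \<inter> descendants T v \<times> descendants T' v'))"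
proof -
  have "\<forall>(v, v')\<in>m. v \<in> rootchildren T \<and> v' \<in> rootchildren T' \<and>
      EV k (subtree T v) = EV k (subtree T' v') \<and>
      back_forth (parent T) (parent T') n (descendants T v) (descendants T' v')
        (insert (v, v') (P \<inter> descendants T v \<times> descendants T' v'))"
    using assms(1) by (simp add: matched_def)
  from bspec[OF this assms(2)]
  show "v \<in> rootchildren T" "v' \<in> rootchildren T'" "EV k (subtree T v) = EV k (subtree T' v')"
    "back_forth (parent T) (parent T') n (descendants T v) (descendants T' v')
      (insert (v, v') (P \<inter> descendants T v \<times> descendants T' v'))"
    by simp_all
qed

lemma matched_converse:
  assumes "matched k T T' n m P"
  shows "matched k T' T n (m\<inverse>) (P\<inverse>)"
proof -
  have m: "inj_on fst m" "inj_on snd m" using assms by (simp_all add: matched_def)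
  have inj: "inj_on fst (m\<inverse>)" using m(2) unfolding inj_on_def by fastforce
  have inj': "inj_on snd (m\<inverse>)" using m(1) unfolding inj_on_def by fastforce
  have P: "P\<inverse> \<subseteq> insert (root T', root T) (\<Union>(v', v)\<in>m\<inverse>. descendants T' v' \<times> descendants T v)"
  proof
    fix p assume "p \<in> P\<inverse>"
    then obtain x y where p: "p = (y, x)" "(x, y) \<in> P" by auto
    from subsetD[OF matched_subset[OF assms] p(2)] show
      "p \<in> insert (root T', root T) (\<Union>(v', v)\<in>m\<inverse>. descendants T' v' \<times> descendants T v)"
    proof (elim insertE UN_E)
      fix q assume q: "q \<in> m" "(x, y) \<in> (case q of (v, v') \<Rightarrow> descendants T v \<times> descendants T' v')"
      then show ?thesis
        using p(1) by (intro insertI2 UN_I[of "(snd q, fst q)"]) (auto simp: split_beta)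
    qed (use p(1) in simp)
  qed
  have "v' \<in> rootchildren T' \<and> v \<in> rootchildren T \<and> EV k (subtree T' v') = EV k (subtree T v) \<and>
        back_forth (parent T') (parent T) n (descendants T' v') (descendants T v)
          (insert (v', v) (P\<inverse> \<inter> descendants T' v' \<times> descendants T v))" if "(v, v') \<in> m" for v v'
  proof -
    have "(insert (v, v') (P \<inter> descendants T v \<times> descendants T' v'))\<inverse> =
      insert (v', v) (P\<inverse> \<inter> descendants T' v' \<times> descendants T v)" by blast
    then show ?thesis
      using matched_pair[OF assms that] back_forth_converse[OF matched_pair(4)[OF assms that]] by simp
  qed
  then have "\<forall>(v', v)\<in>m\<inverse>. v' \<in> rootchildren T' \<and> v \<in> rootchildren T \<and>
      EV k (subtree T' v') = EV k (subtree T v) \<and>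
        back_forth (parent T') (parent T) n (descendants T' v') (descendants T v)
          (insert (v', v) (P\<inverse> \<inter> descendants T' v' \<times> descendants T v))" by fast
  then show ?thesis using assms inj inj' P unfolding matched_def by (simp add: card_inverse)
qed

context
  fixes k :: nat and T T' :: "'v rtree"
  assumes T: "rooted_tree T" and T': "rooted_tree T'"
begin

text \<open>Pebbles below different children are neither equal nor joined, and below the same child
  the game on the two subtrees decides. For edges to the root it matters that \<open>(v, v')\<close>
  takes part in that game: a vertex below \<open>v\<close> has the root as its parent iff it is
  \<open>v\<close> itself.\<close>

lemma matched_partial_iso:
  assumes m: "matched k T T' 0 m P"
  shows "partial_iso (parent T) (parent T') P"
proof -
  have inj: "inj_on fst m" "inj_on snd m" using m by (simp_all add: matched_def)
  define Q where "Q v v' = insert (v, v') (P \<inter> descendants T v \<times> descendants T' v')" for v v'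
  have mm: "v \<in> rootchildren T" "v' \<in> rootchildren T'" "partial_iso (parent T) (parent T') (Q v v')"
    if "(v, v') \<in> m" for v v'
    using matched_pair[OF m that] by (simp_all add: Q_def)
  have QD: "a \<in> descendants T v \<and> b \<in> descendants T' v'"
    if "(a, b) \<in> Q v v'" "(v, v') \<in> m" for a b v v'
    using that mm[OF that(2)] by (auto simp: Q_def rootchild_in_verts self_descendant)
  have vQ: "(v, v') \<in> Q v v'" for v v' by (simp add: Q_def)
  have PQ: "(a, b) = (root T, root T') \<or> (\<exists>v v'. (v, v') \<in> m \<and> (a, b) \<in> Q v v')"
    if "(a, b) \<in> P" for a b
    using subsetD[OF matched_subset[OF m] that] that unfolding Q_def by blast
  have up: "(a, root T) \<in> parent T \<longleftrightarrow> (b, root T') \<in> parent T'"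
    if ab: "(a, b) \<in> Q v v'" "(v, v') \<in> m" for a b v v'
  proof -
    have 1: "(a, root T) \<in> parent T \<longleftrightarrow> a = v"
      using rootchildren_disjoint[OF T _ mm(1)[OF ab(2)], of a a] QD[OF ab] mm(1)[OF ab(2)]
      by (metis T rootchild_iff rootchild_in_verts self_descendant)
    have 2: "(b, root T') \<in> parent T' \<longleftrightarrow> b = v'"
      using rootchildren_disjoint[OF T' _ mm(2)[OF ab(2)], of b b] QD[OF ab] mm(2)[OF ab(2)]
      by (metis T' rootchild_iff rootchild_in_verts self_descendant)
    have "a = v \<longleftrightarrow> b = v'"
      using partial_isoD(1)[OF mm(3)[OF ab(2)] ab(1) vQ] .
    then show ?thesis using 1 2 by simp
  qed
  have nr: "a \<noteq> root T \<and> b \<noteq> root T'" if "(a, b) \<in> Q v v'" "(v, v') \<in> m" for a b v v'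
    using QD[OF that] root_notin_rootchild_descendants[OF T mm(1)[OF that(2)]]
      root_notin_rootchild_descendants[OF T' mm(2)[OF that(2)]] by auto
  have sep: "a \<noteq> a' \<and> (a, a') \<notin> parent S"
    if "rooted_tree S" "v \<in> rootchildren S" "w \<in> rootchildren S" "v \<noteq> w"
      "a \<in> descendants S v" "a' \<in> descendants S w" for S :: "'v rtree" and a a' v w
  proof -
    have "a \<noteq> a'" using rootchildren_disjoint[OF that(1-3)] that(4-6) by auto
    moreover have False if e: "(a, a') \<in> parent S"
    proof (cases "a = v")
      case True
      then have "a' = root S"
        using e \<open>v \<in> rootchildren S\<close> \<open>rooted_tree S\<close> parent_unique rootchild_iff by metis
      then show False
        using root_notin_rootchild_descendants[OF \<open>rooted_tree S\<close> \<open>w \<in> rootchildren S\<close>]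
          \<open>a' \<in> descendants S w\<close> by simp
    next
      case False
      from parent_descendants[OF \<open>rooted_tree S\<close> e \<open>a \<in> descendants S v\<close> this]
      show False
        using rootchildren_disjoint[OF \<open>rooted_tree S\<close> \<open>v \<in> rootchildren S\<close> \<open>w \<in> rootchildren S\<close>]
          \<open>a' \<in> descendants S w\<close> \<open>v \<noteq> w\<close> by blast
    qed
    ultimately show ?thesis by blast
  qed
  have "(a = a' \<longleftrightarrow> b = b') \<and> ((a, a') \<in> parent T \<longleftrightarrow> (b, b') \<in> parent T')"
    if ab: "(a, b) \<in> P" "(a', b') \<in> P" for a b a' b'
  proof -
    consider "(a, b) = (root T, root T')" "(a', b') = (root T, root T')"
      | v v' where "(a, b) = (root T, root T')" "(v, v') \<in> m" "(a', b') \<in> Q v v'"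
      | v v' where "(a', b') = (root T, root T')" "(v, v') \<in> m" "(a, b) \<in> Q v v'"
      | v v' w w' where "(v, v') \<in> m" "(a, b) \<in> Q v v'" "(w, w') \<in> m" "(a', b') \<in> Q w w'"
      using PQ[OF ab(1)] PQ[OF ab(2)] by (elim disjE exE conjE) (assumption | metis)+
    then show ?thesis
    proof cases
      case 1
      then show ?thesis using root_no_parent[OF T] root_no_parent[OF T'] by simp
    next
      case 2
      then show ?thesis using nr[OF 2(3,2)] root_no_parent[OF T] root_no_parent[OF T'] by auto
    next
      case 3
      then show ?thesis using nr[OF 3(3,2)] up[OF 3(3,2)] by auto
    next
      case (4 v v' w w')
      show ?thesis
      proof (cases "(v, v') = (w, w')")
        case True
        then have "(a', b') \<in> Q v v'" using 4 by simp
        then show ?thesis using partial_isoD[OF mm(3)[OF 4(1)] 4(2)] by simp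
      next
        case False
        then have "v \<noteq> w" "v' \<noteq> w'"
          using inj_onD[OF inj(1) _ 4(1,3)] inj_onD[OF inj(2) _ 4(1,3)] by auto
        then show ?thesis
          using sep[OF T mm(1)[OF 4(1)] mm(1)[OF 4(3)], of a a']
            sep[OF T' mm(2)[OF 4(1)] mm(2)[OF 4(3)], of b b'] QD[OF 4(2,1)] QD[OF 4(4,3)]
          by auto
      qed
    qed
  qed
  then show ?thesis unfolding partial_iso_def by (intro ballI) (simp add: split_beta)
qed

lemma matched_forth:
  assumes counts: "child_counts k T = child_counts k T'"
    and m: "matched k T T' (Suc n) m P" and a: "a \<in> verts T"
  shows "\<exists>b\<in>verts T'. \<exists>m'. matched k T T' n m' (insert (a, b) P)"
proof -
  note mP = matched_subset[OF m]
  have fm: "finite m" "inj_on fst m" "inj_on snd m" "card m + Suc n \<le> k"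
    using m by (simp_all add: matched_def)
  note mm = matched_pair[OF m]
  have keep: "back_forth (parent T) (parent T') n (descendants T v) (descendants T' v')
          (insert (v, v') (insert (a, b) P \<inter> descendants T v \<times> descendants T' v'))"
    if "(v, v') \<in> m" "a \<notin> descendants T v" for v v' b
  proof -
    have "descendants T v \<noteq> {}"
      using mm(1)[OF that(1)] self_descendant rootchild_in_verts by fastforce
    then have "back_forth (parent T) (parent T') n (descendants T v) (descendants T' v')
          (insert (v, v') (P \<inter> descendants T v \<times> descendants T' v'))"
      using back_forth_le[OF mm(4)[OF that(1)], of n] by simp
    moreover have "insert (a, b) P \<inter> descendants T v \<times> descendants T' v'
        = P \<inter> descendants T v \<times> descendants T' v'" using that(2) by blast
    ultimately show ?thesis by simp
  qed
  from T a show ?thesis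
  proof (cases rule: in_verts_cases)
    case 1
    have notin: "a \<notin> descendants T v" if "(v, v') \<in> m" for v v'
      using root_notin_rootchild_descendants[OF T mm(1)[OF that]] 1 by simp
    have "matched k T T' n m (insert (a, root T') P)"
      unfolding matched_def
    proof (intro conjI fm)
      show "card m + n \<le> k" using fm by simp
      show "insert (a, root T') P
          \<subseteq> insert (root T, root T') (\<Union>(v, v')\<in>m. descendants T v \<times> descendants T' v')"
        using mP 1 by simp
      show "\<forall>(v, v')\<in>m. v \<in> rootchildren T \<and> v' \<in> rootchildren T' \<and>
          EV k (subtree T v) = EV k (subtree T' v') \<and>
          back_forth (parent T) (parent T') n (descendants T v) (descendants T' v')
            (insert (v, v') (insert (a, root T') P \<inter> descendants T v \<times> descendants T' v'))"
        by (intro ballI) (simp only: split_paired_all prod.case mm(1-3) keep notin simp_thms)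
    qed
    then show ?thesis using root_in_verts[OF T'] by blast
  next
    case (2 v)
    have other: "a \<notin> descendants T w" if "(w, w') \<in> m" "w \<noteq> v" for w w'
      using rootchildren_disjoint[OF T mm(1)[OF that(1)] 2(1)] 2(2) that(2) by blast
    show ?thesis
    proof (cases "v \<in> fst ` m")
      case True
      then obtain v' where vm: "(v, v') \<in> m" by auto
      from mm(4)[OF vm] 2(2) obtain b where b: "b \<in> descendants T' v'"
        "back_forth (parent T) (parent T') n (descendants T v) (descendants T' v')
          (insert (a, b) (insert (v, v') (P \<inter> descendants T v \<times> descendants T' v')))"
        by auto
      have "insert (a, b) (insert (v, v') (P \<inter> descendants T v \<times> descendants T' v')) =
          insert (v, v') (insert (a, b) P \<inter> descendants T v \<times> descendants T' v')"
        using 2(2) b(1) by blast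
      with b have bb: "back_forth (parent T) (parent T') n (descendants T v) (descendants T' v')
          (insert (v, v') (insert (a, b) P \<inter> descendants T v \<times> descendants T' v'))" by simp
      have eq: "w' = v'" if "(v, w') \<in> m" for w'
        using inj_onD[OF fm(2) _ that vm] by simp
      have "matched k T T' n m (insert (a, b) P)"
        unfolding matched_def
      proof (intro conjI fm)
        show "card m + n \<le> k" using fm by simp
        show "insert (a, b) P
            \<subseteq> insert (root T, root T') (\<Union>(v, v')\<in>m. descendants T v \<times> descendants T' v')"
          using mP vm 2(2) b(1) by (intro insert_subsetI) (auto intro!: bexI[of _ "(v, v')"])
        have "back_forth (parent T) (parent T') n (descendants T w) (descendants T' w')
          (insert (w, w') (insert (a, b) P \<inter> descendants T w \<times> descendants T' w'))"
          if "(w, w') \<in> m" for w w'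
          using keep[OF that other[OF that]] bb eq that by (cases "w = v") auto
        then show "\<forall>(v, v')\<in>m. v \<in> rootchildren T \<and> v' \<in> rootchildren T' \<and>
            EV k (subtree T v) = EV k (subtree T' v') \<and>
            back_forth (parent T) (parent T') n (descendants T v) (descendants T' v')
              (insert (v, v') (insert (a, b) P \<inter> descendants T v \<times> descendants T' v'))"
          by (intro ballI) (simp only: split_paired_all prod.case mm(1-3) simp_thms)
      qed
      moreover have "b \<in> verts T'" using b(1) by (simp add: verts_subtree)
      ultimately show ?thesis by blast
    next
      case False
      define j where "j = EV k (subtree T v)"
      define A where "A = {v \<in> rootchildren T. EV k (subtree T v) = j}"
      define A' where "A' = {v \<in> rootchildren T'. EV k (subtree T' v) = j}"
      \<comment> \<open>Matched children have equal classes, so only these pairs can occupy members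
        of \<open>A'\<close>.\<close>
      define mj where "mj = {(w, w')\<in>m. w \<in> A}"
      have mj: "mj \<subseteq> m" by (auto simp: mj_def)
      have "j \<in> classes k"
        unfolding j_def using rooted_subtree[OF T rootchild_in_verts[OF 2(1)]] by (rule EV_in_classes)
      then have "num k A = num k A'"
        using fun_cong[OF counts, of j] by (simp add: child_counts_def A_def A'_def)
      moreover have "finite mj" using mj fm(1) by (rule finite_subset)
      moreover have "card mj < k" using card_mono[OF fm(1) mj] fm(4) by simp
      moreover have "inj_on fst mj" using fm(2) mj by (rule inj_on_subset)
      moreover have "v \<in> A" using 2(1) by (simp add: A_def j_def)
      then have "fst ` mj \<subset> A" using False by (auto simp: mj_def image_iff)
      ultimately have "\<exists>v'\<in>A'. v' \<notin> snd ` mj"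
        by (rule num_eq_imp_unmatched)
      then obtain v' where v': "v' \<in> A'" "v' \<notin> snd ` mj" by blast
      have v'2: "v' \<in> rootchildren T'" "EV k (subtree T' v') = EV k (subtree T v)"
        using v'(1) by (auto simp: A'_def j_def)
      have v'm: "v' \<notin> snd ` m"
      proof
        assume "v' \<in> snd ` m"
        then obtain w where w: "(w, v') \<in> m" by auto
        then have "w \<in> A" using mm[OF w] v'2 by (simp add: A_def j_def)
        then show False using w v'(2) by (force simp: mj_def)
      qed
      have "(subtree T v, subtree T' v') \<in> equiv_k k"
        using v'2(2) rooted_subtree[OF T rootchild_in_verts[OF 2(1)]] by (simp flip: EV_eq_iff)
      then have "back_forth (parent T) (parent T') k (descendants T v) (descendants T' v') {(v, v')}"
        using equiv_k_subtree_iff_back_forth[OF T T'] 2(1) v'2(1) by (simp add: rootchild_in_verts)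
      then have "back_forth (parent T) (parent T') (Suc n) (descendants T v) (descendants T' v') {(v, v')}"
        by (rule back_forth_le) (use fm(4) 2(2) in auto)
      then obtain b where b: "b \<in> descendants T' v'"
        "back_forth (parent T) (parent T') n (descendants T v) (descendants T' v') {(a, b), (v, v')}"
        using 2(2) by auto
      have Pv: "P \<inter> descendants T v \<times> descendants T' v' = {}"
      proof -
        have "x \<notin> descendants T v" if "(x, y) \<in> P" for x y
        proof -
          have "(x, y) \<in> insert (root T, root T') (\<Union>(v, v')\<in>m. descendants T v \<times> descendants T' v')"
            using mP that by (rule subsetD)
          then consider "x = root T" | w w' where "(w, w') \<in> m" "x \<in> descendants T w"
            by (elim insertE UN_E) auto
          then show ?thesis
          proof cases
            case 1
            then show ?thesis using root_notin_rootchild_descendants[OF T 2(1)] by simp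
          next
            case (2 w w')
            then show ?thesis
              using rootchildren_disjoint[OF T mm(1)[OF 2(1)] \<open>v \<in> rootchildren T\<close>, of x] False
              by (metis fst_conv image_eqI)
          qed
        qed
        then show ?thesis by blast
      qed
      have "insert (v, v') (insert (a, b) P \<inter> descendants T v \<times> descendants T' v') = {(a, b), (v, v')}"
        using Pv 2(2) b(1) by blast
      with b have bb: "back_forth (parent T) (parent T') n (descendants T v) (descendants T' v')
          (insert (v, v') (insert (a, b) P \<inter> descendants T v \<times> descendants T' v'))" by simp
      have "matched k T T' n (insert (v, v') m) (insert (a, b) P)"
        unfolding matched_def
      proof (intro conjI)
        show "finite (insert (v, v') m)" using fm by simp
        show "card (insert (v, v') m) + n \<le> k"
          using fm(4) card_insert_le_m1[of "Suc (card m)" m "(v, v')"] by simp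
        show "inj_on fst (insert (v, v') m)" "inj_on snd (insert (v, v') m)"
          using fm False v'm by auto
        show "insert (a, b) P \<subseteq> insert (root T, root T')
            (\<Union>(v, v')\<in>insert (v, v') m. descendants T v \<times> descendants T' v')"
          using mP 2(2) b(1) by (simp add: insert_absorb) blast
        have "back_forth (parent T) (parent T') n (descendants T w) (descendants T' w')
          (insert (w, w') (insert (a, b) P \<inter> descendants T w \<times> descendants T' w'))"
          if "(w, w') \<in> m" for w w'
        proof -
          have "w \<noteq> v" using False that by force
          then show ?thesis using keep[OF that other[OF that]] by blast
        qed
        then show "\<forall>(v, v')\<in>insert (v, v') m. v \<in> rootchildren T \<and> v' \<in> rootchildren T' \<and>
            EV k (subtree T v) = EV k (subtree T' v') \<and>
            back_forth (parent T) (parent T') n (descendants T v) (descendants T' v')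
              (insert (v, v') (insert (a, b) P \<inter> descendants T v \<times> descendants T' v'))"
          by (intro ballI, elim insertE)
            (simp_all only: split_paired_all prod.case prod.inject mm(1-3) bb 2(1) v'2 simp_thms)
      qed
      moreover have "b \<in> verts T'" using b(1) by (simp add: verts_subtree)
      ultimately show ?thesis by blast
    qed
  qed
qed

end

lemma matched_back_forth:
  assumes T: "rooted_tree T" "rooted_tree T'" and counts: "child_counts k T = child_counts k T'"
  shows "matched k T T' n m P \<Longrightarrow> back_forth (parent T) (parent T') n (verts T) (verts T') P"
proof (induction n arbitrary: m P)
  case 0
  then show ?case using matched_partial_iso[OF T] by simp
next
  case (Suc n)
  have "\<exists>b\<in>verts T'. back_forth (parent T) (parent T') n (verts T) (verts T') (insert (a, b) P)"
    if "a \<in> verts T" for a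
    using matched_forth[OF T counts Suc.prems that] Suc.IH by blast
  moreover have "\<exists>a\<in>verts T. back_forth (parent T) (parent T') n (verts T) (verts T') (insert (a, b) P)"
    if b: "b \<in> verts T'" for b
  proof -
    obtain a m' where a: "a \<in> verts T" and m': "matched k T' T n m' (insert (b, a) (P\<inverse>))"
      using matched_forth[OF T(2,1) counts[symmetric] matched_converse[OF Suc.prems] b] by blast
    have "(insert (b, a) (P\<inverse>))\<inverse> = insert (a, b) P" by auto
    then have "matched k T T' n (m'\<inverse>) (insert (a, b) P)" using matched_converse[OF m'] by simp
    then show ?thesis using a Suc.IH by blast
  qed
  ultimately show ?case by simp
qed

text \<open>This makes the \<open>THE\<close> in \<open>recGamma\<close> meaningful for the counts
  of every actual tree.\<close>

lemma child_counts_eq_imp_equiv_k: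
  assumes "rooted_tree T" "rooted_tree T'" "child_counts k T = child_counts k T'"
  shows "(T, T') \<in> equiv_k k"
proof -
  have "matched k T T' k {} {(root T, root T')}" by (simp add: matched_def)
  from matched_back_forth[OF assms this] show ?thesis
    using assms(1,2) by (simp add: equiv_k_iff_back_forth)
qed

lemma recGamma_child_counts:
  assumes "rooted_tree T"
  shows "recGamma k (child_counts k T) = EV k T"
  unfolding recGamma_def
proof (rule the_equality)
  fix j assume "\<exists>T'. rooted_tree T' \<and> child_counts k T' = child_counts k T \<and> EV k T' = j"
  then obtain T' where "rooted_tree T'" "child_counts k T' = child_counts k T" "EV k T' = j" by blast
  then show "j = EV k T" using child_counts_eq_imp_equiv_k[of T' T k] assms EV_eq_iff[of T' k T] by simp
qed (use assms in blast)

section \<open>Grafting trees\<close>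

text \<open>By cardinal arithmetic an infinite vertex type has room for a new root and countably
  many disjoint copies of itself.\<close>

lemma exists_inj_option_nat_times:
  assumes "infinite (UNIV :: 'v set)"
  shows "\<exists>f :: (nat \<times> 'v) option \<Rightarrow> 'v. inj f"
proof -
  obtain g :: "nat \<Rightarrow> 'v" where g: "inj g" using infinite_countable_subset[OF assms] by blast
  have "(card_of (UNIV \<times> UNIV :: ('v \<times> 'v) set), card_of (UNIV :: 'v set)) \<in> ordLeq"
    using card_of_Times_same_infinite[OF assms] ordIso_iff_ordLeq by blast
  then obtain h :: "'v \<times> 'v \<Rightarrow> 'v" where h: "inj h"
    using iffD2[OF card_of_ordLeq] by (metis UNIV_Times_UNIV)
  define f where "f x = (case x of None \<Rightarrow> h (g 0, undefined) | Some (i, u) \<Rightarrow> h (g (Suc i), u))"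
    for x :: "(nat \<times> 'v) option"
  have "inj f"
    by (intro injI) (auto simp: f_def inj_eq[OF g] inj_eq[OF h] split: option.splits)
  then show ?thesis by blast
qed

text \<open>\<open>enc\<close> is injective only if \<open>'v\<close> is infinite.\<close>

definition enc :: "(nat \<times> 'v) option \<Rightarrow> 'v" where
  "enc = (SOME f. inj f)"

definition base :: 'v where "base = enc None"
definition node :: "nat \<Rightarrow> 'v \<Rightarrow> 'v" where "node i u = enc (Some (i, u))"

text \<open>Tagging with the position keeps equal members of the list apart, and the result is again
  a tree over \<open>'v\<close>, so that grafting can be iterated.\<close>

definition graft :: "'v rtree list \<Rightarrow> 'v rtree" where
  "graft ts = \<lparr>
     verts = insert base (\<Union>i<length ts. node i ` verts (ts ! i)),
     root = base,
     parent = (\<Union>i<length ts. insert (node i (root (ts ! i)), base)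
       ((\<lambda>(u, w). (node i u, node i w)) ` parent (ts ! i)))\<rparr>"

text \<open>The counts are written as in \<open>Psi_eq_pmf\<close>, so that \<open>Psi\<close> is
  the law of \<open>gamma k\<close> at a random list of labels.\<close>

definition gamma :: "nat \<Rightarrow> 'v rtree set list \<Rightarrow> 'v rtree set" where
  "gamma k xs = recGamma k (\<lambda>j\<in>classes k. num k {l. l < length xs \<and> xs ! l = j})"

lemma root_graft [simp]: "root (graft ts) = base"
  by (simp add: graft_def)

lemma base_in_graft: "base \<in> verts (graft ts)"
  by (simp add: graft_def)

lemma graft_cases:
  assumes "v \<in> verts (graft ts)"
  obtains "v = base" | i u where "v = node i u" "i < length ts" "u \<in> verts (ts ! i)"
  using assms by (auto simp: graft_def)

lemma parent_graft_cases:
  assumes "(v, w) \<in> parent (graft ts)"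
  obtains i where "v = node i (root (ts ! i))" "w = base" "i < length ts"
    | i u u' where "v = node i u" "w = node i u'" "i < length ts" "(u, u') \<in> parent (ts ! i)"
  using assms by (auto simp: graft_def)

lemma count_list_card: "card {l. l < length xs \<and> xs ! l = j} = count_list xs j"
  by (simp add: count_list_eq_length_filter length_filter_conv_card eq_commute)

lemma exists_list_counts:
  assumes "finite A"
  shows "\<exists>xs. set xs \<subseteq> A \<and> (\<forall>j\<in>A. count_list xs j = n j)"
  using assms
proof (induction A)
  case (insert a A)
  then obtain xs where xs: "set xs \<subseteq> A" "\<forall>j\<in>A. count_list xs j = n j" by auto
  have rep: "count_list (replicate m a) j = (if j = a then m else 0)" for m j
    by (induction m) auto
  show ?case
    using xs insert.hyps
    by (intro exI[of _ "replicate (n a) a @ xs"]) (auto simp: rep count_list_0_iff)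
qed simp

context
  assumes inf: "infinite (UNIV :: 'v set)"
begin

lemma inj_enc: "inj (enc :: (nat \<times> 'v) option \<Rightarrow> 'v)"
  using someI_ex[OF exists_inj_option_nat_times[OF inf]] by (simp add: enc_def)

lemma node_eq_iff: "node i u = (node j w :: 'v) \<longleftrightarrow> i = j \<and> u = w"
  using inj_enc by (auto simp: node_def inj_def)

lemma node_neq_base: "node i u \<noteq> (base :: 'v)" "base \<noteq> (node i u :: 'v)"
  using inj_enc by (auto simp: node_def base_def inj_def)

lemma node_in_graft: "node i u \<in> verts (graft ts) \<longleftrightarrow> i < length ts \<and> u \<in> verts (ts ! i)"
  for u :: 'v and ts
  by (auto simp: graft_def node_eq_iff node_neq_base)

lemma parent_graft_node:
  "(node i u, node j w) \<in> parent (graft ts) \<longleftrightarrow> i = j \<and> i < length ts \<and> (u, w) \<in> parent (ts ! i)"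
  for u :: 'v and ts
  by (fastforce simp: graft_def node_eq_iff node_neq_base)

lemma parent_graft_base:
  "(node i u, base) \<in> parent (graft ts) \<longleftrightarrow> i < length ts \<and> u = root (ts ! i)"
  for u :: 'v and ts
  by (auto simp: graft_def node_eq_iff node_neq_base)

lemma base_no_parent: "(base, w) \<notin> parent (graft ts)" for w :: 'v and ts
  by (auto simp: graft_def node_neq_base)

lemma rtrancl_graft_node:
  fixes u w :: 'v and ts
  assumes "(u, w) \<in> (parent (ts ! i))\<^sup>*" "i < length ts"
  shows "(node i u, node i w) \<in> (parent (graft ts))\<^sup>*"
  using assms(1)
proof (induction rule: rtrancl_induct)
  case (step y z)
  then have "(node i y, node i z) \<in> parent (graft ts)" using assms(2) by (simp add: parent_graft_node)
  with step.IH show ?case by (rule rtrancl_into_rtrancl)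
qed simp

lemma rtrancl_graft_nodeD:
  fixes u v :: 'v and ts
  assumes "(node i u, v) \<in> (parent (graft ts))\<^sup>*" "i < length ts"
  shows "v = base \<or> (\<exists>w. v = node i w \<and> (u, w) \<in> (parent (ts ! i))\<^sup>*)"
  using assms(1)
proof (induction rule: rtrancl_induct)
  case base
  then show ?case by blast
next
  case (step y z)
  then obtain w where w: "y = node i w" "(u, w) \<in> (parent (ts ! i))\<^sup>*"
    using base_no_parent by auto
  from step.hyps(2) show ?case
  proof (cases rule: parent_graft_cases)
    case (2 i' x x')
    then show ?thesis using w by (auto simp: node_eq_iff intro: rtrancl_into_rtrancl)
  qed simp
qed

lemma rooted_graft:
  fixes ts :: "'v rtree list"
  assumes "\<And>t. t \<in> set ts \<Longrightarrow> rooted_tree t"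
  shows "rooted_tree (graft ts)"
  unfolding rooted_tree_def root_graft
proof (intro conjI ballI allI)
  have ts: "rooted_tree (ts ! i)" if "i < length ts" for i using assms that by simp
  show "base \<in> verts (graft ts)" by (rule base_in_graft)
  show "parent (graft ts) \<subseteq> verts (graft ts) \<times> verts (graft ts)"
  proof (intro subrelI)
    fix v w assume "(v, w) \<in> parent (graft ts)"
    then show "(v, w) \<in> verts (graft ts) \<times> verts (graft ts)"
    proof (cases rule: parent_graft_cases)
      case (1 i)
      then show ?thesis using root_in_verts[OF ts] by (simp add: node_in_graft base_in_graft)
    next
      case (2 i u u')
      then show ?thesis using parent_in_verts[OF ts 2(4)] by (simp add: node_in_graft)
    qed
  qed
  show "(base, w) \<notin> parent (graft ts)" for w by (rule base_no_parent)
  show "\<exists>!w. (v, w) \<in> parent (graft ts)" if "v \<in> verts (graft ts) - {base}" for v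
  proof -
    from that obtain i u where v: "v = node i u" "i < length ts" "u \<in> verts (ts ! i)"
      by (auto elim: graft_cases)
    show ?thesis
    proof (cases "u = root (ts ! i)")
      case True
      then have "(v, base) \<in> parent (graft ts)" using v by (simp add: parent_graft_base)
      moreover have "w = base" if "(v, w) \<in> parent (graft ts)" for w
        using that
      proof (cases rule: parent_graft_cases)
        case (2 j x x')
        then show ?thesis using v True root_no_parent[OF ts[OF v(2)]] by (auto simp: node_eq_iff)
      qed simp
      ultimately show ?thesis by blast
    next
      case False
      with ex1_parent[OF ts[OF v(2)] v(3)] obtain w where w: "(u, w) \<in> parent (ts ! i)" by blast
      then have "(v, node i w) \<in> parent (graft ts)" using v by (simp add: parent_graft_node)
      moreover have "w' = node i w" if "(v, w') \<in> parent (graft ts)" for w'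
        using that
      proof (cases rule: parent_graft_cases)
        case (1 j)
        then show ?thesis using v False by (auto simp: node_eq_iff)
      next
        case (2 j x x')
        then show ?thesis using v w parent_unique[OF ts[OF v(2)]] by (auto simp: node_eq_iff)
      qed
      ultimately show ?thesis by blast
    qed
  qed
  show "(v, base) \<in> (parent (graft ts))\<^sup>*" if "v \<in> verts (graft ts)" for v
    using that
  proof (cases rule: graft_cases)
    case (2 i u)
    have "(v, node i (root (ts ! i))) \<in> (parent (graft ts))\<^sup>*"
      using 2 rtrancl_graft_node[OF rtrancl_root[OF ts]] by simp
    moreover have "(node i (root (ts ! i)), base) \<in> parent (graft ts)"
      using 2 by (simp add: parent_graft_base)
    ultimately show ?thesis by (rule rtrancl_into_rtrancl)
  qed simp
qed

lemma descendants_graft: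
  fixes u :: 'v and ts
  assumes "i < length ts"
  shows "descendants (graft ts) (node i u) = node i ` descendants (ts ! i) u"
proof (intro equalityI subsetI)
  fix v assume "v \<in> descendants (graft ts) (node i u)"
  then have v: "v \<in> verts (graft ts)" "(v, node i u) \<in> (parent (graft ts))\<^sup>*"
    by (simp_all add: verts_subtree)
  from v(1) show "v \<in> node i ` descendants (ts ! i) u"
  proof (cases rule: graft_cases)
    case 1
    then show ?thesis using v(2) base_no_parent node_neq_base by (metis converse_rtranclE)
  next
    case (2 j w)
    then show ?thesis using rtrancl_graft_nodeD[OF v(2)[unfolded 2(1)] 2(2)]
      by (auto simp: node_eq_iff node_neq_base verts_subtree)
  qed
next
  fix v assume "v \<in> node i ` descendants (ts ! i) u"
  then show "v \<in> descendants (graft ts) (node i u)"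
    using assms rtrancl_graft_node by (auto simp: verts_subtree node_in_graft)
qed

lemma subtree_graft_equiv_k:
  fixes u :: 'v and ts
  assumes "\<And>t. t \<in> set ts \<Longrightarrow> rooted_tree t" "i < length ts" "u \<in> verts (ts ! i)"
  shows "(subtree (graft ts) (node i u), subtree (ts ! i) u) \<in> equiv_k k"
proof -
  have r: "rooted_tree (ts ! i)" using assms by simp
  have v: "node i u \<in> verts (graft ts)" using assms by (simp add: node_in_graft)
  have "bij_betw (node i) (descendants (ts ! i) u) (descendants (graft ts) (node i u))"
    using assms(2) by (auto simp: bij_betw_def descendants_graft inj_on_def node_eq_iff)
  then have "back_forth (parent (ts ! i)) (parent (graft ts)) k
      (descendants (ts ! i) u) (descendants (graft ts) (node i u)) {(u, node i u)}"
    using assms self_descendant[OF assms(3)]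
    by (intro back_forth_iso[where f = "node i"]) (auto simp: parent_graft_node)
  then have "(subtree (ts ! i) u, subtree (graft ts) (node i u)) \<in> equiv_k k"
    using equiv_k_subtree_iff_back_forth[OF r rooted_graft[OF assms(1)] assms(3) v] by simp
  then show ?thesis using equiv_equiv_k by (meson equiv_def symE)
qed

lemma rootchildren_graft:
  fixes ts :: "'v rtree list"
  assumes "\<And>t. t \<in> set ts \<Longrightarrow> rooted_tree t"
  shows "rootchildren (graft ts) = (\<lambda>i. node i (root (ts ! i))) ` {..<length ts}"
proof -
  have "v \<in> rootchildren (graft ts) \<longleftrightarrow> v \<in> (\<lambda>i. node i (root (ts ! i))) ` {..<length ts}" for v
  proof -
    have "v \<in> rootchildren (graft ts) \<longleftrightarrow> (v, base) \<in> parent (graft ts)"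
      by (simp add: rootchild_iff[OF rooted_graft[OF assms]])
    also have "\<dots> \<longleftrightarrow> v \<in> (\<lambda>i. node i (root (ts ! i))) ` {..<length ts}"
      by (auto simp: parent_graft_base node_neq_base elim: parent_graft_cases)
    finally show ?thesis .
  qed
  then show ?thesis by blast
qed

text \<open>The subtree at the \<open>i\<close>-th child is an isomorphic copy of
  \<open>ts ! i\<close>, so the children of class \<open>j\<close> correspond to the positions of
  \<open>j\<close> in the list of classes.\<close>

lemma EV_graft:
  fixes ts :: "'v rtree list"
  assumes "\<And>t. t \<in> set ts \<Longrightarrow> rooted_tree t"
  shows "EV k (graft ts) = gamma k (map (EV k) ts)"
proof -
  let ?r = "\<lambda>i. node i (root (ts ! i))"
  have EVi: "EV k (subtree (graft ts) (?r i)) = EV k (ts ! i)" if "i < length ts" for i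
  proof -
    have r: "rooted_tree (ts ! i)" using assms that by simp
    have "?r i \<in> verts (graft ts)" using that root_in_verts[OF r] by (simp add: node_in_graft)
    then show ?thesis
      using EV_eq_iff[OF rooted_subtree[OF rooted_graft[OF assms]]]
        subtree_graft_equiv_k[OF assms that root_in_verts[OF r], of k] subtree_root[OF r] by simp
  qed
  have "num k {v \<in> rootchildren (graft ts). EV k (subtree (graft ts) v) = j}
      = num k {l. l < length (map (EV k) ts) \<and> map (EV k) ts ! l = j}" (is "num k ?A = num k ?B") for j
  proof -
    have "?A = ?r ` ?B"
      using EVi by (auto simp: rootchildren_graft[OF assms] image_iff)
    moreover have "inj_on ?r ?B" by (auto simp: inj_on_def node_eq_iff)
    ultimately show ?thesis by (simp add: num_def card_image finite_image_iff)
  qed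
  then have "child_counts k (graft ts) =
      (\<lambda>j\<in>classes k. num k {l. l < length (map (EV k) ts) \<and> map (EV k) ts ! l = j})"
    unfolding child_counts_def by (intro restrict_ext) blast
  then show ?thesis
    using recGamma_child_counts[of "graft ts" k] rooted_graft[of ts] assms by (simp add: gamma_def)
qed

text \<open>\<open>recGamma\<close> is a definite description, so some tree must be shown to have
  these counts: graft representatives of the members of \<open>xs\<close>.\<close>

lemma gamma_in_classes:
  assumes "set xs \<subseteq> classes k"
  shows "gamma k xs \<in> (classes k :: 'v rtree set set)"
proof -
  have "\<forall>j\<in>classes k. \<exists>T :: 'v rtree. rooted_tree T \<and> EV k T = j" by (metis classesE)
  then obtain rep :: "'v rtree set \<Rightarrow> 'v rtree" where
    rep: "\<And>j. j \<in> classes k \<Longrightarrow> rooted_tree (rep j) \<and> EV k (rep j) = j" by metis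
  have r: "rooted_tree t" if "t \<in> set (map rep xs)" for t using that assms rep by auto
  have "map (EV k) (map rep xs) = xs" using assms rep by (auto intro!: map_idI)
  moreover have "EV k (graft (map rep xs)) = gamma k (map (EV k) (map rep xs))"
    by (rule EV_graft) (rule r)
  moreover have "rooted_tree (graft (map rep xs))" by (rule rooted_graft) (rule r)
  ultimately show ?thesis using EV_in_classes by metis
qed

end

text \<open>A leaf is a hole. One and the same term can be completed to a tree by
  \<open>tree_of\<close> or evaluated on classes by \<open>class_of\<close>, for several labelings
  at once; the coupling of two starting distributions rests on this.\<close>

datatype 'l ltree = Leaf 'l | Node "'l ltree list"

primrec tree_of :: "('l \<Rightarrow> 'v rtree) \<Rightarrow> 'l ltree \<Rightarrow> 'v rtree" where
  "tree_of f (Leaf l) = f l"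
| "tree_of f (Node ts) = graft (map (tree_of f) ts)"

primrec class_of :: "nat \<Rightarrow> ('l \<Rightarrow> 'v rtree set) \<Rightarrow> 'l ltree \<Rightarrow> 'v rtree set" where
  "class_of k p (Leaf l) = p l"
| "class_of k p (Node ts) = gamma k (map (class_of k p) ts)"

lemma rooted_tree_of:
  fixes f :: "'l \<Rightarrow> 'v rtree"
  assumes "infinite (UNIV :: 'v set)"
  shows "(\<And>l. l \<in> set_ltree t \<Longrightarrow> rooted_tree (f l)) \<Longrightarrow> rooted_tree (tree_of f t)"
proof (induction t)
  case (Node ts)
  have "rooted_tree (graft (map (tree_of f) ts))"
    by (rule rooted_graft[OF assms]) (use Node in force)
  then show ?case by simp
qed simp

lemma EV_tree_of:
  fixes f :: "'l \<Rightarrow> 'v rtree"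
  assumes "infinite (UNIV :: 'v set)"
  shows "(\<And>l. l \<in> set_ltree t \<Longrightarrow> rooted_tree (f l)) \<Longrightarrow>
    EV k (tree_of f t) = class_of k (\<lambda>l. EV k (f l)) t"
proof (induction t)
  case (Node ts)
  have r: "rooted_tree t" if "t \<in> set (map (tree_of f) ts)" for t
    using that Node.prems rooted_tree_of[OF assms] by fastforce
  have "map (EV k) (map (tree_of f) ts) = map (class_of k (\<lambda>l. EV k (f l))) ts"
    using Node by auto
  moreover have "EV k (graft (map (tree_of f) ts)) = gamma k (map (EV k) (map (tree_of f) ts))"
    by (rule EV_graft[OF assms]) (rule r)
  ultimately show ?case by (simp only: class_of.simps tree_of.simps)
qed simp

section \<open>Neighbourhoods\<close>

text \<open>With the reflexive closure, the \<open>r\<close>-th power means distance at most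
  \<open>r\<close> in the undirected graph.\<close>

definition adjacent :: "('a \<times> 'a) set \<Rightarrow> ('a \<times> 'a) set" where
  "adjacent E = (E \<union> E\<inverse>)\<^sup>="

definition nbhd :: "('a \<times> 'a) set \<Rightarrow> nat \<Rightarrow> 'a set \<Rightarrow> 'a set" where
  "nbhd E r X = (adjacent E ^^ r) `` X"

lemma adjacent_sym: "(x, y) \<in> adjacent E \<Longrightarrow> (y, x) \<in> adjacent E"
  by (auto simp: adjacent_def)

lemma adjacent_refl: "(x, x) \<in> adjacent E"
  by (simp add: adjacent_def)

lemma relpow_adjacent_sym: "(x, y) \<in> adjacent E ^^ r \<Longrightarrow> (y, x) \<in> adjacent E ^^ r"
proof (induction r arbitrary: y)
  case (Suc r)
  then obtain z where "(x, z) \<in> adjacent E ^^ r" "(z, y) \<in> adjacent E" by auto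
  with Suc.IH show ?case by (meson adjacent_sym relpow_Suc_I2)
qed simp

lemma relpow_adjacent_le: "(x, y) \<in> adjacent E ^^ r \<Longrightarrow> r \<le> s \<Longrightarrow> (x, y) \<in> adjacent E ^^ s"
proof (induction s rule: nat_induct)
  case (Suc s)
  then show ?case by (cases "r = Suc s") (auto intro: adjacent_refl)
qed simp

lemma nbhd_0 [simp]: "nbhd E 0 X = X"
  by (simp add: nbhd_def)

lemma nbhd_SucE:
  assumes "x \<in> nbhd E (Suc r) X"
  obtains z where "z \<in> nbhd E r X" "(z, x) \<in> adjacent E"
  using assms by (auto simp: nbhd_def)

lemma nbhd_le: "r \<le> s \<Longrightarrow> nbhd E r X \<subseteq> nbhd E s X"
  using relpow_adjacent_le by (fastforce simp: nbhd_def)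

lemma nbhd_mono: "X \<subseteq> Y \<Longrightarrow> nbhd E r X \<subseteq> nbhd E r Y"
  by (auto simp: nbhd_def)

lemma nbhd_nbhd: "nbhd E r (nbhd E s X) = nbhd E (s + r) X"
  by (simp add: nbhd_def relpow_add relcomp_Image)

lemma nbhd_insert: "nbhd E r (insert x X) = nbhd E r {x} \<union> nbhd E r X"
  by (auto simp: nbhd_def)

lemma nbhd_single_sym: "x \<in> nbhd E r {y} \<longleftrightarrow> y \<in> nbhd E r {x}"
  using relpow_adjacent_sym by (fastforce simp: nbhd_def)

lemma in_nbhdE:
  assumes "x \<in> nbhd E r X"
  obtains y where "y \<in> X" "x \<in> nbhd E r {y}"
  using assms by (auto simp: nbhd_def)

lemma nbhd_extensive: "X \<subseteq> nbhd E r X"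
  using nbhd_le[of 0 r E X] by simp

lemma nbhd_subset:
  assumes "E \<subseteq> V \<times> V" "X \<subseteq> V"
  shows "nbhd E r X \<subseteq> V"
proof (induction r)
  case (Suc r)
  show ?case
  proof
    fix x assume "x \<in> nbhd E (Suc r) X"
    then obtain z where "z \<in> nbhd E r X" "(z, x) \<in> adjacent E" by (rule nbhd_SucE)
    then show "x \<in> V" using Suc assms(1) by (auto simp: adjacent_def)
  qed
qed (use assms in simp)

text \<open>Otherwise a path from \<open>X\<close> over \<open>x\<close> and \<open>y\<close> to
  \<open>a\<close> would have length at most \<open>r + 1 + r\<close>.\<close>

lemma nbhd_separated:
  assumes "a \<notin> nbhd E (2 * r + 1) X" "x \<in> nbhd E r X" "y \<in> nbhd E r {a}"
  shows "(x, y) \<notin> adjacent E"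
proof
  assume "(x, y) \<in> adjacent E"
  then have "y \<in> nbhd E 1 (nbhd E r X)" using assms(2) by (auto simp: nbhd_def)
  then have "{y} \<subseteq> nbhd E (r + 1) X" by (simp add: nbhd_nbhd)
  then have "nbhd E r {y} \<subseteq> nbhd E r (nbhd E (r + 1) X)" by (rule nbhd_mono)
  moreover have "a \<in> nbhd E r {y}" using assms(3) by (simp add: nbhd_single_sym)
  ultimately have "a \<in> nbhd E (r + 1 + r) X" by (auto simp: nbhd_nbhd)
  moreover have "r + 1 + r = 2 * r + 1" by simp
  ultimately show False using assms(1) by metis
qed

text \<open>The remaining \<open>r\<close> rounds are spent on the vertices of a path from
  \<open>P\<close> to \<open>x\<close>. The path stays in the ball and hence among the admissible
  moves, and its answers form a path from \<open>P\<close> to \<open>y\<close>.\<close>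

lemma back_forth_nbhd:
  assumes "back_forth E E' r A A' Q" "(x, y) \<in> Q" "P \<subseteq> Q" "nbhd E r (fst ` P) \<subseteq> A"
    "x \<in> nbhd E r (fst ` P)"
  shows "y \<in> nbhd E' r (snd ` P)"
  using assms
proof (induction r arbitrary: x y Q)
  case 0
  then obtain b where b: "(x, b) \<in> P" by auto
  with 0 have "b = y" using partial_isoD(1)[of E E' Q x b x y] by auto
  with b show ?case by force
next
  case (Suc r)
  from Suc.prems(5) obtain z where z: "z \<in> nbhd E r (fst ` P)" "(z, x) \<in> adjacent E"
    by (rule nbhd_SucE)
  have sub: "nbhd E r (fst ` P) \<subseteq> A" using Suc.prems(4) nbhd_le[of r "Suc r"] by fastforce
  with z(1) have zA: "z \<in> A" by blast
  with Suc.prems(1) obtain w where w: "back_forth E E' r A A' (insert (z, w) Q)" by auto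
  have "w \<in> nbhd E' r (snd ` P)"
    using Suc.prems(3) sub z(1) by (intro Suc.IH[OF w]) auto
  moreover have iso: "partial_iso E E' (insert (z, w) Q)"
    using back_forth_partial_iso[OF w] zA by blast
  have "(w, y) \<in> adjacent E'"
    using z(2) partial_isoD[OF iso, of z w x y] partial_isoD[OF iso, of x y z w] Suc.prems(2)
    by (auto simp: adjacent_def)
  ultimately show ?case by (auto simp: nbhd_def)
qed

text \<open>The \<open>r\<close> additional rounds are never played in the restricted game. Held in
  reserve after each move, they certify by \<open>back_forth_nbhd\<close> that the answer to a
  vertex of one ball lies in the other ball.\<close>

lemma back_forth_restrict_nbhd:
  assumes "back_forth E E' (g + r) A A' Q" "P \<subseteq> Q" "nbhd E r (fst ` P) \<subseteq> A"
    "nbhd E' r (snd ` P) \<subseteq> A'" "A \<noteq> {}" "A' \<noteq> {}"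
  shows "back_forth E E' g (nbhd E r (fst ` P)) (nbhd E' r (snd ` P)) Q"
  using assms(1,2)
proof (induction g arbitrary: Q)
  case 0
  then show ?case using back_forth_partial_iso[OF _ assms(5)] by auto
next
  case (Suc g)
  have "\<exists>b\<in>nbhd E' r (snd ` P). back_forth E E' g (nbhd E r (fst ` P)) (nbhd E' r (snd ` P)) (insert (a, b) Q)"
    if a: "a \<in> nbhd E r (fst ` P)" for a
  proof -
    have "a \<in> A" using a assms(3) by blast
    with Suc.prems(1) obtain b where b: "back_forth E E' (g + r) A A' (insert (a, b) Q)"
      by auto
    have "back_forth E E' r A A' (insert (a, b) Q)"
      using back_forth_le[OF b, of r] assms(5) by simp
    then have "b \<in> nbhd E' r (snd ` P)"
      by (rule back_forth_nbhd) (use assms(3) Suc.prems(2) a in auto)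
    moreover have "P \<subseteq> insert (a, b) Q" using Suc.prems(2) by blast
    ultimately show ?thesis using Suc.IH[OF b] by blast
  qed
  moreover have "\<exists>a\<in>nbhd E r (fst ` P). back_forth E E' g (nbhd E r (fst ` P)) (nbhd E' r (snd ` P)) (insert (a, b) Q)"
    if b: "b \<in> nbhd E' r (snd ` P)" for b
  proof -
    have "b \<in> A'" using b assms(4) by blast
    with Suc.prems(1) obtain a where a: "back_forth E E' (g + r) A A' (insert (a, b) Q)"
      by auto
    have "back_forth E E' r A A' (insert (a, b) Q)"
      using back_forth_le[OF a, of r] assms(5) by simp
    then have "back_forth E' E r A' A ((insert (a, b) Q)\<inverse>)"
      by (rule back_forth_converse)
    then have "a \<in> nbhd E r (snd ` (P\<inverse>))"
      by (rule back_forth_nbhd) (use assms(4) Suc.prems(2) b in \<open>auto simp: image_image fst_eq_Domain snd_eq_Range\<close>)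
    then have "a \<in> nbhd E r (fst ` P)" by (simp add: fst_eq_Domain snd_eq_Range)
    moreover have "P \<subseteq> insert (a, b) Q" using Suc.prems(2) by blast
    ultimately show ?thesis using Suc.IH[OF a] by blast
  qed
  ultimately show ?case by simp
qed

text \<open>Each move is answered by the strategy of the part in which it is made, while the other
  game gives up a round. As \<open>adjacent\<close> is reflexive, the two separation assumptions
  also make the parts disjoint.\<close>

lemma back_forth_disjoint_Un:
  assumes "back_forth E E' n A A' P" "back_forth E E' n B B' Q" "P \<subseteq> A \<times> A'" "Q \<subseteq> B \<times> B'"
    "A \<noteq> {}" "B \<noteq> {}"
    and sep: "\<And>x y. x \<in> A \<Longrightarrow> y \<in> B \<Longrightarrow> (x, y) \<notin> adjacent E"
    and sep': "\<And>x y. x \<in> A' \<Longrightarrow> y \<in> B' \<Longrightarrow> (x, y) \<notin> adjacent E'"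
  shows "back_forth E E' n (A \<union> B) (A' \<union> B') (P \<union> Q)"
  using assms(1-4)
proof (induction n arbitrary: P Q)
  case 0
  have iso: "partial_iso E E' P" "partial_iso E E' Q" using 0 by simp_all
  have PQ: "(a = a' \<longleftrightarrow> b = b') \<and> ((a, a') \<in> E \<longleftrightarrow> (b, b') \<in> E') \<and> ((a', a) \<in> E \<longleftrightarrow> (b', b) \<in> E')"
    if "(a, b) \<in> P" "(a', b') \<in> Q" for a b a' b'
  proof -
    have "a \<in> A" "b \<in> A'" "a' \<in> B" "b' \<in> B'" using that 0(3,4) by auto
    then show ?thesis using sep[of a a'] sep'[of b b'] by (auto simp: adjacent_def)
  qed
  have "(a = a' \<longleftrightarrow> b = b') \<and> ((a, a') \<in> E \<longleftrightarrow> (b, b') \<in> E')"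
    if "(a, b) \<in> P \<union> Q" "(a', b') \<in> P \<union> Q" for a b a' b'
    using that partial_isoD[OF iso(1), of a b a' b'] partial_isoD[OF iso(2), of a b a' b']
      PQ[of a b a' b'] PQ[of a' b' a b] by blast
  then show ?case unfolding back_forth.simps partial_iso_def by (intro ballI) (simp add: split_beta)
next
  case (Suc n)
  have le: "back_forth E E' n A A' P" "back_forth E E' n B B' Q"
    using back_forth_le[OF Suc.prems(1) _ assms(5), of n] back_forth_le[OF Suc.prems(2) _ assms(6), of n]
    by simp_all
  have inA: "back_forth E E' n (A \<union> B) (A' \<union> B') (insert (a, b) (P \<union> Q))"
    if "back_forth E E' n A A' (insert (a, b) P)" "a \<in> A" "b \<in> A'" for a b
    using Suc.IH[OF that(1) le(2)] that Suc.prems(3,4) by simp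
  have inB: "back_forth E E' n (A \<union> B) (A' \<union> B') (insert (a, b) (P \<union> Q))"
    if "back_forth E E' n B B' (insert (a, b) Q)" "a \<in> B" "b \<in> B'" for a b
    using Suc.IH[OF le(1) that(1)] that Suc.prems(3,4) by simp
  have "\<exists>b\<in>A' \<union> B'. back_forth E E' n (A \<union> B) (A' \<union> B') (insert (a, b) (P \<union> Q))"
    if "a \<in> A \<union> B" for a
    using that
  proof
    assume a: "a \<in> A"
    then obtain b where "b \<in> A'" "back_forth E E' n A A' (insert (a, b) P)"
      using Suc.prems(1) by auto
    then show ?thesis using inA a by blast
  next
    assume a: "a \<in> B"
    then obtain b where "b \<in> B'" "back_forth E E' n B B' (insert (a, b) Q)"
      using Suc.prems(2) by auto
    then show ?thesis using inB a by blast
  qed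
  moreover have "\<exists>a\<in>A \<union> B. back_forth E E' n (A \<union> B) (A' \<union> B') (insert (a, b) (P \<union> Q))"
    if "b \<in> A' \<union> B'" for b
    using that
  proof
    assume b: "b \<in> A'"
    then obtain a where "a \<in> A" "back_forth E E' n A A' (insert (a, b) P)"
      using Suc.prems(1) by auto
    then show ?thesis using inA b by blast
  next
    assume b: "b \<in> B'"
    then obtain a where "a \<in> B" "back_forth E E' n B B' (insert (a, b) Q)"
      using Suc.prems(2) by auto
    then show ?thesis using inB b by blast
  qed
  ultimately show ?case by simp
qed

text \<open>One round for each step of the path, going back from \<open>z\<close>. With it the
  answer to a vertex \<open>m\<close> levels below the root of a subtree is again \<open>m\<close>
  levels below the root of the other subtree.\<close>

lemma back_forth_relpow:
  assumes "back_forth E E' m A A' Q" "(x, z) \<in> (E \<inter> A \<times> A) ^^ m" "(x, y) \<in> Q" "(z, u) \<in> Q" "A \<noteq> {}"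
  shows "(y, u) \<in> E' ^^ m"
  using assms
proof (induction m arbitrary: z u Q)
  case 0
  then show ?case using partial_isoD(1)[of E E' Q x y z u] by simp
next
  case (Suc m)
  then obtain v where v: "(x, v) \<in> (E \<inter> A \<times> A) ^^ m" "(v, z) \<in> E" "v \<in> A" by auto
  with Suc.prems(1) obtain w where w: "back_forth E E' m A A' (insert (v, w) Q)" by auto
  then have "(y, w) \<in> E' ^^ m" using Suc.IH[OF w v(1)] Suc.prems by simp
  moreover have "(w, u) \<in> E'"
    using partial_isoD(2)[OF back_forth_partial_iso[OF w assms(5)], of v w z u] v(2) Suc.prems(4) by simp
  ultimately show ?case by auto
qed

section \<open>Locality\<close>

lemma relpow_mono: "R \<subseteq> S \<Longrightarrow> R ^^ n \<subseteq> S ^^ n" for R S :: "('a \<times> 'a) set"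
  by (induction n) (auto simp: relcomp_mono[THEN subsetD])

lemma depth_mono_subset:
  assumes "rooted_tree S" "rooted_tree T" "parent S \<subseteq> parent T" "v \<in> verts S"
  shows "depth T v = depth T (root S) + depth S v"
  using relpow_depth[OF assms(1,4)] relpow_mono[OF assms(3)] by (intro depth_relpow[OF assms(2)]) blast

definition truncate_tree :: "nat \<Rightarrow> 'v rtree \<Rightarrow> 'v rtree" where
  "truncate_tree d T = (let V = {v \<in> verts T. depth T v \<le> d}
     in \<lparr>verts = V, root = root T, parent = parent T \<inter> V \<times> V\<rparr>)"

lemma verts_truncate_tree: "verts (truncate_tree d T) = {v \<in> verts T. depth T v \<le> d}"
  and root_truncate_tree [simp]: "root (truncate_tree d T) = root T"
  and parent_truncate_tree: "parent (truncate_tree d T) =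
    parent T \<inter> verts (truncate_tree d T) \<times> verts (truncate_tree d T)"
  by (simp_all add: truncate_tree_def Let_def)

lemma rooted_truncate_tree:
  assumes T: "rooted_tree T"
  shows "rooted_tree (truncate_tree d T)"
  unfolding rooted_tree_def root_truncate_tree
proof (intro conjI ballI allI)
  let ?S = "truncate_tree d T"
  have up: "w \<in> verts ?S" if "u \<in> verts ?S" "(u, w) \<in> parent T" for u w
    using that parent_in_verts[OF T that(2)] depth_parent[OF T that(2)]
    by (simp add: verts_truncate_tree)
  show "root T \<in> verts ?S" using root_in_verts[OF T] depth_root[OF T] by (simp add: verts_truncate_tree)
  show "parent ?S \<subseteq> verts ?S \<times> verts ?S" by (simp add: parent_truncate_tree)
  show "(root T, w) \<notin> parent ?S" for w using root_no_parent[OF T] by (simp add: parent_truncate_tree)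
  show "\<exists>!w. (v, w) \<in> parent ?S" if v: "v \<in> verts ?S - {root T}" for v
  proof -
    have "v \<in> verts T" "v \<noteq> root T" using v by (simp_all add: verts_truncate_tree)
    from ex1_parent[OF T this] obtain w where w: "(v, w) \<in> parent T" by blast
    then have "(v, w) \<in> parent ?S" using up[of v w] v by (simp add: parent_truncate_tree)
    moreover have "w' = w" if "(v, w') \<in> parent ?S" for w'
      using that parent_unique[OF T w, of w'] by (simp add: parent_truncate_tree)
    ultimately show ?thesis by blast
  qed
  show "(v, root T) \<in> (parent ?S)\<^sup>*" if v: "v \<in> verts ?S" for v
  proof -
    have "(v, root T) \<in> (parent T)\<^sup>*" using v rtrancl_root[OF T] by (simp add: verts_truncate_tree)
    then show ?thesis using v
    proof (induction rule: converse_rtrancl_induct)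
      case (step u w)
      then have "w \<in> verts ?S" using up by blast
      then have "(u, w) \<in> parent ?S" using step by (simp add: parent_truncate_tree)
      then show ?case using step.IH \<open>w \<in> verts ?S\<close> by (meson converse_rtrancl_into_rtrancl)
    qed simp
  qed
qed

text \<open>A step leaves \<open>T(w)\<close> only from \<open>w\<close>, and the depth changes by
  at most one in each step, so a walk from \<open>a\<close> cannot be at \<open>w\<close> before
  step \<open>m\<close>.\<close>

lemma nbhd_subset_descendants:
  assumes T: "rooted_tree T" and a: "(a, w) \<in> parent T ^^ m" "a \<in> verts T"
  shows "r \<le> m \<Longrightarrow> u \<in> nbhd (parent T) r {a} \<Longrightarrow>
    u \<in> descendants T w \<and> depth T w + m \<le> depth T u + r \<and> depth T u \<le> depth T w + m + r"
proof (induction r arbitrary: u)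
  case 0
  then show ?case using a depth_relpow[OF T a(1)] by (auto simp: verts_subtree rtrancl_power)
next
  case (Suc r)
  from Suc.prems(2) obtain x where x: "x \<in> nbhd (parent T) r {a}" "(x, u) \<in> adjacent (parent T)"
    by (rule nbhd_SucE)
  have IH: "x \<in> descendants T w" "depth T w + m \<le> depth T x + r" "depth T x \<le> depth T w + m + r"
    using Suc.IH[OF _ x(1)] Suc.prems(1) by auto
  from x(2) consider "u = x" | "(x, u) \<in> parent T" | "(u, x) \<in> parent T"
    by (auto simp: adjacent_def)
  then show ?case
  proof cases
    case 1
    then show ?thesis using IH by simp
  next
    case 2
    have "x \<noteq> w" using IH(2) Suc.prems(1) by auto
    then have "u \<in> descendants T w" by (rule parent_descendants[OF T 2 IH(1)])
    then show ?thesis using depth_parent[OF T 2] IH by simp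
  next
    case 3
    then have "u \<in> descendants T w" by (rule child_descendants[OF T _ IH(1)])
    then show ?thesis using depth_parent[OF T 3] IH by simp
  qed
qed

text \<open>Disjointness of the full subtrees ensures that one pebble can spoil at most one copy, so
  that \<open>N\<close> copies outlast fewer than \<open>N\<close> pebbles.\<close>

definition rich :: "nat \<Rightarrow> nat \<Rightarrow> nat \<Rightarrow> 'v rtree \<Rightarrow> bool" where
  "rich N g d T \<longleftrightarrow> (\<forall>S. rooted_tree S \<and> (\<forall>v\<in>verts S. depth S v \<le> d) \<longrightarrow>
     (\<exists>W\<subseteq>verts T. finite W \<and> card W = N \<and>
        (\<forall>w\<in>W. \<forall>w'\<in>W. w \<noteq> w' \<longrightarrow> descendants T w \<inter> descendants T w' = {}) \<and>
        (\<forall>w\<in>W. (S, subtree T w) \<in> equiv_k g)))"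

lemma richE:
  assumes "rich N g d T" "rooted_tree S" "\<And>v. v \<in> verts S \<Longrightarrow> depth S v \<le> d"
  obtains W where "W \<subseteq> verts T" "finite W" "card W = N"
    "\<forall>w\<in>W. \<forall>w'\<in>W. w \<noteq> w' \<longrightarrow> descendants T w \<inter> descendants T w' = {}"
    "\<forall>w\<in>W. (S, subtree T w) \<in> equiv_k g"
proof -
  have "\<exists>W\<subseteq>verts T. finite W \<and> card W = N \<and>
        (\<forall>w\<in>W. \<forall>w'\<in>W. w \<noteq> w' \<longrightarrow> descendants T w \<inter> descendants T w' = {}) \<and>
        (\<forall>w\<in>W. (S, subtree T w) \<in> equiv_k g)"
    using assms by (simp add: rich_def)
  then show ?thesis by (elim exE conjE) (rule that)
qed

text \<open>Let \<open>w\<close> be the ancestor \<open>m\<close> levels above \<open>a\<close>. The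
  ball around \<open>a\<close> lies in the part of \<open>T(w)\<close> of depth at most
  \<open>d\<close>, of which \<open>T'\<close> has \<open>N\<close> copies up to equivalence, and
  each copy offers an answer to \<open>a\<close>. The bound on \<open>K\<close> pays one round for
  \<open>a\<close>, then \<open>m\<close> rounds to fix the height of the answer in its copy,
  \<open>r\<close> to keep the game inside the balls, and \<open>g\<close> to play.\<close>

lemma far_vertex_answer:
  fixes T T' :: "'v rtree"
  assumes T: "rooted_tree T" "rooted_tree T'" and rich: "rich N K d T'"
    and K: "g + r + m < K" and d: "m + r \<le> d" and r: "r \<le> m" and s: "s \<le> m"
    and a: "a \<in> verts T" "m \<le> depth T a"
    and Y: "finite Y" "card Y < N"
  shows "\<exists>b\<in>verts T'. b \<notin> nbhd (parent T') s Y \<and>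
    back_forth (parent T) (parent T') g (nbhd (parent T) r {a}) (nbhd (parent T') r {b}) {(a, b)}"
proof -
  let ?E = "parent T" and ?E' = "parent T'"
  have "(a, root T) \<in> ?E ^^ (m + (depth T a - m))" using relpow_depth[OF T(1) a(1)] a(2) by simp
  then obtain w where w: "(a, w) \<in> ?E ^^ m" by (auto simp: relpow_add)
  have wV: "w \<in> verts T"
    using w a(1) parent_rtrancl_in_verts[OF _ T(1)] by (auto simp: rtrancl_power)
  define S where "S = truncate_tree d (subtree T w)"
  have S: "rooted_tree S" "root S = w" "parent S \<subseteq> ?E"
    using rooted_truncate_tree[OF rooted_subtree[OF T(1) wV]]
    by (auto simp: S_def parent_truncate_tree parent_subtree)
  have depth_w: "depth T u = depth T w + depth (subtree T w) u" if "u \<in> descendants T w" for u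
    using depth_mono_subset[OF rooted_subtree[OF T(1) wV] T(1) _ that] by (simp add: parent_subtree)
  have nS: "nbhd ?E r {a} \<subseteq> verts S"
  proof
    fix u assume u: "u \<in> nbhd ?E r {a}"
    have u': "u \<in> descendants T w" "depth T u \<le> depth T w + m + r"
      using nbhd_subset_descendants[OF T(1) w a(1) r u] by auto
    then show "u \<in> verts S" using depth_w[OF u'(1)] d by (simp add: S_def verts_truncate_tree)
  qed
  have aS: "a \<in> verts S" using nS nbhd_extensive[of "{a}" ?E r] by blast
  have ES: "?E \<inter> verts S \<times> verts S = parent S"
    by (auto simp: S_def parent_truncate_tree parent_subtree verts_truncate_tree)
  have wS: "w \<in> verts S" using root_in_verts[OF S(1)] S(2) by simp
  have "depth S v \<le> d" if "v \<in> verts S" for v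
  proof -
    have "v \<in> descendants T w" "depth (subtree T w) v \<le> d"
      using that by (simp_all add: S_def verts_truncate_tree)
    then show ?thesis using depth_mono_subset[OF S(1) T(1) S(3) that] S(2) depth_w by simp
  qed
  then obtain W where W: "W \<subseteq> verts T'" "finite W" "card W = N"
    "\<forall>w\<in>W. \<forall>w'\<in>W. w \<noteq> w' \<longrightarrow> descendants T' w \<inter> descendants T' w' = {}"
    "\<forall>w\<in>W. (S, subtree T' w) \<in> equiv_k K"
    by (rule richE[OF rich S(1)])
  have ex: "\<exists>b. b \<in> descendants T' v \<and> (b, v) \<in> ?E' ^^ m \<and>
    back_forth ?E ?E' g (nbhd ?E r {a}) (nbhd ?E' r {b}) {(a, b)}" if v: "v \<in> W" for v
  proof -
    have vV: "v \<in> verts T'" using v W(1) by blast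
    have vD: "v \<in> descendants T' v" using vV by (rule self_descendant)
    have "back_forth (parent S) (parent (subtree T' v)) K (verts S) (descendants T' v) {(w, v)}"
      using bspec[OF W(5) v] equiv_k_iff_back_forth[OF S(1) rooted_subtree[OF T(2) vV]] S(2) by simp
    then have bf: "back_forth ?E ?E' K (verts S) (descendants T' v) {(w, v)}"
      by (subst back_forth_edges_cong[where F = "parent S" and F' = "parent (subtree T' v)"])
        (use vD wS ES in \<open>auto simp: parent_subtree\<close>)
    have "back_forth ?E ?E' (Suc (g + r + m)) (verts S) (descendants T' v) {(w, v)}"
      by (rule back_forth_le[OF bf _ verts_nonempty[OF S(1)]]) (use K in simp)
    then obtain b where b: "b \<in> descendants T' v"
        "back_forth ?E ?E' (g + r + m) (verts S) (descendants T' v) {(a, b), (w, v)}"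
      using aS by auto
    have "(a, w) \<in> parent S ^^ depth S a" using relpow_depth[OF S(1) aS] S(2) by simp
    moreover have "depth S a = m"
      using depth_mono_subset[OF S(1) T(1) S(3) aS] S(2) depth_relpow[OF T(1) w] by simp
    ultimately have "(a, w) \<in> (?E \<inter> verts S \<times> verts S) ^^ m" using ES by simp
    moreover have "back_forth ?E ?E' m (verts S) (descendants T' v) {(a, b), (w, v)}"
      by (rule back_forth_le[OF b(2) _ verts_nonempty[OF S(1)]]) simp
    ultimately have bv: "(b, v) \<in> ?E' ^^ m"
      using verts_nonempty[OF S(1)] by (intro back_forth_relpow[of ?E ?E' m "verts S"]) auto
    have bV: "b \<in> verts T'" using b(1) by (simp add: verts_subtree)
    have nb: "nbhd ?E' r {b} \<subseteq> descendants T' v"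
      using nbhd_subset_descendants[OF T(2) bv bV r] by blast
    have "back_forth ?E ?E' (g + r) (verts S) (descendants T' v) {(a, b), (w, v)}"
      by (rule back_forth_le[OF b(2) _ verts_nonempty[OF S(1)]]) simp
    then have "back_forth ?E ?E' (g + r) (verts S) (descendants T' v) {(a, b)}"
      by (rule back_forth_mono) simp
    from back_forth_restrict_nbhd[OF this order.refl] nS nb aS vD
    have "back_forth ?E ?E' g (nbhd ?E r {a}) (nbhd ?E' r {b}) {(a, b)}" by auto
    then show ?thesis using b(1) bv by blast
  qed
  then obtain b where b: "\<And>v. v \<in> W \<Longrightarrow> b v \<in> descendants T' v" "\<And>v. v \<in> W \<Longrightarrow> (b v, v) \<in> ?E' ^^ m"
    "\<And>v. v \<in> W \<Longrightarrow> back_forth ?E ?E' g (nbhd ?E r {a}) (nbhd ?E' r {b v}) {(a, b v)}"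
    by metis
  \<comment> \<open>A member of \<open>Y\<close> within distance \<open>s \<le> m\<close> of
    \<open>b v\<close> lies below \<open>v\<close>. The copies are disjoint, so different copies are
    spoilt by different members of \<open>Y\<close>, which are too few.\<close>
  have "\<exists>v\<in>W. b v \<notin> nbhd ?E' s Y"
  proof (rule ccontr)
    assume "\<not> ?thesis"
    then have "\<forall>v\<in>W. \<exists>y. y \<in> Y \<and> y \<in> nbhd ?E' s {b v}"
      by (metis in_nbhdE nbhd_single_sym)
    then obtain y where y: "\<And>v. v \<in> W \<Longrightarrow> y v \<in> Y" "\<And>v. v \<in> W \<Longrightarrow> y v \<in> nbhd ?E' s {b v}" by metis
    have yD: "y v \<in> descendants T' v" if "v \<in> W" for v
    proof -
      have "b v \<in> verts T'" using b(1)[OF that] by (simp add: verts_subtree)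
      from nbhd_subset_descendants[OF T(2) b(2)[OF that] this s y(2)[OF that]] show ?thesis by blast
    qed
    have "inj_on y W"
      by (rule inj_onI) (metis W(4) yD disjoint_iff)
    then have "card W \<le> card Y" using y(1) Y(1) by (intro card_inj_on_le) auto
    then show False using Y(2) W(3) by simp
  qed
  then obtain v where v: "v \<in> W" "b v \<notin> nbhd ?E' s Y" by blast
  have "b v \<in> verts T'" using b(1)[OF v(1)] by (simp add: verts_subtree)
  then show ?thesis using v b(3) by blast
qed

text \<open>Balls of radius \<open>r\<close> around vertices at distance more than \<open>2 * r + 1\<close> are disjoint and not
  joined by an edge; a closer vertex has its ball inside the ball of radius \<open>3 * r + 1\<close>. Recognising
  the members of a ball of radius \<open>r\<close> costs \<open>r\<close> rounds, which accounts for \<open>game_rank\<close>.\<close>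

primrec radius :: "nat \<Rightarrow> nat" where
  "radius 0 = 0"
| "radius (Suc n) = 3 * radius n + 1"

primrec game_rank :: "nat \<Rightarrow> nat" where
  "game_rank 0 = 0"
| "game_rank (Suc n) = Suc (game_rank n + radius (Suc n))"

lemma radius_mono: "m \<le> n \<Longrightarrow> radius m \<le> radius n"
  by (induction n) (auto simp: le_Suc_eq)

lemma rank_mono: "m \<le> n \<Longrightarrow> game_rank m \<le> game_rank n"
  by (induction n) (auto simp: le_Suc_eq)

text \<open>The bound is \<open>Suc k\<close> because the pair of roots is counted among the
  pebbles.\<close>

definition locally_matched ::
    "nat \<Rightarrow> 'v rtree \<Rightarrow> 'v rtree \<Rightarrow> nat \<Rightarrow> ('v \<times> 'v) set \<Rightarrow> bool" where
  "locally_matched k T T' n P \<longleftrightarrow>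
     finite P \<and> card P + n \<le> Suc k \<and> P \<subseteq> verts T \<times> verts T' \<and> (root T, root T') \<in> P \<and>
     back_forth (parent T) (parent T') (game_rank n)
       (nbhd (parent T) (radius n) (fst ` P)) (nbhd (parent T') (radius n) (snd ` P)) P"

lemma locally_matched_converse:
  assumes "locally_matched k T T' n P"
  shows "locally_matched k T' T n (P\<inverse>)"
proof -
  have "back_forth (parent T') (parent T) (game_rank n)
       (nbhd (parent T') (radius n) (snd ` P)) (nbhd (parent T) (radius n) (fst ` P)) (P\<inverse>)"
    using assms by (intro back_forth_converse) (simp add: locally_matched_def)
  then show ?thesis
    using assms by (auto simp: locally_matched_def card_inverse fst_eq_Domain snd_eq_Range)
qed

text \<open>Chosen to exceed \<open>g + r + m\<close> in \<open>far_vertex_answer\<close> for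
  \<open>g = game_rank k\<close>, \<open>r = radius k\<close> and
  \<open>m = 2 * r + 1\<close>.\<close>

definition locality_rank :: "nat \<Rightarrow> nat" where
  "locality_rank k = Suc (game_rank k + 3 * radius k + 1)"

text \<open>At most \<open>k\<close> pebbles, the root included, lie on a tree when a far move has
  to be answered, so \<open>Suc k\<close> copies suffice. The depth \<open>radius (Suc k)\<close> is
  \<open>m + r\<close> for the same \<open>m\<close> and \<open>r\<close> as in
  \<open>locality_rank\<close>.\<close>

definition universal :: "nat \<Rightarrow> 'v rtree \<Rightarrow> bool" where
  "universal k T \<longleftrightarrow> rich (Suc k) (locality_rank k) (radius (Suc k)) T"

lemma locally_matched_forth:
  assumes T: "rooted_tree T" "rooted_tree T'" and univ: "universal k T'"
    and P: "locally_matched k T T' (Suc n) P" and a: "a \<in> verts T"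
  shows "\<exists>b\<in>verts T'. locally_matched k T T' n (insert (a, b) P)"
proof -
  let ?E = "parent T" and ?E' = "parent T'" and ?r = "radius n"
  let ?A = "nbhd ?E (radius (Suc n)) (fst ` P)" and ?A' = "nbhd ?E' (radius (Suc n)) (snd ` P)"
  have P: "finite P" "card P + Suc n \<le> Suc k" "P \<subseteq> verts T \<times> verts T'" "(root T, root T') \<in> P"
    "back_forth ?E ?E' (game_rank (Suc n)) ?A ?A' P"
    using P by (simp_all add: locally_matched_def del: radius.simps game_rank.simps)
  have PA: "fst ` P \<subseteq> ?A" "snd ` P \<subseteq> ?A'" by (rule nbhd_extensive)+
  have rP: "root T \<in> fst ` P" "root T' \<in> snd ` P" using P(4) by force+
  have nA: "?A \<noteq> {}" and nA': "?A' \<noteq> {}" using PA rP by blast+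
  have card: "card (insert (a, b) P) + n \<le> Suc k" for b
    using P(2) card_insert_le_m1[of "Suc (card P)" P "(a, b)"] by simp
  have main: "locally_matched k T T' n (insert (a, b) P)"
    if "b \<in> verts T'" "back_forth ?E ?E' (game_rank n) (nbhd ?E ?r (insert a (fst ` P)))
        (nbhd ?E' ?r (insert b (snd ` P))) (insert (a, b) P)" for b
    using that P(1,3,4) a card by (simp add: locally_matched_def)
  show ?thesis
  proof (cases "a \<in> nbhd ?E (2 * ?r + 1) (fst ` P)")
    case True
    have le: "2 * ?r + 1 \<le> radius (Suc n)" by simp
    from nbhd_le[OF this] True have aA: "a \<in> ?A" by (rule subsetD)
    \<comment> \<open>One of the rounds in \<open>game_rank (Suc n)\<close> places \<open>a\<close>.
      The reserve \<open>radius (Suc n)\<close> is used twice, to see that \<open>b\<close> is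
      within distance \<open>2 * ?r + 1\<close> of the old pebbles as well, and to confine the game
      to balls of radius \<open>?r\<close>.\<close>
    have "\<exists>b\<in>?A'. back_forth ?E ?E' (game_rank n + radius (Suc n)) ?A ?A' (insert (a, b) P)"
      using P(5) unfolding game_rank.simps back_forth.simps by (elim conjE) (rule bspec[OF _ aA])
    then obtain b where b: "b \<in> ?A'"
      "back_forth ?E ?E' (game_rank n + radius (Suc n)) ?A ?A' (insert (a, b) P)" by (elim bexE)
    have "back_forth ?E ?E' (2 * ?r + 1) ?A ?A' (insert (a, b) P)"
      by (rule back_forth_le[OF b(2) _ nA]) simp
    then have bn: "b \<in> nbhd ?E' (2 * ?r + 1) (snd ` P)"
      by (rule back_forth_nbhd[OF _ insertI1 subset_insertI nbhd_le[OF le] True])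
    have sub: "nbhd F ?r (insert x X) \<subseteq> nbhd F (radius (Suc n)) X"
      if "x \<in> nbhd F (2 * ?r + 1) X" for F :: "('v \<times> 'v) set" and x X
    proof -
      have "insert x X \<subseteq> nbhd F (2 * ?r + 1) X" using that nbhd_extensive[of X F "2 * ?r + 1"] by blast
      then have "nbhd F ?r (insert x X) \<subseteq> nbhd F ?r (nbhd F (2 * ?r + 1) X)" by (rule nbhd_mono)
      also have "\<dots> = nbhd F (radius (Suc n)) X" by (simp add: nbhd_nbhd)
      finally show ?thesis .
    qed
    have "back_forth ?E ?E' (game_rank n + ?r) ?A ?A' (insert (a, b) P)"
      by (rule back_forth_le[OF b(2) _ nA]) simp
    then have "back_forth ?E ?E' (game_rank n) (nbhd ?E ?r (fst ` insert (a, b) P))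
        (nbhd ?E' ?r (snd ` insert (a, b) P)) (insert (a, b) P)"
      by (rule back_forth_restrict_nbhd[OF _ order.refl])
        (simp_all only: image_insert fst_conv snd_conv sub[OF True] sub[OF bn] nA nA' simp_thms)
    moreover have "b \<in> verts T'"
    proof -
      have "snd ` P \<subseteq> verts T'" using P(3) by auto
      from nbhd_subset[OF parent_subset[OF T(2)] this] show ?thesis using b(1) by (rule subsetD)
    qed
    ultimately show ?thesis using main[of b] by (intro bexI[of _ b]) (simp_all only: image_insert fst_conv snd_conv)
  next
    case False
    have n: "n \<le> k" using P(2) by simp
    \<comment> \<open>The root is pebbled, so a vertex far from all pebbles is deep and has an
      ancestor \<open>2 * ?r + 1\<close> levels up.\<close>
    have "2 * ?r + 1 \<le> depth T a"
    proof (rule ccontr)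
      assume *: "\<not> ?thesis"
      have "?E \<subseteq> adjacent ?E" by (auto simp: adjacent_def)
      from subsetD[OF relpow_mono[OF this] relpow_depth[OF T(1) a]]
      have "(root T, a) \<in> adjacent ?E ^^ depth T a" by (rule relpow_adjacent_sym)
      then have "(root T, a) \<in> adjacent ?E ^^ (2 * ?r + 1)"
        by (rule relpow_adjacent_le) (use * in simp)
      then have "a \<in> nbhd ?E (2 * ?r + 1) (fst ` P)" unfolding nbhd_def using rP(1) by (rule ImageI)
      then show False using False by simp
    qed
    moreover have "game_rank n + ?r + (2 * ?r + 1) < locality_rank k"
      using radius_mono[OF n] rank_mono[OF n] by (simp add: locality_rank_def)
    moreover have "2 * ?r + 1 + ?r \<le> radius (Suc k)" using radius_mono[OF n] by simp
    moreover have "card (snd ` P) < Suc k" using card_image_le[OF P(1), of snd] P(2) by simp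
    ultimately obtain b where b: "b \<in> verts T'" "b \<notin> nbhd ?E' (2 * ?r + 1) (snd ` P)"
      "back_forth ?E ?E' (game_rank n) (nbhd ?E ?r {a}) (nbhd ?E' ?r {b}) {(a, b)}"
      using far_vertex_answer[OF T univ[unfolded universal_def], of "game_rank n" ?r "2 * ?r + 1"
          "2 * ?r + 1" a "snd ` P"] a P(1) by auto
    have "game_rank n + ?r \<le> game_rank (Suc n)" "?r \<le> radius (Suc n)" by simp_all
    then have "back_forth ?E ?E' (game_rank n + ?r) ?A ?A' P"
      using back_forth_le[OF P(5) _ nA] by blast
    then have "back_forth ?E ?E' (game_rank n) (nbhd ?E ?r (fst ` P)) (nbhd ?E' ?r (snd ` P)) P"
      by (rule back_forth_restrict_nbhd[OF _ order.refl nbhd_le nbhd_le nA nA']) simp_all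
    then have "back_forth ?E ?E' (game_rank n) (nbhd ?E ?r (fst ` P) \<union> nbhd ?E ?r {a})
        (nbhd ?E' ?r (snd ` P) \<union> nbhd ?E' ?r {b}) (P \<union> {(a, b)})"
    proof (rule back_forth_disjoint_Un[OF _ b(3)])
      show "P \<subseteq> nbhd ?E ?r (fst ` P) \<times> nbhd ?E' ?r (snd ` P)"
        using nbhd_extensive[of "fst ` P" ?E ?r] nbhd_extensive[of "snd ` P" ?E' ?r] by force
      show "{(a, b)} \<subseteq> nbhd ?E ?r {a} \<times> nbhd ?E' ?r {b}" "nbhd ?E ?r {a} \<noteq> {}"
        using nbhd_extensive[of "{a}" ?E ?r] nbhd_extensive[of "{b}" ?E' ?r] by auto
      show "nbhd ?E ?r (fst ` P) \<noteq> {}" using nbhd_extensive[of "fst ` P" ?E ?r] rP(1) by blast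
    qed (rule nbhd_separated[OF False] nbhd_separated[OF b(2)]; assumption)+
    then show ?thesis
      using main[of b] b(1) 
      by (intro bexI[of _ b])
        (simp_all add: nbhd_insert[of _ _ a "fst ` P"] nbhd_insert[of _ _ b "snd ` P"] Un_commute)
  qed
qed

lemma locally_matched_back_forth:
  assumes T: "rooted_tree T" "rooted_tree T'" and univ: "universal k T" "universal k T'"
  shows "locally_matched k T T' n P \<Longrightarrow> back_forth (parent T) (parent T') n (verts T) (verts T') P"
proof (induction n arbitrary: P)
  case 0
  then show ?case by (simp add: locally_matched_def)
next
  case (Suc n)
  have "\<exists>b\<in>verts T'. back_forth (parent T) (parent T') n (verts T) (verts T') (insert (a, b) P)"
    if "a \<in> verts T" for a
    using locally_matched_forth[OF T univ(2) Suc.prems that] Suc.IH by blast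
  moreover have "\<exists>a\<in>verts T. back_forth (parent T) (parent T') n (verts T) (verts T') (insert (a, b) P)"
    if b: "b \<in> verts T'" for b
  proof -
    obtain a where a: "a \<in> verts T" and m': "locally_matched k T' T n (insert (b, a) (P\<inverse>))"
      using locally_matched_forth[OF T(2,1) univ(1) locally_matched_converse[OF Suc.prems] b] by blast
    have "(insert (b, a) (P\<inverse>))\<inverse> = insert (a, b) P" by auto
    then have "locally_matched k T T' n (insert (a, b) P)" using locally_matched_converse[OF m'] by simp
    then show ?thesis using a Suc.IH by blast
  qed
  ultimately show ?case by simp
qed

lemma universal_equiv_k:
  assumes "rooted_tree T" "rooted_tree T'" "universal k T" "universal k T'"
    and "back_forth (parent T) (parent T') (game_rank k)
       (nbhd (parent T) (radius k) {root T}) (nbhd (parent T') (radius k) {root T'}) {(root T, root T')}"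
  shows "(T, T') \<in> equiv_k k"
proof -
  have "locally_matched k T T' k {(root T, root T')}"
    using assms(5) root_in_verts[OF assms(1)] root_in_verts[OF assms(2)]
    by (simp add: locally_matched_def)
  from locally_matched_back_forth[OF assms(1-4) this] show ?thesis
    using assms(1,2) by (simp add: equiv_k_iff_back_forth)
qed

section \<open>A universal finite tree\<close>

primrec subterms :: "'l ltree \<Rightarrow> 'l ltree set" where
  "subterms (Leaf l) = {Leaf l}"
| "subterms (Node ts) = insert (Node ts) (\<Union>(set (map subterms ts)))"

text \<open>Branches may stop at an earlier level with \<open>Node []\<close>; only holes are
  required to be at level \<open>s\<close>.\<close>

primrec leaves_at :: "nat \<Rightarrow> 'l ltree \<Rightarrow> bool" where
  "leaves_at 0 t \<longleftrightarrow> (\<exists>l. t = Leaf l)"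
| "leaves_at (Suc s) t \<longleftrightarrow> (\<exists>ts. t = Node ts \<and> (\<forall>t\<in>set ts. leaves_at s t))"

lemma class_of_cong:
  "(\<And>l. l \<in> set_ltree t \<Longrightarrow> p l = q l) \<Longrightarrow> class_of k p t = class_of k q t"
proof (induction t)
  case (Node ts)
  then have "map (class_of k p) ts = map (class_of k q) ts" by auto
  then show ?case by (simp only: class_of.simps)
qed simp

text \<open>The last clause guarantees that a list built from the counts of a tree mentions only
  classes of actual children, so that an induction on the depth can descend to them.\<close>

lemma exists_list_gamma:
  assumes "a \<in> classes k \<rightarrow>\<^sub>E counts k"
  shows "\<exists>xs :: 'v rtree set list. set xs \<subseteq> classes k \<and> gamma k xs = recGamma k a \<and>
    (\<forall>j\<in>set xs. a j \<noteq> Exactly 0)"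
proof -
  \<comment> \<open>Already \<open>k\<close> occurrences are recorded as \<open>Omega\<close>, so a
    finite list can realise every count vector.\<close>
  define n where "n j = (case a j of Exactly u \<Rightarrow> u | Omega \<Rightarrow> k)" for j
  obtain xs :: "'v rtree set list" where xs: "set xs \<subseteq> classes k" "\<forall>j\<in>classes k. count_list xs j = n j"
    using exists_list_counts[OF finite_classes] by blast
  have "num k {l. l < length xs \<and> xs ! l = j} = a j" if "j \<in> classes k" for j
    using that xs(2) assms
    by (auto simp: num_def count_list_card n_def counts_def split: cnt.splits dest!: PiE_mem)
  then have "(\<lambda>j\<in>classes k. num k {l. l < length xs \<and> xs ! l = j}) = a"
    using assms by (intro extensionalityI[of _ "classes k"]) (auto simp: PiE_def)
  moreover have "a j \<noteq> Exactly 0" if "j \<in> set xs" for j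
  proof
    assume "a j = Exactly 0"
    then have "count_list xs j = 0" using that xs by (auto simp: n_def)
    then show False using that by (simp add: count_list_0_iff)
  qed
  ultimately show ?thesis using xs(1) by (intro exI[of _ xs]) (simp add: gamma_def)
qed

lemma child_counts_in_PiE: "child_counts k T \<in> classes k \<rightarrow>\<^sub>E counts k"
  by (auto simp: child_counts_def num_def counts_def)

lemma depth_subtree:
  assumes T: "rooted_tree T" and v: "v \<in> verts T" and u: "u \<in> descendants T v"
  shows "depth T u = depth T v + depth (subtree T v) u"
  using depth_mono_subset[OF rooted_subtree[OF T v] T _ u] by (simp add: parent_subtree)

lemma nbhd_root:
  assumes T: "rooted_tree T"
  shows "nbhd (parent T) r {root T} = verts (truncate_tree r T)"
proof (intro equalityI subsetI)
  fix u assume "u \<in> nbhd (parent T) r {root T}"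
  then show "u \<in> verts (truncate_tree r T)"
  proof (induction r arbitrary: u)
    case 0
    then show ?case using root_in_verts[OF T] depth_root[OF T] by (simp add: verts_truncate_tree)
  next
    case (Suc r)
    from Suc.prems obtain x where x: "x \<in> nbhd (parent T) r {root T}" "(x, u) \<in> adjacent (parent T)"
      by (rule nbhd_SucE)
    have IH: "x \<in> verts T" "depth T x \<le> r" using Suc.IH[OF x(1)] by (simp_all add: verts_truncate_tree)
    from x(2) consider "u = x" | "(x, u) \<in> parent T" | "(u, x) \<in> parent T"
      by (auto simp: adjacent_def)
    then show ?case
    proof cases
      case 1
      then show ?thesis using IH by (simp add: verts_truncate_tree)
    next
      case 2
      then show ?thesis using IH parent_in_verts[OF T 2] depth_parent[OF T 2] by (simp add: verts_truncate_tree)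
    next
      case 3
      then show ?thesis using IH parent_in_verts[OF T 3] depth_parent[OF T 3] by (simp add: verts_truncate_tree)
    qed
  qed
next
  fix u assume "u \<in> verts (truncate_tree r T)"
  then have u: "u \<in> verts T" "depth T u \<le> r" by (simp_all add: verts_truncate_tree)
  have "parent T \<subseteq> adjacent (parent T)" by (auto simp: adjacent_def)
  from subsetD[OF relpow_mono[OF this] relpow_depth[OF T u(1)]]
  have "(root T, u) \<in> adjacent (parent T) ^^ depth T u" by (rule relpow_adjacent_sym)
  then have "(root T, u) \<in> adjacent (parent T) ^^ r" using u(2) by (rule relpow_adjacent_le)
  then show "u \<in> nbhd (parent T) r {root T}" by (simp add: nbhd_def)
qed

text \<open>On the common ball around the root the identity is a strategy, and universality extends
  it to the whole trees.\<close>

lemma truncate_tree_eq_imp_equiv_k: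
  assumes T: "rooted_tree T" "rooted_tree T'" and univ: "universal k T" "universal k T'"
    and eq: "truncate_tree (radius k) T = truncate_tree (radius k) T'"
  shows "(T, T') \<in> equiv_k k"
proof (rule universal_equiv_k[OF T univ])
  let ?V = "verts (truncate_tree (radius k) T)"
  have r: "root T = root T'" using arg_cong[OF eq, of root] by simp
  have E: "parent T \<inter> ?V \<times> ?V = parent T' \<inter> ?V \<times> ?V"
    using arg_cong[OF eq, of parent] eq parent_truncate_tree[of "radius k" T]
      parent_truncate_tree[of "radius k" T'] by simp
  have n: "nbhd (parent T) (radius k) {root T} = ?V" "nbhd (parent T') (radius k) {root T'} = ?V"
    using nbhd_root[OF T(1)] nbhd_root[OF T(2)] eq by simp_all
  have rV: "root T \<in> ?V" using root_in_verts[OF rooted_truncate_tree[OF T(1)]] by simp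
  show "back_forth (parent T) (parent T') (game_rank k) (nbhd (parent T) (radius k) {root T})
     (nbhd (parent T') (radius k) {root T'}) {(root T, root T')}"
    unfolding n
  proof (rule back_forth_iso[of "\<lambda>x. x"])
    show "(x, y) \<in> parent T \<longleftrightarrow> (x, y) \<in> parent T'" if "x \<in> ?V" "y \<in> ?V" for x y
      using E that by blast
  qed (use r rV in \<open>auto simp: bij_betw_def\<close>)
qed

context
  assumes inf: "infinite (UNIV :: 'v set)"
begin

lemma depth_graft:
  fixes u :: 'v
  assumes ts: "\<And>t. t \<in> set ts \<Longrightarrow> rooted_tree t" and i: "i < length ts" and u: "u \<in> verts (ts ! i)"
  shows "depth (graft ts) (node i u) = Suc (depth (ts ! i) u)"
proof -
  have r: "rooted_tree (ts ! i)" using ts i by simp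
  have g: "rooted_tree (graft ts)" by (rule rooted_graft[OF inf]) (rule ts)
  have "(node i u, node i w) \<in> parent (graft ts) ^^ n" if "(u, w) \<in> parent (ts ! i) ^^ n" for n w
    using that
  proof (induction n arbitrary: w)
    case (Suc n)
    then obtain x where "(u, x) \<in> parent (ts ! i) ^^ n" "(x, w) \<in> parent (ts ! i)" by auto
    with Suc.IH i have "(node i u, node i x) \<in> parent (graft ts) ^^ n" "(node i x, node i w) \<in> parent (graft ts)"
      by (simp_all add: parent_graft_node[OF inf])
    then show ?case unfolding relpow.simps by (rule relcompI)
  qed simp
  from this[OF relpow_depth[OF r u]]
  have "(node i u, base) \<in> parent (graft ts) ^^ Suc (depth (ts ! i) u)"
    using i by (auto simp: parent_graft_base[OF inf])
  then show ?thesis using depth_eq[OF g] by simp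
qed

lemma truncate_graft_0:
  fixes ts :: "'v rtree list"
  assumes ts: "\<And>t. t \<in> set ts \<Longrightarrow> rooted_tree t"
  shows "truncate_tree 0 (graft ts) = \<lparr>verts = {base}, root = base, parent = {}\<rparr>"
proof -
  have g: "rooted_tree (graft ts)" by (rule rooted_graft[OF inf]) (rule ts)
  have "v = base" if "v \<in> verts (graft ts)" "depth (graft ts) v = 0" for v
    using that(1)
  proof (cases rule: graft_cases)
    case (2 i u)
    then show ?thesis using that(2) depth_graft[OF ts 2(2,3)] by simp
  qed
  then have "verts (truncate_tree 0 (graft ts)) = {base}"
    using depth_root[OF g] base_in_graft by (auto simp: verts_truncate_tree)
  then show ?thesis
    using base_no_parent[OF inf, of base ts]
    by (intro rtree.equality) (simp_all add: parent_truncate_tree)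
qed

lemma truncate_graft_Suc:
  fixes ts :: "'v rtree list"
  assumes ts: "\<And>t. t \<in> set ts \<Longrightarrow> rooted_tree t"
  shows "truncate_tree (Suc d) (graft ts) = graft (map (truncate_tree d) ts)"
proof (rule rtree.equality)
  let ?S = "truncate_tree (Suc d) (graft ts)" and ?G = "graft (map (truncate_tree d) ts)"
  have g: "rooted_tree (graft ts)" by (rule rooted_graft[OF inf]) (rule ts)
  have b: "base \<in> verts ?S" "base \<in> verts ?G"
    using depth_root[OF g] by (simp_all add: base_in_graft verts_truncate_tree)
  have n: "node i u \<in> verts ?S \<longleftrightarrow> node i u \<in> verts ?G" for i u
  proof (cases "i < length ts \<and> u \<in> verts (ts ! i)")
    case True
    then have "depth (graft ts) (node i u) = Suc (depth (ts ! i) u)" by (intro depth_graft[OF ts]) auto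
    then show ?thesis using True by (simp add: verts_truncate_tree node_in_graft[OF inf])
  qed (auto simp: verts_truncate_tree node_in_graft[OF inf])
  show V: "verts ?S = verts ?G"
  proof (intro equalityI subsetI)
    fix v assume v: "v \<in> verts ?S"
    then have "v \<in> verts (graft ts)" by (simp add: verts_truncate_tree)
    then show "v \<in> verts ?G" using b n v by (cases rule: graft_cases) metis+
  next
    fix v assume v: "v \<in> verts ?G"
    then show "v \<in> verts ?S" using b n v by (cases rule: graft_cases) metis+
  qed
  show "parent ?S = parent ?G"
  proof (intro equalityI subrelI)
    fix v w assume "(v, w) \<in> parent ?S"
    then have e: "(v, w) \<in> parent (graft ts)" "v \<in> verts ?G" "w \<in> verts ?G"
      using V by (simp_all add: parent_truncate_tree)
    from e(1) show "(v, w) \<in> parent ?G"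
    proof (cases rule: parent_graft_cases)
      case (1 i)
      then show ?thesis by (simp add: parent_graft_base[OF inf])
    next
      case (2 i u u')
      then show ?thesis
        using e(2,3) by (simp add: parent_graft_node[OF inf] node_in_graft[OF inf] parent_truncate_tree)
    qed
  next
    fix v w assume e: "(v, w) \<in> parent ?G"
    from e show "(v, w) \<in> parent ?S"
    proof (cases rule: parent_graft_cases)
      case (1 i)
      then have "rooted_tree (truncate_tree d (ts ! i))" using ts by (simp add: rooted_truncate_tree)
      from root_in_verts[OF this] have "v \<in> verts ?G" using 1 by (simp add: node_in_graft[OF inf])
      then show ?thesis
        using 1 b V by (simp add: parent_graft_base[OF inf] parent_truncate_tree)
    next
      case (2 i u u')
      then have "v \<in> verts ?G" "w \<in> verts ?G"
        by (auto simp: node_in_graft[OF inf] parent_truncate_tree)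
      then show ?thesis
        using 2 V by (simp add: parent_graft_node[OF inf] parent_truncate_tree)
    qed
  qed
qed simp_all

text \<open>The holes sit at level \<open>s\<close>, below the cut at \<open>d\<close>. As
  \<open>graft\<close> names vertices by positions, the truncations agree literally and not just up
  to isomorphism.\<close>

lemma truncate_tree_of:
  fixes f g :: "'l \<Rightarrow> 'v rtree"
  shows "leaves_at s t \<Longrightarrow> d < s \<Longrightarrow>
    (\<And>l. l \<in> set_ltree t \<Longrightarrow> rooted_tree (f l) \<and> rooted_tree (g l)) \<Longrightarrow>
    truncate_tree d (tree_of f t) = truncate_tree d (tree_of g t)"
proof (induction s arbitrary: t d)
  case (Suc s)
  then obtain ts where t: "t = Node ts" "\<forall>t\<in>set ts. leaves_at s t" by auto
  have r: "rooted_tree S" if "S \<in> set (map (tree_of f) ts) \<or> S \<in> set (map (tree_of g) ts)" for S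
    using that Suc.prems(3) by (auto simp: t(1) intro!: rooted_tree_of[OF inf])
  show ?case
  proof (cases d)
    case 0
    then show ?thesis using r by (simp add: t(1) truncate_graft_0 del: set_map)
  next
    case (Suc d')
    have "truncate_tree d' (tree_of f u) = truncate_tree d' (tree_of g u)" if "u \<in> set ts" for u
      using that t Suc.prems Suc by (intro Suc.IH) auto
    then have "map (truncate_tree d') (map (tree_of f) ts) = map (truncate_tree d') (map (tree_of g) ts)"
      by simp
    then show ?thesis using r truncate_graft_Suc unfolding t(1) tree_of.simps Suc by metis
  qed
qed simp

text \<open>Richness speaks of full subtrees, and grafting adds vertices only above them. Hence one
  occurrence of a rich tree at any place is enough.\<close>

lemma rich_graft:
  fixes ts :: "'v rtree list"
  assumes ts: "\<And>t. t \<in> set ts \<Longrightarrow> rooted_tree t" and t: "t \<in> set ts" "rich N g d t"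
  shows "rich N g d (graft ts)"
  unfolding rich_def
proof (intro allI impI, elim conjE)
  fix S :: "'v rtree" assume S: "rooted_tree S" "\<forall>v\<in>verts S. depth S v \<le> d"
  obtain i where i: "i < length ts" "t = ts ! i" using t(1) by (metis in_set_conv_nth)
  obtain W where W: "W \<subseteq> verts t" "finite W" "card W = N"
    "\<forall>w\<in>W. \<forall>w'\<in>W. w \<noteq> w' \<longrightarrow> descendants t w \<inter> descendants t w' = {}"
    "\<forall>w\<in>W. (S, subtree t w) \<in> equiv_k g"
    by (rule richE[OF t(2) S(1)]) (use S(2) in auto)
  have inj: "inj (node i :: 'v \<Rightarrow> 'v)" by (simp add: inj_def node_eq_iff[OF inf])
  have "(S, subtree (graft ts) (node i w)) \<in> equiv_k g" if "w \<in> W" for w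
  proof -
    have "w \<in> verts (ts ! i)" using W(1) i that by blast
    from subtree_graft_equiv_k[OF inf ts i(1) this, of g]
    have "(subtree t w, subtree (graft ts) (node i w)) \<in> equiv_k g"
      using equiv_equiv_k i(2) by (meson equiv_def symE)
    then show ?thesis using W(5) that equiv_equiv_k by (meson equiv_def transE)
  qed
  moreover have "descendants (graft ts) (node i w) \<inter> descendants (graft ts) (node i w') = {}"
    if "w \<in> W" "w' \<in> W" "node i w \<noteq> node i w'" for w w'
  proof -
    have "w \<noteq> w'" using that(3) by auto
    then have "descendants t w \<inter> descendants t w' = {}"
      using bspec[OF bspec[OF W(4) that(1)] that(2)] by simp
    then have "node i ` (descendants t w \<inter> descendants t w') = {}" by simp
    then show ?thesis
      unfolding descendants_graft[OF inf i(1)] i(2) image_Int[OF inj] .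
  qed
  moreover have "node i ` W \<subseteq> verts (graft ts)" using W(1) i by (auto simp: node_in_graft[OF inf])
  moreover have "card (node i ` W) = N"
    using W(3) inj card_image[of "node i" W] by (auto intro: inj_on_subset)
  ultimately show "\<exists>W\<subseteq>verts (graft ts). finite W \<and> card W = N \<and>
      (\<forall>w\<in>W. \<forall>w'\<in>W. w \<noteq> w' \<longrightarrow> descendants (graft ts) w \<inter> descendants (graft ts) w' = {}) \<and>
      (\<forall>w\<in>W. (S, subtree (graft ts) w) \<in> equiv_k g)"
    using W(2) by (intro exI[of _ "node i ` W"]) simp
qed

lemma rich_tree_of_subterm:
  fixes f :: "'l \<Rightarrow> 'v rtree"
  shows "u \<in> subterms t \<Longrightarrow> (\<And>l. l \<in> set_ltree t \<Longrightarrow> rooted_tree (f l)) \<Longrightarrow>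
    rich N g d (tree_of f u) \<Longrightarrow> rich N g d (tree_of f t)"
proof (induction t)
  case (Node ts)
  show ?case
  proof (cases "u = Node ts")
    case False
    then obtain t where t: "t \<in> set ts" "u \<in> subterms t" using Node.prems(1) by auto
    have "rich N g d (tree_of f t)"
      by (rule Node.IH[OF t _ Node.prems(3)]) (rule Node.prems(2), use t in auto)
    moreover have "rooted_tree S" if "S \<in> set (map (tree_of f) ts)" for S
      using that Node.prems(2) by (auto intro!: rooted_tree_of[OF inf])
    moreover have "tree_of f t \<in> set (map (tree_of f) ts)" using t(1) by simp
    ultimately show ?thesis unfolding tree_of.simps by (metis rich_graft)
  qed (use Node.prems in simp)
qed simp

text \<open>\<open>S\<close> may branch infinitely, but it is equivalent to a finite tree: at every
  level keep at most \<open>k\<close> children of each class, replaced by terms for their classes.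
  Without leaves the completion \<open>f\<close> has no influence.\<close>

lemma exists_leafless_term:
  assumes k: "0 < k"
  shows "rooted_tree (S :: 'v rtree) \<Longrightarrow> (\<And>v. v \<in> verts S \<Longrightarrow> depth S v \<le> d) \<Longrightarrow>
    \<exists>t :: 'l ltree. set_ltree t = {} \<and> (\<forall>f. EV k (tree_of f t) = EV k S)"
proof (induction d arbitrary: S rule: less_induct)
  case (less d)
  obtain xs :: "'v rtree set list" where xs: "set xs \<subseteq> classes k"
    "gamma k xs = recGamma k (child_counts k S)" "\<forall>j\<in>set xs. child_counts k S j \<noteq> Exactly 0"
    using exists_list_gamma[OF child_counts_in_PiE] by blast
  have "\<exists>t :: 'l ltree. set_ltree t = {} \<and> (\<forall>f. EV k (tree_of f t) = j)" if j: "j \<in> set xs" for j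
  proof -
    have "{v \<in> rootchildren S. EV k (subtree S v) = j} \<noteq> {}"
    proof
      assume e: "{v \<in> rootchildren S. EV k (subtree S v) = j} = {}"
      have "child_counts k S j = num k {v \<in> rootchildren S. EV k (subtree S v) = j}"
        using j xs(1) by (auto simp: child_counts_def)
      \<comment> \<open>For \<open>k = 0\<close> even the empty set would be counted as
        \<open>Omega\<close>.\<close>
      also have "\<dots> = Exactly 0" unfolding e using k by (simp add: num_def)
      finally show False using xs(3) j by simp
    qed
    then obtain v where v: "v \<in> rootchildren S" "EV k (subtree S v) = j" by blast
    have vS: "v \<in> verts S" using v(1) by (rule rootchild_in_verts)
    have "1 \<le> d" using less.prems(2)[OF vS] depth_rootchild[OF less.prems(1) v(1)] by simp
    have "\<exists>t :: 'l ltree. set_ltree t = {} \<and> (\<forall>f. EV k (tree_of f t) = EV k (subtree S v))"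
    proof (rule less.IH[of "d - 1"])
      show "d - 1 < d" using \<open>1 \<le> d\<close> by simp
      show "rooted_tree (subtree S v)" by (rule rooted_subtree[OF less.prems(1) vS])
      show "depth (subtree S v) u \<le> d - 1" if u: "u \<in> descendants S v" for u
      proof -
        have "u \<in> verts S" using u by (simp add: verts_subtree)
        from less.prems(2)[OF this] show ?thesis
          using depth_subtree[OF less.prems(1) vS u] depth_rootchild[OF less.prems(1) v(1)] by simp
      qed
    qed
    then show ?thesis using v(2) by simp
  qed
  then have "\<forall>j. \<exists>t :: 'l ltree. j \<in> set xs \<longrightarrow> set_ltree t = {} \<and> (\<forall>f. EV k (tree_of f t) = j)"
    by blast
  from choice[OF this] obtain tm :: "'v rtree set \<Rightarrow> 'l ltree" where
    tm: "\<forall>j. j \<in> set xs \<longrightarrow> set_ltree (tm j) = {} \<and> (\<forall>f. EV k (tree_of f (tm j)) = j)"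
    by (rule exE)
  have "EV k (tree_of f (Node (map tm xs))) = EV k S" for f
  proof -
    have r: "rooted_tree T" if "T \<in> set (map (tree_of f) (map tm xs))" for T
      using that tm by (auto intro!: rooted_tree_of[OF inf])
    have "EV k (graft (map (tree_of f) (map tm xs))) = gamma k (map (EV k) (map (tree_of f) (map tm xs)))"
      by (rule EV_graft[OF inf]) (rule r)
    also have "map (EV k) (map (tree_of f) (map tm xs)) = xs" using tm by (auto intro!: map_idI)
    finally show ?thesis using xs(2) recGamma_child_counts[OF less.prems(1)] by simp
  qed
  moreover have "set_ltree (Node (map tm xs)) = {}" using tm by auto
  ultimately show ?case by blast
qed

text \<open>Below a common root, take \<open>Suc k\<close> copies of a finite tree for each of the
  finitely many classes of rank \<open>locality_rank k\<close> that contain a tree of depth at most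
  \<open>radius (Suc k)\<close>.\<close>

lemma exists_universal_term:
  "\<exists>u :: 'l ltree. set_ltree u = {} \<and> (\<forall>f :: 'l \<Rightarrow> 'v rtree. universal k (tree_of f u))"
proof -
  define g where "g = locality_rank k"
  define d where "d = radius (Suc k)"
  define C where "C = {j. \<exists>S :: 'v rtree. rooted_tree S \<and> (\<forall>v\<in>verts S. depth S v \<le> d) \<and> j = EV g S}"
  have "C \<subseteq> classes g" by (auto simp: C_def EV_in_classes)
  then have finC: "finite C" using finite_classes by (rule finite_subset)
  have g: "0 < g" by (simp add: g_def locality_rank_def)
  have "\<exists>t :: 'l ltree. set_ltree t = {} \<and> (\<forall>f. EV g (tree_of f t) = j)" if "j \<in> C" for j
  proof -
    obtain S :: "'v rtree" where S: "rooted_tree S" "\<forall>v\<in>verts S. depth S v \<le> d" "j = EV g S"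
      using \<open>j \<in> C\<close> by (auto simp: C_def)
    show ?thesis unfolding S(3) by (rule exists_leafless_term[OF g S(1)]) (use S(2) in blast)
  qed
  then have "\<forall>j. \<exists>t :: 'l ltree. j \<in> C \<longrightarrow> set_ltree t = {} \<and> (\<forall>f. EV g (tree_of f t) = j)"
    by blast
  from choice[OF this] obtain tm :: "'v rtree set \<Rightarrow> 'l ltree" where
    tm: "\<forall>j. j \<in> C \<longrightarrow> set_ltree (tm j) = {} \<and> (\<forall>f. EV g (tree_of f (tm j)) = j)"
    by (rule exE)
  obtain us where us: "set us \<subseteq> tm ` C" "\<forall>t\<in>tm ` C. count_list us t = Suc k"
    using exists_list_counts[OF finite_imageI[OF finC], of tm "\<lambda>_. Suc k"] by blast
  have "rich (Suc k) g d (tree_of f (Node us))" for f :: "'l \<Rightarrow> 'v rtree"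
    unfolding rich_def
  proof (intro allI impI, elim conjE)
    let ?ts = "map (tree_of f) us"
    let ?r = "\<lambda>i. node i (root (?ts ! i))"
    fix S :: "'v rtree" assume S: "rooted_tree S" "\<forall>v\<in>verts S. depth S v \<le> d"
    then have j: "EV g S \<in> C" by (auto simp: C_def)
    define I where "I = {i. i < length us \<and> us ! i = tm (EV g S)}"
    have I: "finite I" "card I = Suc k" using us(2) j by (simp_all add: I_def count_list_card)
    have ts: "rooted_tree T" if "T \<in> set ?ts" for T
      using that us(1) tm by (auto intro!: rooted_tree_of[OF inf])
    have ri: "rooted_tree (?ts ! i)" if "i \<in> I" for i
      by (rule ts, rule nth_mem) (use that in \<open>simp add: I_def\<close>)
    have inj: "inj_on ?r I" by (auto simp: inj_on_def node_eq_iff[OF inf])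
    have "(S, subtree (graft ?ts) (?r i)) \<in> equiv_k g" if i: "i \<in> I" for i
    proof -
      have il: "i < length ?ts" using i by (simp add: I_def)
      have "EV g (?ts ! i) = EV g S" using i tm j by (simp add: I_def)
      then have "(?ts ! i, S) \<in> equiv_k g" using EV_eq_iff[OF ri[OF i]] by simp
      moreover have "(subtree (graft ?ts) (?r i), ?ts ! i) \<in> equiv_k g"
        using subtree_graft_equiv_k[OF inf ts il root_in_verts[OF ri[OF i]], of g]
          subtree_root[OF ri[OF i]] by simp
      ultimately show ?thesis using equiv_equiv_k by (meson equiv_def transE symE)
    qed
    moreover have "descendants (graft ?ts) (?r i) \<inter> descendants (graft ?ts) (?r i') = {}"
      if "i \<in> I" "i' \<in> I" "?r i \<noteq> ?r i'" for i i'
    proof -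
      have l: "i < length ?ts" "i' < length ?ts" "i \<noteq> i'" using that by (auto simp: I_def)
      then show ?thesis
        unfolding descendants_graft[OF inf l(1)] descendants_graft[OF inf l(2)]
        by (auto simp: node_eq_iff[OF inf])
    qed
    moreover have "?r ` I \<subseteq> verts (graft ?ts)"
    proof -
      have "?r i \<in> verts (graft ?ts)" if "i \<in> I" for i
        using that root_in_verts[OF ri[OF that]] by (simp add: node_in_graft[OF inf] I_def)
      then show ?thesis by blast
    qed
    moreover have "card (?r ` I) = Suc k" using I(2) card_image[OF inj] by simp
    ultimately show "\<exists>W\<subseteq>verts (tree_of f (Node us)). finite W \<and> card W = Suc k \<and>
        (\<forall>w\<in>W. \<forall>w'\<in>W. w \<noteq> w' \<longrightarrow>
          descendants (tree_of f (Node us)) w \<inter> descendants (tree_of f (Node us)) w' = {}) \<and>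
        (\<forall>w\<in>W. (S, subtree (tree_of f (Node us)) w) \<in> equiv_k g)"
      unfolding tree_of.simps using I(1) by (intro exI[of _ "?r ` I"]) simp
  qed
  moreover have "set_ltree (Node us) = {}" using us(1) tm by auto
  ultimately show ?thesis unfolding universal_def g_def d_def by blast
qed

text \<open>Fill the holes with representatives of the classes given by \<open>p\<close> and by
  \<open>q\<close>. Both trees contain the universal tree and agree up to depth
  \<open>radius k\<close>, so locality makes them equivalent. This is the only fact about the logic
  that the coupling uses.\<close>

lemma class_of_eq:
  fixes p q :: "'l \<Rightarrow> 'v rtree set"
  assumes u: "u \<in> subterms t" "\<And>f :: 'l \<Rightarrow> 'v rtree. universal k (tree_of f u)"
    and t: "leaves_at s t" "radius k < s"
    and pq: "\<And>l. l \<in> set_ltree t \<Longrightarrow> p l \<in> classes k" "\<And>l. l \<in> set_ltree t \<Longrightarrow> q l \<in> classes k"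
  shows "class_of k p t = class_of k q t"
proof -
  have "\<forall>l. \<exists>T :: 'v rtree. l \<in> set_ltree t \<longrightarrow> rooted_tree T \<and> EV k T = p l"
    using pq(1) by (metis classesE)
  then obtain f where f: "\<And>l. l \<in> set_ltree t \<Longrightarrow> rooted_tree (f l) \<and> EV k (f l) = p l" by metis
  have "\<forall>l. \<exists>T :: 'v rtree. l \<in> set_ltree t \<longrightarrow> rooted_tree T \<and> EV k T = q l"
    using pq(2) by (metis classesE)
  then obtain g where g: "\<And>l. l \<in> set_ltree t \<Longrightarrow> rooted_tree (g l) \<and> EV k (g l) = q l" by metis
  have rf: "rooted_tree (tree_of f t)" and rg: "rooted_tree (tree_of g t)"
    using f g by (auto intro!: rooted_tree_of[OF inf])
  have "(tree_of f t, tree_of g t) \<in> equiv_k k"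
  proof (rule truncate_tree_eq_imp_equiv_k[OF rf rg])
    show "universal k (tree_of f t)" "universal k (tree_of g t)"
      unfolding universal_def
      by (rule rich_tree_of_subterm[OF u(1)], use f g u(2) in \<open>auto simp: universal_def\<close>)+
    show "truncate_tree (radius k) (tree_of f t) = truncate_tree (radius k) (tree_of g t)"
      by (rule truncate_tree_of[OF t]) (use f g in blast)
  qed
  then have "EV k (tree_of f t) = EV k (tree_of g t)" using EV_eq_iff[OF rf] by simp
  moreover have "EV k (tree_of f t) = class_of k (\<lambda>l. EV k (f l)) t"
    by (rule EV_tree_of[OF inf]) (use f in blast)
  moreover have "EV k (tree_of g t) = class_of k (\<lambda>l. EV k (g l)) t"
    by (rule EV_tree_of[OF inf]) (use g in blast)
  moreover have "class_of k (\<lambda>l. EV k (f l)) t = class_of k p t"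
    by (rule class_of_cong) (use f in blast)
  moreover have "class_of k (\<lambda>l. EV k (g l)) t = class_of k q t"
    by (rule class_of_cong) (use g in blast)
  ultimately show ?thesis by simp
qed

end

section \<open>Random trees\<close>

primrec random_tree :: "real \<Rightarrow> 'l pmf \<Rightarrow> nat \<Rightarrow> 'l ltree pmf" where
  "random_tree c X 0 = map_pmf Leaf X"
| "random_tree c X (Suc s) =
     map_pmf Node (bind_pmf (poisson_pmf c) (\<lambda>n. replicate_pmf n (random_tree c X s)))"

lemma set_random_tree:
  assumes "0 < c"
  shows "t \<in> set_pmf (random_tree c X s) \<Longrightarrow> leaves_at s t \<and> set_ltree t \<subseteq> set_pmf X"
proof (induction s arbitrary: t)
  case (Suc s)
  then obtain ts where ts: "t = Node ts" "set ts \<subseteq> set_pmf (random_tree c X s)"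
    by (auto simp: set_replicate_pmf)
  have "leaves_at s u \<and> set_ltree u \<subseteq> set_pmf X" if "u \<in> set ts" for u
    using Suc.IH that ts(2) by blast
  then show ?case using ts(1) by (auto dest: subsetD)
qed auto

lemma map_replicate_pmf:
  "map_pmf (map f) (replicate_pmf n M) = replicate_pmf n (map_pmf f M)"
proof (induction n)
  case (Suc n)
  have "replicate_pmf (Suc n) (map_pmf f M) =
      bind_pmf M (\<lambda>x. bind_pmf (map_pmf (map f) (replicate_pmf n M)) (\<lambda>xs. return_pmf (f x # xs)))"
    by (simp add: Suc bind_map_pmf)
  also have "\<dots> = map_pmf (map f) (replicate_pmf (Suc n) M)"
    by (simp add: map_bind_pmf bind_map_pmf)
  finally show ?case by simp
qed simp

lemma map_class_of_random_tree:
  "map_pmf (class_of k p) (random_tree c X (Suc s)) =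
    bind_pmf (poisson_pmf c) (\<lambda>n. bind_pmf (replicate_pmf n (map_pmf (class_of k p) (random_tree c X s)))
      (\<lambda>xs. return_pmf (gamma k xs)))"
proof -
  have "map_pmf (class_of k p) (random_tree c X (Suc s)) =
      bind_pmf (poisson_pmf c) (\<lambda>n. map_pmf (gamma k)
        (map_pmf (map (class_of k p)) (replicate_pmf n (random_tree c X s))))"
    by (simp add: pmf.map_comp map_bind_pmf o_def)
  then show ?thesis by (simp only: map_replicate_pmf map_pmf_def[of "gamma k"])
qed

section \<open>Distributions of classes and iterates of \<open>Psi\<close>\<close>

lemma exists_pmf_dists:
  assumes "x \<in> dists k"
  shows "\<exists>X :: 'v rtree set pmf. set_pmf X \<subseteq> classes k \<and> (\<forall>i\<in>classes k. pmf X i = x i)"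
proof -
  let ?S = "classes k :: 'v rtree set set"
  let ?f = "\<lambda>i. if i \<in> ?S then x i else 0"
  have x: "\<And>i. i \<in> ?S \<Longrightarrow> 0 \<le> x i" "(\<Sum>i\<in>?S. x i) = 1" using assms by (auto simp: dists_def)
  have "(\<integral>\<^sup>+ i. ennreal (?f i) \<partial>count_space UNIV) = (\<Sum>i\<in>?S. ennreal (?f i))"
    using finite_classes by (intro nn_integral_count_space') auto
  also have "\<dots> = ennreal (\<Sum>i\<in>?S. x i)" using x(1) by (simp add: sum_ennreal)
  finally have 1: "(\<integral>\<^sup>+ i. ennreal (?f i) \<partial>count_space UNIV) = 1" using x(2) by simp
  have "pmf (embed_pmf ?f) i = ?f i" for i using x(1) 1 by (intro pmf_embed_pmf) auto
  moreover have "set_pmf (embed_pmf ?f) = {i. ?f i \<noteq> 0}" using x(1) 1 by (intro set_embed_pmf) auto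
  ultimately show ?thesis by (intro exI[of _ "embed_pmf ?f"]) (auto split: if_splits)
qed

lemma pmf_in_dists:
  assumes "set_pmf X \<subseteq> (classes k :: 'v rtree set set)" "x \<in> extensional (classes k)"
    and "\<And>i. i \<in> classes k \<Longrightarrow> pmf X i = x i"
  shows "x \<in> dists k"
proof -
  have "(\<Sum>i\<in>classes k. x i) = (\<Sum>i\<in>classes k. pmf X i)" using assms(3) by simp
  also have "\<dots> = 1" using finite_classes assms(1) by (rule sum_pmf_eq_1)
  finally have "(\<Sum>i\<in>classes k. x i) = 1" .
  moreover have "x i \<in> {0..}" if "i \<in> classes k" for i
    using assms(3)[OF that] pmf_nonneg[of X i] by simp
  ultimately show ?thesis using assms(2) by (simp add: dists_def PiE_iff)
qed

text \<open>The infinite vertex type enters through \<open>gamma_in_classes\<close>: every list of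
  classes is realised by a tree, so no probability is lost outside \<open>classes k\<close>.\<close>

lemma Psi_law:
  fixes X :: "'v rtree set pmf"
  assumes inf: "infinite (UNIV :: 'v set)" and c: "0 < c"
    and X: "set_pmf X \<subseteq> classes k" "\<And>i. i \<in> classes k \<Longrightarrow> pmf X i = x i" and x: "x \<in> dists k"
  defines "Y \<equiv> bind_pmf (poisson_pmf c) (\<lambda>n. bind_pmf (replicate_pmf n X) (\<lambda>xs. return_pmf (gamma k xs)))"
  shows "set_pmf Y \<subseteq> classes k" "\<And>j. j \<in> classes k \<Longrightarrow> pmf Y j = Psi k c x j" "Psi k c x \<in> dists k"
proof -
  show Y: "set_pmf Y \<subseteq> classes k"
    using X(1) gamma_in_classes[OF inf] unfolding Y_def by (fastforce simp: set_replicate_pmf)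
  show pY: "pmf Y j = Psi k c x j" if "j \<in> classes k" for j
    using Psi_eq_pmf[OF c x X(2) that] unfolding Y_def gamma_def by simp
  show "Psi k c x \<in> dists k"
    by (rule pmf_in_dists[OF Y]) (use pY in \<open>auto simp: Psi_def\<close>)
qed

lemma Psi_in_dists:
  fixes x :: "'v rtree set \<Rightarrow> real"
  assumes inf: "infinite (UNIV :: 'v set)" and c: "0 < c" and x: "x \<in> dists k"
  shows "Psi k c x \<in> dists k"
proof -
  obtain X :: "'v rtree set pmf" where X: "set_pmf X \<subseteq> classes k" "\<forall>i\<in>classes k. pmf X i = x i"
    using exists_pmf_dists[OF x] by blast
  show ?thesis by (rule Psi_law(3)[OF inf c X(1) _ x]) (use X(2) in blast)
qed

lemma Psi_iterate_in_dists:
  fixes x :: "'v rtree set \<Rightarrow> real"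
  assumes "infinite (UNIV :: 'v set)" "0 < c" "x \<in> dists k"
  shows "(Psi k c ^^ s) x \<in> dists k"
  by (induction s) (use assms Psi_in_dists in auto)

text \<open>The labels have a type of their own, so that one random tree labelled with pairs carries
  two starting distributions, read off with \<open>fst\<close> and \<open>snd\<close>.\<close>

lemma Psi_iterate_law:
  fixes X :: "'l pmf" and x :: "'v rtree set \<Rightarrow> real"
  assumes inf: "infinite (UNIV :: 'v set)" and c: "0 < c" and x: "x \<in> dists k"
    and X: "set_pmf (map_pmf p X) \<subseteq> classes k" "\<And>i. i \<in> classes k \<Longrightarrow> pmf (map_pmf p X) i = x i"
  shows "set_pmf (map_pmf (class_of k p) (random_tree c X s)) \<subseteq> classes k \<and>
    (\<forall>j\<in>classes k. pmf (map_pmf (class_of k p) (random_tree c X s)) j = (Psi k c ^^ s) x j)"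
proof (induction s)
  case 0
  show ?case using X by (simp add: pmf.map_comp o_def del: set_map_pmf)
next
  case (Suc s)
  from Psi_law(1,2)[OF inf c conjunct1[OF Suc] _ Psi_iterate_in_dists[OF inf c x]]
  show ?case unfolding map_class_of_random_tree using Suc by (simp del: set_bind_pmf set_map_pmf)
qed

section \<open>Probability that a fixed finite term occurs\<close>

lemma emeasure_replicate_pmf:
  "emeasure (replicate_pmf n M) {ts. set ts \<subseteq> Q} = emeasure M Q ^ n"
proof (induction n)
  case 0
  then show ?case by (simp add: indicator_def)
next
  case (Suc n)
  have "emeasure (replicate_pmf (Suc n) M) {ts. set ts \<subseteq> Q} =
      (\<integral>\<^sup>+x. \<integral>\<^sup>+xs. indicator Q x * indicator {ts. set ts \<subseteq> Q} xs \<partial>replicate_pmf n M \<partial>M)"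
    by (simp add: indicator_def if_distrib cong: if_cong)
      (intro nn_integral_cong, simp add: indicator_def)
  also have "\<dots> = (\<integral>\<^sup>+x. indicator Q x * emeasure M Q ^ n \<partial>M)"
    by (simp add: nn_integral_cmult Suc)
  also have "\<dots> = emeasure M Q * emeasure M Q ^ n"
    by (simp add: nn_integral_multc)
  finally show ?case by simp
qed

text \<open>The children are independent, so this is the generating function of the Poisson law at
  the probability of \<open>Q\<close>.\<close>

lemma measure_random_tree_Suc:
  assumes c: "0 < c"
  shows "measure_pmf.prob (random_tree c X (Suc s)) {Node ts |ts. set ts \<subseteq> Q} =
    exp (c * (measure_pmf.prob (random_tree c X s) Q - 1))"
proof -
  let ?M = "random_tree c X s"
  define q where "q = measure_pmf.prob ?M Q"
  have q: "0 \<le> q" "emeasure ?M Q = ennreal q" by (simp_all add: q_def measure_pmf.emeasure_eq_measure)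
  have "Node -` {Node ts |ts. set ts \<subseteq> Q} = {ts. set ts \<subseteq> Q}" by auto
  then have "emeasure (random_tree c X (Suc s)) {Node ts |ts. set ts \<subseteq> Q} =
      (\<integral>\<^sup>+n. ennreal (q ^ n) \<partial>poisson_pmf c)"
    by (simp add: emeasure_replicate_pmf q ennreal_power)
  also have "\<dots> = (\<Sum>n. ennreal (pmf (poisson_pmf c) n * q ^ n))"
    by (simp add: nn_integral_measure_pmf nn_integral_count_space_nat ennreal_mult' q(1))
  also have "\<dots> = ennreal (exp (c * (q - 1)))"
  proof (rule suminf_ennreal_eq)
    have "(\<lambda>n. exp (- c) * ((c * q) ^ n /\<^sub>R fact n)) sums (exp (- c) * exp (c * q))"
      by (intro sums_mult exp_converges)
    also have "exp (- c) * exp (c * q) = exp (c * (q - 1))"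
      by (simp add: mult_exp_exp algebra_simps)
    also have "(\<lambda>n. exp (- c) * ((c * q) ^ n /\<^sub>R fact n)) = (\<lambda>n. pmf (poisson_pmf c) n * q ^ n)"
      using c by (simp add: power_mult_distrib field_simps)
    finally show "(\<lambda>n. pmf (poisson_pmf c) n * q ^ n) sums exp (c * (q - 1))" .
  qed (use q(1) in simp)
  finally show ?thesis by (simp add: measure_def q_def)
qed

lemma pmf_random_tree_Node:
  assumes c: "0 < c"
  shows "pmf (random_tree c X (Suc s)) (Node ts) =
    pmf (poisson_pmf c) (length ts) * prod_list (map (pmf (random_tree c X s)) ts)"
proof -
  have "pmf (random_tree c X (Suc s)) (Node ts) =
      pmf (bind_pmf (poisson_pmf c) (\<lambda>n. replicate_pmf n (random_tree c X s))) ts"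
    unfolding random_tree.simps by (rule pmf_map_inj') (simp add: inj_def)
  also have "\<dots> = (\<integral>n. pmf (replicate_pmf n (random_tree c X s)) ts \<partial>poisson_pmf c)"
    by (simp add: pmf_bind)
  also have "\<dots> = (\<Sum>n\<in>{length ts}. pmf (replicate_pmf n (random_tree c X s)) ts * pmf (poisson_pmf c) n)"
    by (rule integral_measure_pmf_real) (auto simp: pmf_replicate_pmf split: if_splits)
  finally show ?thesis by (simp add: pmf_replicate_pmf)
qed

text \<open>On terms without leaves this is the probability of exactly that term once enough
  generations have been grown; the law of the labels does not affect it. For the universal term it
  is the constant \<open>\<delta>\<close> of the overview.\<close>

primrec weight :: "real \<Rightarrow> 'l ltree \<Rightarrow> real" where
  "weight c (Leaf l) = 0"
| "weight c (Node ts) = pmf (poisson_pmf c) (length ts) * prod_list (map (weight c) ts)"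

lemma weight_pos:
  assumes "0 < c"
  shows "set_ltree t = {} \<Longrightarrow> 0 < weight c t"
proof (induction t)
  case (Node ts)
  have "0 < prod_list (map (weight c) ts)" using Node by (induction ts) auto
  then show ?case using assms by simp
qed simp

lemma pmf_random_tree_leafless:
  assumes "0 < c"
  shows "set_ltree t = {} \<Longrightarrow> size t \<le> s \<Longrightarrow> pmf (random_tree c X s) t = weight c t"
proof (induction t arbitrary: s)
  case (Node ts)
  then obtain s' where s: "s = Suc s'" by (cases s) auto
  have "pmf (random_tree c X s') t = weight c t" if t: "t \<in> set ts" for t
  proof (rule Node.IH[OF t])
    show "set_ltree t = {}" using Node.prems(1) t by auto
    have "size t \<le> size_list size ts" using t by (intro size_list_estimation') auto
    then show "size t \<le> s'" using Node.prems(2) s by simp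
  qed
  then have "map (pmf (random_tree c X s')) ts = map (weight c) ts" by simp
  then show ?case by (simp only: s pmf_random_tree_Node[OF assms] weight.simps)
qed simp

text \<open>By convexity the secant of \<open>exp (c * (t - 1)) - \<delta>\<close> over \<open>[e, g]\<close> is not steeper than the one
  over \<open>[g, 1]\<close>, and at \<open>t = 1\<close> this function has the value \<open>1 - \<delta>\<close>.\<close>

lemma exp_secant_contraction:
  fixes c \<delta> e g e' g' :: real
  assumes c: "0 < c" and \<delta>: "0 < \<delta>" and eg: "e \<le> g" "g \<le> 1 - \<delta>" "0 \<le> g'" "g' \<le> 1 - \<delta>"
    and g': "g' = exp (c * (g - 1)) - \<delta>" and e': "e' = exp (c * (e - 1)) - \<delta>"
  shows "(g' - e') / (1 - g') \<le> (1 - \<delta>) * ((g - e) / (1 - g))"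
proof -
  \<comment> \<open>The slope of the tangent at \<open>g\<close>; by convexity this tangent lies
    below the graph at both \<open>e\<close> and \<open>1\<close>, which compares the two
    secants.\<close>
  define d where "d = c * exp (c * (g - 1))"
  have tangent: "exp (c * (g - 1)) + d * (y - g) \<le> exp (c * (y - 1))" for y
  proof -
    have "exp (c * (y - 1)) = exp (c * (g - 1)) * exp (c * (y - g))"
      by (simp add: mult_exp_exp algebra_simps)
    moreover have "exp (c * (g - 1)) * (1 + c * (y - g)) \<le> exp (c * (g - 1)) * exp (c * (y - g))"
      by (intro mult_left_mono exp_ge_add_one_self) simp
    ultimately show ?thesis by (simp add: d_def algebra_simps)
  qed
  have "d * (1 - g) \<le> 1 - g' - \<delta>" using tangent[of 1] g' by simp
  also have "\<dots> \<le> (1 - \<delta>) * (1 - g')" using \<delta> eg(3) by (simp add: algebra_simps)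
  finally have d: "d \<le> (1 - \<delta>) * (1 - g') / (1 - g)" using eg(2) \<delta> by (simp add: pos_le_divide_eq)
  have "g' - e' \<le> d * (g - e)" using tangent[of e] g' e' by (simp add: algebra_simps)
  also have "\<dots> \<le> ((1 - \<delta>) * (1 - g') / (1 - g)) * (g - e)" using d eg(1) by (intro mult_right_mono) auto
  finally show ?thesis using eg(4) \<delta> by (simp add: pos_divide_le_eq mult_ac)
qed

text \<open>The slope of \<open>exp (c * (t - 1))\<close> may exceed \<open>1\<close>, so the
  difference of the sequences need not shrink at each step. Divided by \<open>1 - g n\<close> it
  does, by the factor \<open>1 - \<delta>\<close>, and this divisor stays between
  \<open>\<delta>\<close> and \<open>1\<close>.\<close>

lemma exp_iterates_converge:
  fixes g e :: "nat \<Rightarrow> real"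
  assumes c: "0 < c" and \<delta>: "0 < \<delta>"
    and ge: "\<And>n. 0 \<le> e n" "\<And>n. e n \<le> g n" "\<And>n. g n \<le> 1 - \<delta>"
    and g: "\<And>n. g (Suc n) = exp (c * (g n - 1)) - \<delta>"
    and e: "\<And>n. e (Suc n) = exp (c * (e n - 1)) - \<delta>"
  shows "g n - e n \<le> (1 - \<delta>) ^ n / \<delta>"
proof -
  have g0: "0 \<le> g n" for n using ge(1,2)[of n] by linarith
  have \<delta>1: "\<delta> \<le> 1" using g0[of 0] ge(3)[of 0] by linarith
  have "(g n - e n) / (1 - g n) \<le> (1 - \<delta>) ^ n / \<delta>"
  proof (induction n)
    case 0
    have "g 0 - e 0 \<le> 1" using ge(1)[of 0] ge(3)[of 0] \<delta> by linarith
    then show ?case using ge(2,3)[of 0] \<delta> by (simp add: frac_le)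
  next
    case (Suc n)
    have "(g (Suc n) - e (Suc n)) / (1 - g (Suc n)) \<le> (1 - \<delta>) * ((g n - e n) / (1 - g n))"
      by (rule exp_secant_contraction[OF c \<delta> ge(2,3) g0 ge(3) g e])
    also have "\<dots> \<le> (1 - \<delta>) * ((1 - \<delta>) ^ n / \<delta>)" using Suc \<delta>1 by (intro mult_left_mono) auto
    finally show ?case by simp
  qed
  moreover have "g n - e n \<le> (g n - e n) / (1 - g n)"
  proof -
    have "0 < 1 - g n" "1 - g n \<le> 1" using ge(3)[of n] \<delta> g0[of n] by auto
    then show ?thesis using ge(2)[of n] mult_left_le[of "1 - g n" "g n - e n"]
      by (simp add: pos_le_divide_eq)
  qed
  ultimately show ?thesis by linarith
qed

lemma subterm_size: "u \<in> subterms t \<Longrightarrow> size u \<le> size t"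
proof (induction t)
  case (Node ts)
  show ?case
  proof (cases "u = Node ts")
    case False
    then obtain t where t: "t \<in> set ts" "u \<in> subterms t" using Node.prems by auto
    have "size t \<le> size_list size ts" using t by (intro size_list_estimation') auto
    then show ?thesis using Node.IH[OF t] by simp
  qed simp
qed simp

text \<open>If all children satisfy \<open>P\<close> and avoid \<open>u\<close>, so does the whole
  tree, unless it is \<open>u\<close> itself; no child of \<open>u\<close> contains
  \<open>u\<close>, by size. The predicate \<open>P\<close> allows the same recursion for all trees
  and for extinct trees.\<close>

lemma prob_subterm_free_Suc:
  assumes c: "0 < c" and u: "set_ltree u = {}" "P u"
    and P: "\<And>ts. P (Node ts) \<longleftrightarrow> (\<forall>t\<in>set ts. P t)"
  shows "measure_pmf.prob (random_tree c X (Suc s)) {t. P t \<and> u \<notin> subterms t} =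
    exp (c * (measure_pmf.prob (random_tree c X s) {t. P t \<and> u \<notin> subterms t} - 1)) -
      pmf (random_tree c X (Suc s)) u"
proof -
  let ?M = "random_tree c X (Suc s)" and ?Q = "{t. P t \<and> u \<notin> subterms t}"
  obtain us where us: "u = Node us" using u(1) by (cases u) auto
  have self: "u \<notin> subterms t" if "t \<in> set us" for t
  proof
    assume "u \<in> subterms t"
    then have "size u \<le> size t" by (rule subterm_size)
    moreover have "size t \<le> size_list size us" using that by (intro size_list_estimation') auto
    ultimately show False by (simp add: us)
  qed
  have eq: "{Node ts |ts. set ts \<subseteq> ?Q} = ({Node ts |ts. True} \<inter> ?Q) \<union> {u}"
  proof (intro equalityI subsetI)
    fix t assume "t \<in> {Node ts |ts. set ts \<subseteq> ?Q}"
    then show "t \<in> ({Node ts |ts. True} \<inter> ?Q) \<union> {u}" by (auto simp: P)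
  next
    fix t assume "t \<in> ({Node ts |ts. True} \<inter> ?Q) \<union> {u}"
    then show "t \<in> {Node ts |ts. set ts \<subseteq> ?Q}" using self u(2) by (auto simp: P us)
  qed
  have "measure_pmf.prob ?M ?Q = measure_pmf.prob ?M ({Node ts |ts. True} \<inter> ?Q)"
    by (rule measure_pmf.finite_measure_eq_AE) (auto simp: AE_measure_pmf_iff)
  moreover have "measure_pmf.prob ?M {Node ts |ts. set ts \<subseteq> ?Q} =
      measure_pmf.prob ?M ({Node ts |ts. True} \<inter> ?Q) + measure_pmf.prob ?M {u}"
  proof -
    have "u \<in> subterms u" by (cases u) auto
    then show ?thesis unfolding eq by (intro measure_pmf.finite_measure_Union) auto
  qed
  ultimately show ?thesis
    using measure_random_tree_Suc[OF c, of X s ?Q] by (simp add: measure_pmf_single del: random_tree.simps)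
qed

text \<open>Starting at level \<open>size u\<close> gives \<open>u\<close> the probability
  \<open>weight c u\<close> at every later level, so both recursions subtract the same constant. The
  event is the difference of the one measured by \<open>g\<close> and the one measured by
  \<open>e\<close>.\<close>

lemma prob_undetermined:
  assumes c: "0 < c" and u: "set_ltree u = {}"
  shows "measure_pmf.prob (random_tree c X (size u + n)) {t. set_ltree t \<noteq> {} \<and> u \<notin> subterms t}
    \<le> (1 - weight c u) ^ n / weight c u"
proof -
  let ?M = "\<lambda>n. random_tree c X (size u + n)"
  define g where "g n = measure_pmf.prob (?M n) {t. True \<and> u \<notin> subterms t}" for n
  define e where "e n = measure_pmf.prob (?M n) {t. set_ltree t = {} \<and> u \<notin> subterms t}" for n
  have w: "pmf (?M n) u = weight c u" for n by (rule pmf_random_tree_leafless[OF c u]) simp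
  have "g n - e n \<le> (1 - weight c u) ^ n / weight c u"
  proof (rule exp_iterates_converge[OF c weight_pos[OF c u]])
    show "0 \<le> e n" for n by (simp add: e_def)
    show "e n \<le> g n" for n unfolding e_def g_def by (intro measure_pmf.finite_measure_mono) auto
    show "g n \<le> 1 - weight c u" for n
    proof -
      have "u \<in> subterms u" by (cases u) auto
      then have "g n \<le> measure_pmf.prob (?M n) (UNIV - {u})"
        unfolding g_def by (intro measure_pmf.finite_measure_mono) auto
      also have "\<dots> = 1 - weight c u"
        using measure_pmf.prob_compl[of "{u}" "?M n"] by (simp add: measure_pmf_single w)
      finally show ?thesis .
    qed
    show "g (Suc n) = exp (c * (g n - 1)) - weight c u" for n
      using prob_subterm_free_Suc[OF c u, of "\<lambda>_. True" X "size u + n"] w[of "Suc n"]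
      unfolding g_def by simp
    show "e (Suc n) = exp (c * (e n - 1)) - weight c u" for n
      using prob_subterm_free_Suc[OF c u, of "\<lambda>t. set_ltree t = {}" X "size u + n"] w[of "Suc n"] u
      unfolding e_def by simp
  qed
  moreover have "measure_pmf.prob (?M n) {t. set_ltree t \<noteq> {} \<and> u \<notin> subterms t} = g n - e n"
  proof -
    have "{t. set_ltree t \<noteq> {} \<and> u \<notin> subterms t} =
        {t. True \<and> u \<notin> subterms t} - {t. set_ltree t = {} \<and> u \<notin> subterms t}" by auto
    then show ?thesis unfolding g_def e_def
      by (simp only:) (intro measure_pmf.finite_measure_Diff, auto)
  qed
  ultimately show ?thesis by simp
qed

section \<open>Coupling and merging of the iterates\<close>

lemma pmf_map_diff_le:
  "\<bar>pmf (map_pmf f M) j - pmf (map_pmf h M) j\<bar> \<le> measure_pmf.prob M {t. f t \<noteq> h t}"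
proof -
  have *: "pmf (map_pmf f M) j \<le> pmf (map_pmf h M) j + measure_pmf.prob M {t. f t \<noteq> h t}" for f h
  proof -
    have "pmf (map_pmf f M) j = measure_pmf.prob M (f -` {j})" by (simp add: pmf_map)
    also have "\<dots> \<le> measure_pmf.prob M (h -` {j} \<union> {t. f t \<noteq> h t})"
      by (intro measure_pmf.finite_measure_mono) auto
    also have "\<dots> \<le> measure_pmf.prob M (h -` {j}) + measure_pmf.prob M {t. f t \<noteq> h t}"
      by (intro measure_Un_le) auto
    finally show ?thesis by (simp add: pmf_map)
  qed
  have "{t. h t \<noteq> f t} = {t. f t \<noteq> h t}" by auto
  then show ?thesis using *[of f h] *[of h f] by (simp add: abs_le_iff)
qed

text \<open>Both distributions are read off one random tree whose leaves carry independent pairs of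
  labels. The two classes of the root agree if there is no leaf or if \<open>u\<close> occurs. The
  bound is uniform because \<open>u\<close> and its weight do not depend on \<open>x\<close> and
  \<open>y\<close>.\<close>

lemma Psi_iterates_merge:
  assumes inf: "infinite (UNIV :: 'v set)" and c: "0 < c"
  shows "\<exists>\<epsilon> N. \<epsilon> \<longlonglongrightarrow> 0 \<and> (\<forall>x\<in>dists k. \<forall>y\<in>dists k. \<forall>s\<ge>N. \<forall>j\<in>classes k.
    \<bar>(Psi k c ^^ s) x j - (Psi k c ^^ s) y (j :: 'v rtree set)\<bar> \<le> \<epsilon> s)"
proof -
  obtain u :: "('v rtree set \<times> 'v rtree set) ltree" where u: "set_ltree u = {}"
    "\<forall>f :: 'v rtree set \<times> 'v rtree set \<Rightarrow> 'v rtree. universal k (tree_of f u)"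
    using exists_universal_term[OF inf, of k] by (elim exE conjE)
  let ?w = "weight c u"
  have w: "0 < ?w" using weight_pos[OF c u(1)] .
  have w1: "?w \<le> 1"
    using pmf_random_tree_leafless[OF c u(1) order.refl] pmf_le_1 by metis
  \<comment> \<open>From \<open>size u\<close> on the estimate of \<open>prob_undetermined\<close>
    applies, and beyond \<open>radius k\<close> the leaves are out of reach for
    \<open>class_of_eq\<close>.\<close>
  let ?N = "max (size u) (Suc (radius k))"
  define \<epsilon> where "\<epsilon> s = (1 - ?w) ^ (s - size u) / ?w" for s
  have "(\<lambda>n. (1 - ?w) ^ n / ?w) \<longlonglongrightarrow> 0 / ?w"
    using w w1 by (intro tendsto_divide LIMSEQ_power_zero tendsto_const) auto
  then have "(\<lambda>s. \<epsilon> (s + size u)) \<longlonglongrightarrow> 0" by (simp add: \<epsilon>_def)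
  then have "\<epsilon> \<longlonglongrightarrow> 0" by (rule LIMSEQ_offset)
  moreover have "\<bar>(Psi k c ^^ s) x j - (Psi k c ^^ s) y j\<bar> \<le> \<epsilon> s"
    if x: "x \<in> dists k" and y: "y \<in> dists k" and s: "?N \<le> s" and j: "j \<in> classes k"
    for x y :: "'v rtree set \<Rightarrow> real" and s j
  proof -
    obtain X :: "'v rtree set pmf" where X: "set_pmf X \<subseteq> classes k" "\<forall>i\<in>classes k. pmf X i = x i"
      using exists_pmf_dists[OF x] by blast
    obtain Y :: "'v rtree set pmf" where Y: "set_pmf Y \<subseteq> classes k" "\<forall>i\<in>classes k. pmf Y i = y i"
      using exists_pmf_dists[OF y] by blast
    let ?M = "random_tree c (pair_pmf X Y) s"
    have 1: "pmf (map_pmf (class_of k fst) ?M) j = (Psi k c ^^ s) x j"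
      using Psi_iterate_law[OF inf c x, of fst "pair_pmf X Y" s] X j by (simp add: map_fst_pair_pmf)
    have 2: "pmf (map_pmf (class_of k snd) ?M) j = (Psi k c ^^ s) y j"
      using Psi_iterate_law[OF inf c y, of snd "pair_pmf X Y" s] Y j by (simp add: map_snd_pair_pmf)
    have det: "class_of k fst t = class_of k snd t"
      if t: "t \<in> set_pmf ?M" "\<not> (set_ltree t \<noteq> {} \<and> u \<notin> subterms t)" for t
    proof (cases "set_ltree t = {}")
      case True
      then show ?thesis by (intro class_of_cong) auto
    next
      case False
      have lt: "leaves_at s t" "set_ltree t \<subseteq> set_pmf (pair_pmf X Y)"
        using set_random_tree[OF c t(1)] by auto
      have l: "fst l \<in> classes k" "snd l \<in> classes k" if "l \<in> set_ltree t" for l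
        using subsetD[OF lt(2) that] X(1) Y(1) by (auto simp: mem_Times_iff)
      show ?thesis
        by (rule class_of_eq[OF inf _ u(2)[rule_format] lt(1) _ l]) (use False t(2) s in auto)
    qed
    have "\<bar>(Psi k c ^^ s) x j - (Psi k c ^^ s) y j\<bar>
        \<le> measure_pmf.prob ?M {t. class_of k fst t \<noteq> class_of k snd t}"
      using pmf_map_diff_le[of "class_of k fst" ?M j "class_of k snd"] by (simp add: 1 2)
    also have "\<dots> \<le> measure_pmf.prob ?M {t. set_ltree t \<noteq> {} \<and> u \<notin> subterms t}"
      by (intro measure_pmf.finite_measure_mono_AE) (use det in \<open>auto simp: AE_measure_pmf_iff\<close>)
    also have "\<dots> \<le> \<epsilon> s"
      using prob_undetermined[OF c u(1), of "pair_pmf X Y" "s - size u"] s by (simp add: \<epsilon>_def)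
    finally show ?thesis .
  qed
  ultimately show ?thesis by blast
qed

section \<open>Existence and uniqueness of the fixed point\<close>

lemma dists_nonempty: "(dists k :: ('v rtree set \<Rightarrow> real) set) \<noteq> {}"
proof -
  let ?T = "\<lparr>verts = {undefined}, root = undefined, parent = {}\<rparr> :: 'v rtree"
  have "rooted_tree ?T" by (simp add: rooted_tree_def)
  then have "set_pmf (return_pmf (EV k ?T)) \<subseteq> classes k" by (simp add: EV_in_classes)
  then have "restrict (pmf (return_pmf (EV k ?T))) (classes k) \<in> dists k"
    by (rule pmf_in_dists) auto
  then show ?thesis by blast
qed

lemma tendsto_cnt_prob:
  assumes "f \<longlonglongrightarrow> r"
  shows "(\<lambda>n. cnt_prob k (f n) a) \<longlonglongrightarrow> cnt_prob k r a"
  by (cases a) (auto intro!: tendsto_intros assms)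

lemma tendsto_Psi:
  assumes "\<And>i. i \<in> classes k \<Longrightarrow> (\<lambda>n. x n i) \<longlonglongrightarrow> L i" "j \<in> classes k"
  shows "(\<lambda>n. Psi k c (x n) j) \<longlonglongrightarrow> Psi k c L (j :: 'v rtree set)"
  using assms unfolding Psi_def
  by (auto intro!: tendsto_sum tendsto_prod tendsto_cnt_prob tendsto_mult tendsto_const)

text \<open>Merging, applied to \<open>x0\<close> and its own iterates, makes every coordinate of
  the orbit a Cauchy sequence. The limit is a distribution because the classes are finite in number,
  and it is fixed because \<open>Psi k c\<close> is continuous. A fixed point equals all its
  iterates, so merging also gives uniqueness.\<close>

theorem theorem7p1:
  fixes k :: nat and c :: real
  assumes "infinite (UNIV :: 'v set)"
    and "k \<ge> 1" and "c > 0"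
  shows "(Psi k c :: ('v rtree set \<Rightarrow> real) \<Rightarrow> ('v rtree set \<Rightarrow> real)) \<in> dists k \<rightarrow> dists k \<and>
    (\<exists>!x :: 'v rtree set \<Rightarrow> real. x \<in> dists k \<and> Psi k c x = x)"
proof (intro conjI)
  let ?D = "dists k :: ('v rtree set \<Rightarrow> real) set" and ?S = "classes k :: 'v rtree set set"
  note it = Psi_iterate_in_dists[OF assms(1,3)]
  show "Psi k c \<in> ?D \<rightarrow> ?D" using Psi_in_dists[OF assms(1,3)] by blast
  obtain \<epsilon> N where \<epsilon>: "\<epsilon> \<longlonglongrightarrow> 0" and merge:
    "\<And>x y s j. x \<in> ?D \<Longrightarrow> y \<in> ?D \<Longrightarrow> N \<le> s \<Longrightarrow> j \<in> ?S \<Longrightarrow>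
      \<bar>(Psi k c ^^ s) x j - (Psi k c ^^ s) y j\<bar> \<le> \<epsilon> s"
    using Psi_iterates_merge[OF assms(1,3), of k] by blast
  obtain x0 where x0: "x0 \<in> ?D" using dists_nonempty by blast
  define x where "x s = (Psi k c ^^ s) x0" for s
  have "Cauchy (\<lambda>s. x s j)" if j: "j \<in> ?S" for j
  proof (rule metric_CauchyI)
    fix r :: real assume "0 < r"
    then have "\<forall>\<^sub>F s in sequentially. \<epsilon> s < r / 2" using \<epsilon> by (intro order_tendstoD) auto
    then obtain M where M: "\<And>s. M \<le> s \<Longrightarrow> \<epsilon> s < r / 2" by (auto simp: eventually_sequentially)
    let ?m = "max M N"
    have near: "\<bar>x s j - x ?m j\<bar> < r / 2" if "?m \<le> s" for s
    proof -
      \<comment> \<open>Hence \<open>x s\<close> and \<open>x ?m\<close> are both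
        \<open>?m\<close>-th iterates of distributions, and the bound at \<open>?m\<close> covers
        all later \<open>s\<close> at once.\<close>
      have "x s = (Psi k c ^^ ?m) ((Psi k c ^^ (s - ?m)) x0)"
        unfolding x_def using that by (metis comp_apply funpow_add le_add_diff_inverse)
      then have "\<bar>x s j - x ?m j\<bar> \<le> \<epsilon> ?m"
        using merge[OF it[OF x0] x0 _ j, of ?m "s - ?m"] by (simp add: x_def)
      then show ?thesis using M[of ?m] by simp
    qed
    show "\<exists>M. \<forall>m\<ge>M. \<forall>n\<ge>M. dist (x m j) (x n j) < r"
    proof (intro exI[of _ ?m] allI impI)
      fix m n assume mn: "?m \<le> m" "?m \<le> n"
      show "dist (x m j) (x n j) < r" using near[OF mn(1)] near[OF mn(2)] unfolding dist_real_def by arith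
    qed
  qed
  then have "\<forall>j\<in>?S. \<exists>l. (\<lambda>s. x s j) \<longlonglongrightarrow> l" using Cauchy_convergent convergent_def by blast
  then obtain l where l: "\<And>j. j \<in> ?S \<Longrightarrow> (\<lambda>s. x s j) \<longlonglongrightarrow> l j" by metis
  define L where "L = restrict l ?S"
  have L: "(\<lambda>s. x s j) \<longlonglongrightarrow> L j" if "j \<in> ?S" for j using l[OF that] that by (simp add: L_def)
  have xD: "x s \<in> ?D" for s unfolding x_def by (rule it[OF x0])
  have "0 \<le> L j" if "j \<in> ?S" for j
  proof (rule LIMSEQ_le_const[OF L[OF that]])
    have "0 \<le> x s j" for s using xD[of s] that by (auto simp: dists_def)
    then show "\<exists>N. \<forall>n\<ge>N. 0 \<le> x n j" by blast
  qed
  moreover have "(\<Sum>j\<in>?S. L j) = 1"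
  proof (rule LIMSEQ_unique)
    show "(\<lambda>s. \<Sum>j\<in>?S. x s j) \<longlonglongrightarrow> (\<Sum>j\<in>?S. L j)" using L by (rule tendsto_sum)
    have "(\<Sum>j\<in>?S. x s j) = 1" for s using xD[of s] by (simp add: dists_def)
    then show "(\<lambda>s. \<Sum>j\<in>?S. x s j) \<longlonglongrightarrow> 1" by simp
  qed
  ultimately have LD: "L \<in> ?D" by (auto simp: dists_def L_def)
  have "Psi k c L j = L j" if j: "j \<in> ?S" for j
  proof (rule LIMSEQ_unique)
    show "(\<lambda>s. Psi k c (x s) j) \<longlonglongrightarrow> Psi k c L j" using L j by (rule tendsto_Psi)
    have "(\<lambda>s. x (Suc s) j) \<longlonglongrightarrow> L j" using L[OF j] by (rule LIMSEQ_Suc)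
    then show "(\<lambda>s. Psi k c (x s) j) \<longlonglongrightarrow> L j" by (simp add: x_def)
  qed
  then have fixL: "Psi k c L = L"
    by (intro extensionalityI[of _ ?S]) (auto simp: Psi_def L_def)
  show "\<exists>!x. x \<in> ?D \<and> Psi k c x = x"
  proof (rule ex1I[of _ L])
    show "L \<in> ?D \<and> Psi k c L = L" using LD fixL by simp
    fix y assume y: "y \<in> ?D \<and> Psi k c y = y"
    have funpow: "(Psi k c ^^ s) z = z" if "Psi k c z = z" for z :: "'v rtree set \<Rightarrow> real" and s
      by (induction s) (use that in auto)
    have "y j = L j" if j: "j \<in> ?S" for j
    proof -
      have "\<bar>y j - L j\<bar> \<le> \<epsilon> s" if "N \<le> s" for s
        using merge[OF conjunct1[OF y] LD that j] funpow y fixL by simp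
      then have "\<bar>y j - L j\<bar> \<le> 0" by (intro LIMSEQ_le_const[OF \<epsilon>]) blast
      then show ?thesis by simp
    qed
    then show "y = L"
      using y by (intro extensionalityI[of _ ?S]) (auto simp: dists_def PiE_def L_def)
  qed
qed

end
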